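(* Assume the setting below, on the Shishkin mesh $S_N$ (i.e. $\lambda=N$) with mesh parameter $a\ge\min\{3,\max\{1,a_*\}\}$, where $a_*=\beta/(b(0)-\beta)$. Then \[ \|w^N-W^N\|\le C\max\left\{\varepsilon N^{-2}(\ln N)^2,\ \varepsilon N^{-1}+N^{-(a+1)/2}\right\}, \] with $C$ independent of $\varepsilon$ and $N$.
   Context: Let $0<\varepsilon<1$. Let $b,c,f\in C^4[0,1]$, and let $\beta$ be a constant with $b(x)>\beta>0$ and $c(x)\ge0$ on $[0,1]$. Let $u$ be the solution of $-\varepsilon u''-bu'+cu=f$ on $(0,1)$ with $u(0)=u(1)=0$. Let $u_0$ be the solution of $-bu_0'+cu_0=f$ on $(0,1)$ with $u_0(1)=0$ (assumed known exactly). Set $w=u-u_0$; it solves $-\varepsilon w''-bw'+cw=\varepsilon u_0''$, $w(0)=-u_0(0)$, $w(1)=0$. Mesh $S_\lambda$, $\lambda\in\{N,\varepsilon^{-1}\}$. $N$ is a positive integer. $Q\in(0,1)$ is a fixed rational with $J=QN$ an integer, and $a>0$. Set $\xi=(a\varepsilon/\beta)\ln\lambda$, assumed $\le Q$, and $h=\xi/J$, $H=(1-\xi)/(N-J)$. The mesh points are $x_i=ih$ ($0\le i\le J$) and $x_i=\xi+(i-J)H$ ($J\le i\le N$). Write $h_i=x_i-x_{i-1}$ and $\hbar_i=(h_i+h_{i+1})/2$. Scheme. $D^+U_i=(U_{i+1}-U_i)/h_{i+1}$, $D^-U_i=(U_i-U_{i-1})/h_i$, $D''U_i=(D^+U_i-D^-U_i)/\hbar_i$.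 Let $\sigma(\rho)=2\rho/(e^{2\rho}-1)$ for $\rho>0$, $\sigma(0)=1$, and $\rho_i=b(x_i)h_{i+1}/(2\varepsilon)$. The ASI operator is $L^NU_i=-\varepsilon\sigma(\rho_i)D''U_i-b(x_i)D^+U_i+c(x_i)U_i$. $W^N$ solves $W^N_0=-u_0(0)$, $L^NW^N_i=\varepsilon u_0''(x_i)$ for $1\le i\le N-1$, $W^N_N=0$. $w^N$ is the restriction of $w$ to the mesh, and $\|U\|=\max_{0\le i\le N}|U_i|$. *)

theory Defs
  imports "HOL-Analysis.Analysis"
begin

definition Ck_on :: "nat \<Rightarrow> real set \<Rightarrow> (real \<Rightarrow> real) \<Rightarrow> bool" where
  "Ck_on k S f \<longleftrightarrow> (\<exists>g::nat \<Rightarrow> real \<Rightarrow> real.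
     (\<forall>x\<in>S. g 0 x = f x) \<and>
     (\<forall>j<k. \<forall>x\<in>S. (g j has_real_derivative g (Suc j) x) (at x within S)) \<and>
     (\<forall>j\<le>k. continuous_on S (g j)))"

definition sigma :: "real \<Rightarrow> real" where
  "sigma \<rho> = (if \<rho> = 0 then 1 else 2 * \<rho> / (exp (2 * \<rho>) - 1))"

definition mesh :: "real \<Rightarrow> nat \<Rightarrow> nat \<Rightarrow> nat \<Rightarrow> real" where
  "mesh \<xi> J N i = (if i \<le> J then real i * (\<xi> / real J)
                    else \<xi> + real (i - J) * ((1 - \<xi>) / real (N - J)))"

definition shishkin_xi :: "real \<Rightarrow> real \<Rightarrow> real \<Rightarrow> nat \<Rightarrow> real" where
  "shishkin_xi a \<beta> \<epsilon> N = a * \<epsilon> / \<beta> * ln (real N)"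

definition asi_op :: "real \<Rightarrow> (real \<Rightarrow> real) \<Rightarrow> (real \<Rightarrow> real) \<Rightarrow> (nat \<Rightarrow> real)
                      \<Rightarrow> (nat \<Rightarrow> real) \<Rightarrow> nat \<Rightarrow> real" where
  "asi_op \<epsilon> b c x U i =
     (let hi = x i - x (i - 1);
          hi1 = x (Suc i) - x i;
          hb = (hi + hi1) / 2;
          Dp = (U (Suc i) - U i) / hi1;
          Dm = (U i - U (i - 1)) / hi;
          D2 = (Dp - Dm) / hb;
          \<rho> = b (x i) * hi1 / (2 * \<epsilon>)
      in - \<epsilon> * sigma \<rho> * D2 - b (x i) * Dp + c (x i) * U i)"

end

theory Submission
  imports Defs
begin

text \<open>Write \<open>w = u - u\<^sub>0\<close> and \<open>E x = exp (- \<beta> x / \<epsilon>)\<close>.  A maximum principle and the equation give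
  \<open>\<bar>w\<bar> \<le> C (\<epsilon> + E)\<close>, \<open>\<bar>w'\<bar> \<le> C (\<epsilon> + E/\<epsilon>)\<close> and \<open>\<bar>w''\<bar> \<le> C (1 + E/\<epsilon>\<^sup>2)\<close>.  On a uniform mesh of width \<open>h\<close>
  the scheme with coefficient frozen at \<open>b x\<^sub>i\<close> is exact for \<open>- \<epsilon> v'' - b x\<^sub>i v'\<close> and is a positive
  functional of this source.  So the consistency error is an average of the variation of
  \<open>\<epsilon> g - c w + (b - b x\<^sub>i) w'\<close> (\<open>g = u\<^sub>0''\<close>) around \<open>x\<^sub>i\<close>, which is
  \<open>O(\<epsilon> h + h\<^sup>2 + (h + h\<^sup>2/\<epsilon>\<^sup>2) E x\<^sub>i)\<close> in the fine part and \<open>O(\<epsilon> H + E x\<^sub>i)\<close> in the coarse part.  At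
  the transition point, where the scheme is not exact, the error is
  \<open>O((\<epsilon> (h + H) + E x\<^sub>J) / (H + \<epsilon>))\<close>.
  The discrete minimum principle with the barriers \<open>1 - x\<^sub>i\<close> and
  \<open>\<Prod>\<^sub>j 1 / (1 + \<beta> (x\<^sub>j - x\<^bsub>j-1\<^esub>) / (2 \<epsilon>))\<close>, the product taken over \<open>j > 0\<close> or over \<open>j > J\<close>, turns this into
  an error \<open>O(\<epsilon> N\<^sup>-\<^sup>1 + \<epsilon> N\<^sup>-\<^sup>2 (ln N)\<^sup>2 + N\<^sup>-\<^sup>a)\<close>; finally \<open>a \<ge> 1\<close> gives \<open>N\<^sup>-\<^sup>a \<le> N powr (- (a + 1) / 2)\<close>.\<close>

section \<open>Calculus on the unit interval\<close>

text \<open>The obstacle is that a coarse step \<open>H\<close> need not be small compared with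
  \<epsilon>, so Taylor expansion of the layer is useless there. Everything rests on a uniform gap
  between \<beta> and a lower bound \<beta>1 of \<open>b\<close>: it leaves room for exponents on
  both sides of \<beta>, yields a supersolution for \<open>w'\<close>, and gives the product
  barriers a positive image. These barriers decay at the halved rate
  \<open>\<beta> / (2 \<epsilon>)\<close> because the forward step divided by the mean of the two
  steps can approach 2 at the transition point. The loss is harmless: the barrier only has to
  dominate \<open>E\<close> in the fine part. The image of a barrier is of the order of its next
  value divided by \<epsilon>, so layer errors gain a factor \<epsilon>: \<open>h E\<close> costs
  only \<open>\<epsilon> h\<close>, and \<open>h\<^sup>2 E / \<epsilon>\<^sup>2\<close> costs
  \<open>h\<^sup>2 / \<epsilon>\<close>, the origin of the term with the squared logarithm.\<close>

lemma Ck_on_two_derivs: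
  assumes "Ck_on k {0..1} f" "2 \<le> k"
  obtains f1 f2 where
    "continuous_on {0..1} f" "continuous_on {0..1} f1" "continuous_on {0..1} f2"
    "\<And>x. x \<in> {0<..<1} \<Longrightarrow> (f has_real_derivative f1 x) (at x)"
    "\<And>x. x \<in> {0<..<1} \<Longrightarrow> (f1 has_real_derivative f2 x) (at x)"
proof -
  obtain G :: "nat \<Rightarrow> real \<Rightarrow> real" where G0: "\<And>x. x \<in> {0..1} \<Longrightarrow> G 0 x = f x"
    and Gd: "\<And>j x. j < k \<Longrightarrow> x \<in> {0..1} \<Longrightarrow> (G j has_real_derivative G (Suc j) x) (at x within {0..1})"
    and Gc: "\<And>j. j \<le> k \<Longrightarrow> continuous_on {0..1} (G j)"
    using assms(1) unfolding Ck_on_def by blast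
  have at: "at x within {0..1} = at x" if "x \<in> {0<..<1}" for x :: real
    using that by (intro at_within_interior) simp
  have d: "(G j has_real_derivative G (Suc j) x) (at x)" if "j < k" "x \<in> {0<..<1}" for j x
    using Gd[of j x] that at[of x] by simp
  show thesis
  proof (rule that[of "G 1" "G 2"])
    show "continuous_on {0..1} f"
      using continuous_on_eq[of "{0..1}" "G 0" f] Gc[of 0] G0 by simp
    show "continuous_on {0..1} (G 1)" "continuous_on {0..1} (G 2)" using Gc assms(2) by auto
    show "(f has_real_derivative G 1 x) (at x)" if x: "x \<in> {0<..<1}" for x
    proof -
      have "(G 0 has_real_derivative G 1 x) (at x)" using d[of 0 x] assms(2) x by simp
      \<comment> \<open>\<open>f\<close> and \<open>G 0\<close> are known to agree only on the unit
        interval, so the two-sided derivative is transferred through an open neighbourhood inside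
        it.\<close>
      then show ?thesis
        by (rule DERIV_cong_ev[THEN iffD1, rotated -1])
          (use x G0 in \<open>auto simp: eventually_nhds intro!: exI[of _ "{0<..<1}"]\<close>)
    qed
    show "(G 1 has_real_derivative G 2 x) (at x)" if "x \<in> {0<..<1}" for x
      using d[of 1 x] assms(2) that by (simp add: numeral_2_eq_2)
  qed
qed

lemma abs_diff_le_of_deriv:
  fixes f F :: "real \<Rightarrow> real"
  assumes "x \<le> s" "continuous_on {x..s} f" "continuous_on {x..s} F"
    and f: "\<And>t. x < t \<Longrightarrow> t < s \<Longrightarrow> (f has_real_derivative f' t) (at t)"
    and F: "\<And>t. x < t \<Longrightarrow> t < s \<Longrightarrow> (F has_real_derivative F' t) (at t)"
    and le: "\<And>t. x < t \<Longrightarrow> t < s \<Longrightarrow> \<bar>f' t\<bar> \<le> F' t"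
  shows "\<bar>f s - f x\<bar> \<le> F s - F x"
proof -
  have 1: "F x - f x \<le> F s - f s"
  proof (rule DERIV_nonneg_imp_increasing_open[OF assms(1)])
    fix t assume t: "x < t" "t < s"
    show "\<exists>y. ((\<lambda>t. F t - f t) has_real_derivative y) (at t) \<and> 0 \<le> y"
      using le[OF t] by (intro exI[of _ "F' t - f' t"] conjI DERIV_diff f F t) auto
  qed (use assms in \<open>auto intro!: continuous_intros\<close>)
  have 2: "F x + f x \<le> F s + f s"
  proof (rule DERIV_nonneg_imp_increasing_open[OF assms(1)])
    fix t assume t: "x < t" "t < s"
    show "\<exists>y. ((\<lambda>t. F t + f t) has_real_derivative y) (at t) \<and> 0 \<le> y"
      using le[OF t] by (intro exI[of _ "F' t + f' t"] conjI DERIV_add f F t) auto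
  qed (use assms in \<open>auto intro!: continuous_intros\<close>)
  from 1 2 show ?thesis by linarith
qed

lemma abs_diff_le_of_deriv_bound:
  fixes f :: "real \<Rightarrow> real"
  assumes "x \<le> s" "continuous_on {x..s} f"
    and "\<And>t. x < t \<Longrightarrow> t < s \<Longrightarrow> (f has_real_derivative f' t) (at t)"
    and "\<And>t. x < t \<Longrightarrow> t < s \<Longrightarrow> \<bar>f' t\<bar> \<le> B"
  shows "\<bar>f s - f x\<bar> \<le> B * (s - x)"
proof -
  have "\<bar>f s - f x\<bar> \<le> B * s - B * x"
    by (rule abs_diff_le_of_deriv[where F' = "\<lambda>_. B"])
      (use assms in \<open>auto intro!: continuous_intros derivative_eq_intros\<close>)
  then show ?thesis by (simp add: algebra_simps)
qed

lemma abs_diff_le_on: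
  fixes f f' :: "real \<Rightarrow> real"
  assumes f: "\<And>x. x \<in> {l<..<u} \<Longrightarrow> (f has_real_derivative f' x) (at x)"
    and bd: "\<And>x. x \<in> {l<..<u} \<Longrightarrow> \<bar>f' x\<bar> \<le> B"
    and st: "s \<in> {l<..<u}" "t \<in> {l<..<u}"
  shows "\<bar>f s - f t\<bar> \<le> B * \<bar>s - t\<bar>"
proof -
  have *: "\<bar>f s - f t\<bar> \<le> B * (s - t)" if "t \<le> s" "s \<in> {l<..<u}" "t \<in> {l<..<u}" for s t
  proof (rule abs_diff_le_of_deriv_bound[OF that(1), where f' = f'])
    show "continuous_on {t..s} f"
      using that by (intro continuous_at_imp_continuous_on ballI DERIV_isCont[OF f]) auto
  qed (use that f bd in auto)
  show ?thesis using *[of t s] *[of s t] st by (cases "t \<le> s") (auto simp: abs_minus_commute)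
qed

text \<open>The function \<open>r \<mapsto> f r - f' t * r\<close> has derivative at most
  \<open>L * \<bar>s - t\<bar>\<close> between \<open>s\<close> and \<open>t\<close>. This uses no
  second derivative, at the price of \<open>L\<close> instead of \<open>L / 2\<close>.\<close>

lemma abs_taylor_le:
  fixes f f' :: "real \<Rightarrow> real"
  assumes f: "\<And>x. x \<in> {l<..<u} \<Longrightarrow> (f has_real_derivative f' x) (at x)"
    and L: "\<And>x y. x \<in> {l<..<u} \<Longrightarrow> y \<in> {l<..<u} \<Longrightarrow> \<bar>f' x - f' y\<bar> \<le> L * \<bar>x - y\<bar>"
    and L0: "0 \<le> L" and s: "s \<in> {l<..<u}" and t: "t \<in> {l<..<u}"
  shows "\<bar>f s - f t - f' t * (s - t)\<bar> \<le> L * (s - t)\<^sup>2"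
proof -
  have *: "\<bar>(f r - f' t * r) - (f q - f' t * q)\<bar> \<le> (L * \<bar>s - t\<bar>) * (r - q)"
    if "q \<le> r" "{q, r} = {s, t}" for q r
  proof (rule abs_diff_le_of_deriv_bound[OF that(1), where f' = "\<lambda>x. f' x - f' t"])
    have I: "x \<in> {l<..<u}" if "x \<in> {q..r}" for x using s t that \<open>{q, r} = {s, t}\<close>
      by (auto simp: doubleton_eq_iff)
    show "continuous_on {q..r} (\<lambda>r. f r - f' t * r)"
      using I by (intro continuous_intros continuous_at_imp_continuous_on ballI DERIV_isCont[OF f])
    fix x assume "q < x" "x < r"
    then have x: "x \<in> {q..r}" by auto
    show "((\<lambda>r. f r - f' t * r) has_real_derivative f' x - f' t) (at x)"
      by (auto intro!: derivative_eq_intros f[OF I[OF x]])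
    have "\<bar>f' x - f' t\<bar> \<le> L * \<bar>x - t\<bar>" by (rule L[OF I[OF x] t])
    also have "\<dots> \<le> L * \<bar>s - t\<bar>"
      using L0 x that by (intro mult_left_mono) (auto simp: doubleton_eq_iff)
    finally show "\<bar>f' x - f' t\<bar> \<le> L * \<bar>s - t\<bar>" .
  qed
  have "\<bar>(f s - f' t * s) - (f t - f' t * t)\<bar> \<le> (L * \<bar>s - t\<bar>) * \<bar>s - t\<bar>"
    using *[of t s] *[of s t] by (cases "t \<le> s") (auto simp: abs_minus_commute insert_commute)
  then show ?thesis by (simp add: algebra_simps power2_eq_square abs_mult_self_eq)
qed

text \<open>The second derivative of the reduced solution is an algebraic expression in the data,
  their first derivatives and \<open>u0\<close>. Closure of this class under differences, products
  and reciprocals bounds it and its variation without differentiating it again.\<close>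

definition bounded_lipschitz :: "(real \<Rightarrow> real) \<Rightarrow> bool" where
  "bounded_lipschitz f \<longleftrightarrow> (\<exists>K. \<forall>x\<in>{0<..<1}. \<forall>y\<in>{0<..<1}. \<bar>f x\<bar> \<le> K \<and> \<bar>f x - f y\<bar> \<le> K * \<bar>x - y\<bar>)"

lemma bounded_lipschitzI:
  assumes "\<And>x. x \<in> {0<..<1} \<Longrightarrow> \<bar>f x\<bar> \<le> A"
    "\<And>x y. x \<in> {0<..<1} \<Longrightarrow> y \<in> {0<..<1} \<Longrightarrow> \<bar>f x - f y\<bar> \<le> B * \<bar>x - y\<bar>"
  shows "bounded_lipschitz f"
  unfolding bounded_lipschitz_def
proof (intro exI[of _ "max A B"] ballI conjI)
  fix x y :: real assume xy: "x \<in> {0<..<1}" "y \<in> {0<..<1}"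
  show "\<bar>f x\<bar> \<le> max A B" using assms(1)[OF xy(1)] by simp
  have "B * \<bar>x - y\<bar> \<le> max A B * \<bar>x - y\<bar>" by (intro mult_right_mono) auto
  then show "\<bar>f x - f y\<bar> \<le> max A B * \<bar>x - y\<bar>" using assms(2)[of x y] xy by linarith
qed

lemma bounded_lipschitzE:
  assumes "bounded_lipschitz f"
  obtains K where "K \<ge> 0" "\<And>x. x \<in> {0<..<1} \<Longrightarrow> \<bar>f x\<bar> \<le> K"
    "\<And>x y. x \<in> {0<..<1} \<Longrightarrow> y \<in> {0<..<1} \<Longrightarrow> \<bar>f x - f y\<bar> \<le> K * \<bar>x - y\<bar>"
proof -
  obtain K where K: "\<And>x y. x \<in> {0<..<1} \<Longrightarrow> y \<in> {0<..<1} \<Longrightarrow> \<bar>f x\<bar> \<le> K \<and> \<bar>f x - f y\<bar> \<le> K * \<bar>x - y\<bar>"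
    using assms unfolding bounded_lipschitz_def by blast
  have "K \<ge> 0" using K[of "1/2" "1/2"] by simp
  with K show thesis using that by blast
qed

lemma bounded_lipschitz_diff:
  assumes "bounded_lipschitz f" "bounded_lipschitz g"
  shows "bounded_lipschitz (\<lambda>x. f x - g x)"
proof -
  obtain K where K: "\<And>x. x \<in> {0<..<1} \<Longrightarrow> \<bar>f x\<bar> \<le> K"
    "\<And>x y. x \<in> {0<..<1} \<Longrightarrow> y \<in> {0<..<1} \<Longrightarrow> \<bar>f x - f y\<bar> \<le> K * \<bar>x - y\<bar>"
    using assms(1) by (elim bounded_lipschitzE) blast
  obtain L where L: "\<And>x. x \<in> {0<..<1} \<Longrightarrow> \<bar>g x\<bar> \<le> L"
    "\<And>x y. x \<in> {0<..<1} \<Longrightarrow> y \<in> {0<..<1} \<Longrightarrow> \<bar>g x - g y\<bar> \<le> L * \<bar>x - y\<bar>"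
    using assms(2) by (elim bounded_lipschitzE) blast
  show ?thesis
  proof (rule bounded_lipschitzI[of _ "K + L" "K + L"])
    fix x y :: real assume xy: "x \<in> {0<..<1}" "y \<in> {0<..<1}"
    show "\<bar>f x - g x\<bar> \<le> K + L" using K(1)[OF xy(1)] L(1)[OF xy(1)] by linarith
    show "\<bar>f x - g x - (f y - g y)\<bar> \<le> (K + L) * \<bar>x - y\<bar>"
      using K(2)[OF xy] L(2)[OF xy] unfolding distrib_right by linarith
  qed
qed

lemma bounded_lipschitz_mult:
  assumes "bounded_lipschitz f" "bounded_lipschitz g"
  shows "bounded_lipschitz (\<lambda>x. f x * g x)"
proof -
  obtain K where K: "K \<ge> 0" "\<And>x. x \<in> {0<..<1} \<Longrightarrow> \<bar>f x\<bar> \<le> K"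
    "\<And>x y. x \<in> {0<..<1} \<Longrightarrow> y \<in> {0<..<1} \<Longrightarrow> \<bar>f x - f y\<bar> \<le> K * \<bar>x - y\<bar>"
    using assms(1) by (elim bounded_lipschitzE) blast
  obtain L where L: "L \<ge> 0" "\<And>x. x \<in> {0<..<1} \<Longrightarrow> \<bar>g x\<bar> \<le> L"
    "\<And>x y. x \<in> {0<..<1} \<Longrightarrow> y \<in> {0<..<1} \<Longrightarrow> \<bar>g x - g y\<bar> \<le> L * \<bar>x - y\<bar>"
    using assms(2) by (elim bounded_lipschitzE) blast
  show ?thesis
  proof (rule bounded_lipschitzI[of _ "K * L" "2 * K * L"])
    fix x y :: real assume xy: "x \<in> {0<..<1}" "y \<in> {0<..<1}"
    show "\<bar>f x * g x\<bar> \<le> K * L" using K(1) K(2)[OF xy(1)] L(2)[OF xy(1)]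
      by (auto simp: abs_mult intro!: mult_mono)
    have "\<bar>f x * g x - f y * g y\<bar> = \<bar>(f x - f y) * g x + f y * (g x - g y)\<bar>" by (simp add: algebra_simps)
    also have "\<dots> \<le> \<bar>f x - f y\<bar> * \<bar>g x\<bar> + \<bar>f y\<bar> * \<bar>g x - g y\<bar>"
      by (metis abs_mult abs_triangle_ineq)
    also have "\<dots> \<le> (K * \<bar>x - y\<bar>) * L + K * (L * \<bar>x - y\<bar>)"
      using K(1) K(2)[OF xy(2)] K(3)[OF xy] L(2)[OF xy(1)] L(3)[OF xy] L(1)
      by (intro add_mono mult_mono) auto
    finally show "\<bar>f x * g x - f y * g y\<bar> \<le> 2 * K * L * \<bar>x - y\<bar>" by (simp add: algebra_simps)
  qed
qed

lemma bounded_lipschitz_inverse: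
  assumes "bounded_lipschitz f" "0 < m" "\<And>x. x \<in> {0<..<1} \<Longrightarrow> m \<le> f x"
  shows "bounded_lipschitz (\<lambda>x. 1 / f x)"
proof -
  obtain K where K: "K \<ge> 0"
    "\<And>x y. x \<in> {0<..<1} \<Longrightarrow> y \<in> {0<..<1} \<Longrightarrow> \<bar>f x - f y\<bar> \<le> K * \<bar>x - y\<bar>"
    using assms(1) by (elim bounded_lipschitzE) blast
  show ?thesis
  proof (rule bounded_lipschitzI[of _ "1 / m" "K / (m * m)"])
    fix x y :: real assume xy: "x \<in> {0<..<1}" "y \<in> {0<..<1}"
    have f: "m \<le> f x" "m \<le> f y" using assms xy by auto
    then show "\<bar>1 / f x\<bar> \<le> 1 / m" using assms(2) by (simp add: frac_le)
    have "\<bar>1 / f x - 1 / f y\<bar> = \<bar>f x - f y\<bar> / (f x * f y)"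
      using f assms(2) by (simp add: field_simps abs_mult)
    also have "\<dots> \<le> (K * \<bar>x - y\<bar>) / (m * m)"
      using f assms(2) K(1) K(2)[OF xy] by (intro frac_le mult_mono) auto
    finally show "\<bar>1 / f x - 1 / f y\<bar> \<le> K / (m * m) * \<bar>x - y\<bar>" by simp
  qed
qed

lemma continuous_on_unit_bounded:
  fixes f :: "real \<Rightarrow> real"
  assumes "continuous_on {0..1} f"
  obtains K where "K \<ge> 0" "\<And>x. x \<in> {0..1} \<Longrightarrow> \<bar>f x\<bar> \<le> K"
proof -
  have "bounded (f ` {0..1})" using assms by (intro compact_imp_bounded compact_continuous_image) auto
  then obtain K where "\<forall>y\<in>f ` {0..1}. norm y \<le> K" unfolding bounded_iff by blast
  then have K: "\<bar>f x\<bar> \<le> K" if "x \<in> {0..1}" for x using that by auto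
  moreover have "K \<ge> 0" using K[of 0] by simp
  ultimately show thesis using that by blast
qed

lemma bounded_lipschitz_of_deriv:
  assumes "continuous_on {0..1} f" "continuous_on {0..1} f'"
    and d: "\<And>x. x \<in> {0<..<1} \<Longrightarrow> (f has_real_derivative f' x) (at x)"
  shows "bounded_lipschitz f"
proof -
  obtain A where A: "\<And>x. x \<in> {0..1} \<Longrightarrow> \<bar>f x\<bar> \<le> A" using assms(1) by (elim continuous_on_unit_bounded) blast
  obtain B where B: "\<And>x. x \<in> {0..1} \<Longrightarrow> \<bar>f' x\<bar> \<le> B" using assms(2) by (elim continuous_on_unit_bounded) blast
  have *: "\<bar>f y - f x\<bar> \<le> B * (y - x)" if "x \<le> y" "x \<in> {0<..<1}" "y \<in> {0<..<1}" for x y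
    using that by (intro abs_diff_le_of_deriv_bound[where f' = f'] d B continuous_on_subset[OF assms(1)]) auto
  show ?thesis
  proof (rule bounded_lipschitzI[of _ A B])
    fix x y :: real assume xy: "x \<in> {0<..<1}" "y \<in> {0<..<1}"
    show "\<bar>f x\<bar> \<le> A" using A xy by auto
    show "\<bar>f x - f y\<bar> \<le> B * \<bar>x - y\<bar>"
      using *[of x y] *[of y x] xy by (cases "x \<le> y") (auto simp: abs_minus_commute)
  qed
qed

text \<open>As \<open>c\<close> may vanish, the perturbation \<open>\<delta> * (2 - x)\<close> is needed to make the inequality strict.\<close>

lemma minimum_principle:
  fixes z z1 z2 b c :: "real \<Rightarrow> real"
  assumes "\<epsilon> > 0" and cont: "continuous_on {0..1} z"
    and z1: "\<And>x. x \<in> {0<..<1} \<Longrightarrow> (z has_real_derivative z1 x) (at x)"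
    and z2: "\<And>x. x \<in> {0<..<1} \<Longrightarrow> (z1 has_real_derivative z2 x) (at x)"
    and b: "\<And>x. x \<in> {0<..<1} \<Longrightarrow> b x > 0" and c: "\<And>x. x \<in> {0<..<1} \<Longrightarrow> c x \<ge> 0"
    and L: "\<And>x. x \<in> {0<..<1} \<Longrightarrow> 0 \<le> - \<epsilon> * z2 x - b x * z1 x + c x * z x"
    and bc: "z 0 \<ge> 0" "z 1 \<ge> 0" and x: "x \<in> {0..1}"
  shows "z x \<ge> 0"
proof (rule field_le_epsilon)
  fix e :: real assume e: "e > 0"
  \<comment> \<open>On the unit interval \<open>\<delta> * (2 - x)\<close> lies between \<delta> and
    \<open>e\<close>: it is strictly positive, yet costs at most the allowed
    \<open>e\<close>.\<close>
  define \<delta> where "\<delta> = e / 2"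
  have \<delta>: "\<delta> > 0" using e by (simp add: \<delta>_def)
  define y where "y = (\<lambda>x. z x + \<delta> * (2 - x))"
  have "continuous_on {0..1} y" unfolding y_def by (intro continuous_intros cont)
  then obtain m where m: "m \<in> {0..1}" and min: "\<And>t. t \<in> {0..1} \<Longrightarrow> y m \<le> y t"
    using continuous_attains_inf[of "{0..1::real}" y] by auto
  have "y m \<ge> 0"
  proof (rule ccontr)
    assume neg: "\<not> y m \<ge> 0"
    have "y 0 \<ge> 0" "y 1 \<ge> 0" using bc \<delta> by (auto simp: y_def)
    then have "m \<noteq> 0" "m \<noteq> 1" using neg by auto
    then have mi: "m \<in> {0<..<1}" using m by auto
    have d1: "(y has_real_derivative z1 t - \<delta>) (at t)" if "t \<in> {0<..<1}" for t
      unfolding y_def using z1[OF that] by (auto intro!: derivative_eq_intros)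
    have d2: "((\<lambda>t. z1 t - \<delta>) has_real_derivative z2 m) (at m)"
      using z2[OF mi] by (auto intro!: derivative_eq_intros)
    define r where "r = min m (1 - m)"
    have r: "r > 0" "\<And>t. \<bar>m - t\<bar> < r \<Longrightarrow> t \<in> {0<..<1}" using mi by (auto simp: r_def)
    \<comment> \<open>Stationarity of \<open>y\<close> gives \<open>z1 m = \<delta> > 0\<close>, so
      the convection term \<open>- b m * z1 m\<close> is strictly negative even where
      \<open>c\<close> vanishes.\<close>
    have zero: "z1 m - \<delta> = 0"
      by (rule DERIV_local_min[OF d1[OF mi] r(1)]) (use r(2) min in \<open>auto simp: less_imp_le\<close>)
    \<comment> \<open>Second derivative test: otherwise the derivative of \<open>y\<close> would be
      negative just to the right of \<open>m\<close>, and \<open>y\<close> would fall below its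
      minimum.\<close>
    have "z2 m \<ge> 0"
    proof (rule ccontr)
      assume "\<not> z2 m \<ge> 0"
      then obtain d where d: "d > 0" "\<And>h. h > 0 \<Longrightarrow> h < d \<Longrightarrow> z1 (m + h) - \<delta> < z1 m - \<delta>"
        using DERIV_neg_dec_right[OF d2] by auto
      define s where "s = min r d / 2"
      have s: "0 < s" "s < r" "s < d" using r d by (auto simp: s_def)
      have "y (m + s) < y m"
      proof (rule DERIV_neg_imp_decreasing_open[where f = y])
        show "m < m + s" using s by simp
        show "\<exists>l. (y has_real_derivative l) (at t) \<and> l < 0" if "m < t" "t < m + s" for t
          using d1[of t] r(2)[of t] d(2)[of "t - m"] that s zero by fastforce
        show "continuous_on {m..m + s} y"
          using \<open>continuous_on {0..1} y\<close> by (rule continuous_on_subset) (use r(2)[of "m + s"] mi s in \<open>auto simp: r_def\<close>)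
      qed
      moreover have "m + s \<in> {0..1}" using r(2)[of "m + s"] s by auto
      ultimately show False using min by force
    qed
    have zm: "z m < 0" using neg \<delta> mi unfolding y_def
      by (smt (verit, best) greaterThanLessThan_iff mult_nonneg_nonneg)
    have "- \<epsilon> * z2 m \<le> 0" "b m * z1 m > 0" "c m * z m \<le> 0"
      using \<open>z2 m \<ge> 0\<close> assms(1) b[OF mi] c[OF mi] zero zm \<delta> by (auto simp: mult_nonneg_nonpos)
    then show False using L[OF mi] by linarith
  qed
  then have "0 \<le> y x" using min[OF x] by linarith
  also have "\<dots> \<le> z x + e" using x \<delta> by (auto simp: y_def \<delta>_def algebra_simps)
  finally show "0 \<le> z x + e" .
qed

section \<open>Derivative bounds for the layer function\<close>

text \<open>\<epsilon> is deliberately kept out, so that constants obtained here are uniform in it.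
  \<open>K\<close> bounds all data at once, \<open>g\<close> stands for the second derivative of the
  reduced solution, and \<open>\<beta> < \<beta>1\<close> records the uniform gap.\<close>

locale convection_diffusion =
  fixes b b' c g :: "real \<Rightarrow> real" and \<beta> \<beta>1 K :: real
  assumes \<beta>_pos: "0 < \<beta>" and \<beta>_less: "\<beta> < \<beta>1" and K_ge1: "1 \<le> K"
    and b_cont: "continuous_on {0..1} b"
    and b_lower: "\<And>x. x \<in> {0<..<1} \<Longrightarrow> \<beta>1 \<le> b x"
    and b_upper: "\<And>x. x \<in> {0<..<1} \<Longrightarrow> b x \<le> K"
    and b'_bound: "\<And>x. x \<in> {0<..<1} \<Longrightarrow> \<bar>b' x\<bar> \<le> K"
    and b_lip: "\<And>x y. x \<in> {0<..<1} \<Longrightarrow> y \<in> {0<..<1} \<Longrightarrow> \<bar>b x - b y\<bar> \<le> K * \<bar>x - y\<bar>"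
    and b_taylor: "\<And>x s. x \<in> {0<..<1} \<Longrightarrow> s \<in> {0<..<1} \<Longrightarrow>
      \<bar>b s - b x - b' x * (s - x)\<bar> \<le> K * (s - x)\<^sup>2"
    and c_nonneg: "\<And>x. x \<in> {0<..<1} \<Longrightarrow> 0 \<le> c x"
    and c_upper: "\<And>x. x \<in> {0<..<1} \<Longrightarrow> c x \<le> K"
    and c_lip: "\<And>x y. x \<in> {0<..<1} \<Longrightarrow> y \<in> {0<..<1} \<Longrightarrow> \<bar>c x - c y\<bar> \<le> K * \<bar>x - y\<bar>"
    and g_bound: "\<And>x. x \<in> {0<..<1} \<Longrightarrow> \<bar>g x\<bar> \<le> K"
    and g_lip: "\<And>x y. x \<in> {0<..<1} \<Longrightarrow> y \<in> {0<..<1} \<Longrightarrow> \<bar>g x - g y\<bar> \<le> K * \<bar>x - y\<bar>"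
begin

definition solution :: "real \<Rightarrow> (real \<Rightarrow> real) \<Rightarrow> (real \<Rightarrow> real) \<Rightarrow> (real \<Rightarrow> real) \<Rightarrow> bool" where
  "solution \<epsilon> w w1 w2 \<longleftrightarrow> 0 < \<epsilon> \<and> \<epsilon> < 1 \<and> continuous_on {0..1} w \<and> \<bar>w 0\<bar> \<le> K \<and> w 1 = 0 \<and>
    (\<forall>x\<in>{0<..<1}. (w has_real_derivative w1 x) (at x) \<and> (w1 has_real_derivative w2 x) (at x) \<and>
       - \<epsilon> * w2 x - b x * w1 x + c x * w x = \<epsilon> * g x)"

lemma b_pos: "x \<in> {0<..<1} \<Longrightarrow> 0 < b x"
  using b_lower[of x] \<beta>_pos \<beta>_less by linarith

text \<open>Comparison function: \<open>K / \<beta> * \<epsilon> * (1 - x)\<close> has image at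
  least \<open>K * \<epsilon>\<close>, which pays for the source; the exponential pays for
  \<open>w 0\<close>, and its image is nonnegative because \<open>b\<close> exceeds \<beta>. The
  sign \<open>s\<close> treats \<open>w\<close> and \<open>- w\<close> together.\<close>

lemma solution_bound:
  assumes sol: "solution \<epsilon> w w1 w2" and x: "x \<in> {0..1}"
  shows "\<bar>w x\<bar> \<le> K / \<beta> * \<epsilon> + K * exp (- \<beta> * x / \<epsilon>)"
proof -
  have e: "0 < \<epsilon>" and wc: "continuous_on {0..1} w" and w0: "\<bar>w 0\<bar> \<le> K" and w1: "w 1 = 0"
    and d1: "\<And>x. x \<in> {0<..<1} \<Longrightarrow> (w has_real_derivative w1 x) (at x)"
    and d2: "\<And>x. x \<in> {0<..<1} \<Longrightarrow> (w1 has_real_derivative w2 x) (at x)"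
    and eq: "\<And>x. x \<in> {0<..<1} \<Longrightarrow> - \<epsilon> * w2 x - b x * w1 x + c x * w x = \<epsilon> * g x"
    using sol by (auto simp: solution_def)
  have K0: "K \<ge> 0" using K_ge1 by simp
  have *: "0 \<le> K / \<beta> * \<epsilon> * (1 - x) + K * exp (- \<beta> * x / \<epsilon>) - s * w x" if s: "\<bar>s\<bar> = 1" for s
  proof (rule minimum_principle[where b = b and c = c and \<epsilon> = \<epsilon> and x = x and
      z = "\<lambda>x. K / \<beta> * \<epsilon> * (1 - x) + K * exp (- \<beta> * x / \<epsilon>) - s * w x" and
      ?z1.0 = "\<lambda>x. - K / \<beta> * \<epsilon> - K * (\<beta> / \<epsilon>) * exp (- \<beta> * x / \<epsilon>) - s * w1 x" and
      ?z2.0 = "\<lambda>x. K * (\<beta> / \<epsilon>)\<^sup>2 * exp (- \<beta> * x / \<epsilon>) - s * w2 x"])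
    fix x :: real assume x: "x \<in> {0<..<1}"
    show "((\<lambda>x. K / \<beta> * \<epsilon> * (1 - x) + K * exp (- \<beta> * x / \<epsilon>) - s * w x) has_real_derivative
        - K / \<beta> * \<epsilon> - K * (\<beta> / \<epsilon>) * exp (- \<beta> * x / \<epsilon>) - s * w1 x) (at x)"
      using e \<beta>_pos by (auto intro!: derivative_eq_intros d1[OF x] simp: field_simps)
    show "((\<lambda>x. - K / \<beta> * \<epsilon> - K * (\<beta> / \<epsilon>) * exp (- \<beta> * x / \<epsilon>) - s * w1 x) has_real_derivative
        K * (\<beta> / \<epsilon>)\<^sup>2 * exp (- \<beta> * x / \<epsilon>) - s * w2 x) (at x)"
      using e \<beta>_pos by (auto intro!: derivative_eq_intros d2[OF x] simp: field_simps power2_eq_square)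
    define E where "E = exp (- \<beta> * x / \<epsilon>)"
    have E: "E > 0" by (simp add: E_def)
    have bx: "\<beta> \<le> b x" using b_lower[OF x] \<beta>_less by linarith
    have "s * g x \<le> K" using g_bound[OF x] s by (metis abs_le_D1 abs_mult mult_1)
    then have "\<epsilon> * (s * g x) \<le> \<epsilon> * K" using e by simp
    moreover have "K * \<epsilon> * 1 \<le> K * \<epsilon> * (b x / \<beta>)" using bx \<beta>_pos K0 e by (intro mult_left_mono) auto
    moreover have "0 \<le> K * (\<beta> / \<epsilon>) * E * (b x - \<beta>)" using bx \<beta>_pos K0 e E by simp
    moreover have "0 \<le> c x * (K / \<beta> * \<epsilon> * (1 - x) + K * E)"
      using c_nonneg[OF x] \<beta>_pos K0 e E x by (intro mult_nonneg_nonneg add_nonneg_nonneg) auto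
    ultimately have "0 \<le> K * \<epsilon> * (b x / \<beta>) + K * (\<beta> / \<epsilon>) * E * (b x - \<beta>)
        + c x * (K / \<beta> * \<epsilon> * (1 - x) + K * E) - \<epsilon> * (s * g x)"
      by (smt (verit) mult.commute mult_1_right)
    moreover have "- \<epsilon> * (K * (\<beta> / \<epsilon>)\<^sup>2 * E - s * w2 x) -
         b x * (- K / \<beta> * \<epsilon> - K * (\<beta> / \<epsilon>) * E - s * w1 x) +
         c x * (K / \<beta> * \<epsilon> * (1 - x) + K * E - s * w x)
      = K * \<epsilon> * (b x / \<beta>) + K * (\<beta> / \<epsilon>) * E * (b x - \<beta>) + c x * (K / \<beta> * \<epsilon> * (1 - x) + K * E)
        - s * (- \<epsilon> * w2 x - b x * w1 x + c x * w x)"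
      using e \<beta>_pos by (simp add: field_simps power2_eq_square)
    moreover have "s * (- \<epsilon> * w2 x - b x * w1 x + c x * w x) = \<epsilon> * (s * g x)"
      using eq[OF x] by simp
    ultimately show "0 \<le> - \<epsilon> * (K * (\<beta> / \<epsilon>)\<^sup>2 * exp (- \<beta> * x / \<epsilon>) - s * w2 x) -
         b x * (- K / \<beta> * \<epsilon> - K * (\<beta> / \<epsilon>) * exp (- \<beta> * x / \<epsilon>) - s * w1 x) +
         c x * (K / \<beta> * \<epsilon> * (1 - x) + K * exp (- \<beta> * x / \<epsilon>) - s * w x)"
      unfolding E_def by (simp only:)
  next
    have "s * w 0 \<le> K" using w0 s by (metis abs_le_D1 abs_mult mult_1)
    moreover have "0 \<le> K / \<beta> * \<epsilon>" using \<beta>_pos K0 e by simp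
    ultimately show "0 \<le> K / \<beta> * \<epsilon> * (1 - 0) + K * exp (- \<beta> * 0 / \<epsilon>) - s * w 0" by simp
    show "0 \<le> K / \<beta> * \<epsilon> * (1 - 1) + K * exp (- \<beta> * 1 / \<epsilon>) - s * w 1" using K0 w1 by simp
  qed (use e \<beta>_pos wc b_pos c_nonneg x in \<open>auto intro!: continuous_intros\<close>)
  have "K / \<beta> * \<epsilon> * (1 - x) \<le> K / \<beta> * \<epsilon> * 1"
    using \<beta>_pos K0 e x by (intro mult_left_mono) auto
  then show ?thesis using *[of 1] *[of "-1"] by simp
qed

text \<open>With \<open>B\<close> an antiderivative of \<open>b\<close>, the equation reads
  \<open>(w' exp (B/\<epsilon>))' = exp (B/\<epsilon>) (c w - \<epsilon> g)/\<epsilon>\<close>; it is integrated to both sides of a point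
  \<open>y \<in> (0,\<epsilon>)\<close> where \<open>w'\<close> is a difference quotient of \<open>w\<close>.\<close>

lemma solution_deriv_bound:
  assumes sol: "solution \<epsilon> w w1 w2" and x: "x \<in> {0<..<1}"
    and R: "\<And>x. x \<in> {0<..<1} \<Longrightarrow> \<bar>c x * w x - \<epsilon> * g x\<bar> \<le> R * (\<epsilon> + exp (- \<beta> * x / \<epsilon>))"
    and D: "\<And>x. x \<in> {0..1} \<Longrightarrow> \<bar>w x\<bar> \<le> D"
    and A: "A = exp (K + \<beta>) * (2 * D + 2 * R) + R / (\<beta>1 - \<beta>)"
  shows "\<bar>w1 x\<bar> \<le> A * (\<epsilon> + exp (- \<beta> * x / \<epsilon>) / \<epsilon>)"
proof -
  have e: "0 < \<epsilon>" "\<epsilon> < 1" and wc: "continuous_on {0..1} w"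
    and d1: "\<And>x. x \<in> {0<..<1} \<Longrightarrow> (w has_real_derivative w1 x) (at x)"
    and d2: "\<And>x. x \<in> {0<..<1} \<Longrightarrow> (w1 has_real_derivative w2 x) (at x)"
    and eq: "\<And>x. x \<in> {0<..<1} \<Longrightarrow> - \<epsilon> * w2 x - b x * w1 x + c x * w x = \<epsilon> * g x"
    using sol by (auto simp: solution_def)
  have D0: "D \<ge> 0" using D[of 0] by simp
  have R0: "R \<ge> 0"
  proof -
    have "0 \<le> R * (\<epsilon> + exp (- \<beta> * x / \<epsilon>))" using R[OF x] by (meson abs_ge_zero order_trans)
    moreover have "\<epsilon> + exp (- \<beta> * x / \<epsilon>) > 0" using e by (simp add: add_pos_pos)
    ultimately show ?thesis by (simp add: zero_le_mult_iff)
  qed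
  obtain B where B0: "\<And>x. x \<in> {0..1} \<Longrightarrow> (B has_vector_derivative b x) (at x within {0..1})"
    using antiderivative_continuous[OF b_cont] by blast
  have B: "(B has_real_derivative b x) (at x)" if "x \<in> {0<..<1}" for x
    using B0[of x] that at_within_interior[of x "{0..1}"]
    by (simp add: has_real_derivative_iff_has_vector_derivative)
  have Bmono: "B s \<le> B t" "B t - B s \<le> K * (t - s)" if "s \<le> t" "s \<in> {0<..<1}" "t \<in> {0<..<1}" for s t
  proof -
    have cont: "continuous_on {s..t} B"
      using that by (intro continuous_at_imp_continuous_on ballI DERIV_isCont[OF B]) auto
    show "B s \<le> B t"
      by (rule DERIV_nonneg_imp_increasing_open[OF that(1) _ cont])
        (use that B less_imp_le[OF b_pos] in \<open>meson greaterThanLessThan_iff less_trans\<close>)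
    have "\<bar>B t - B s\<bar> \<le> K * (t - s)"
      by (rule abs_diff_le_of_deriv_bound[OF that(1) cont, where f' = b])
        (use that in \<open>auto simp: abs_of_pos[OF b_pos] intro!: B b_upper\<close>)
    then show "B t - B s \<le> K * (t - s)" by simp
  qed
  obtain y where y: "0 < y" "y < \<epsilon>" and wy: "w \<epsilon> - w 0 = \<epsilon> * w1 y"
  proof -
    have "\<exists>l z. 0 < z \<and> z < \<epsilon> \<and> (w has_real_derivative l) (at z) \<and> w \<epsilon> - w 0 = (\<epsilon> - 0) * l"
    proof (rule MVT[OF e(1)])
      show "continuous_on {0..\<epsilon>} w" using e by (intro continuous_on_subset[OF wc]) auto
      show "w differentiable (at z)" if "0 < z" "z < \<epsilon>" for z
        using d1[of z] that e unfolding real_differentiable_def by auto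
    qed
    then obtain l z where z: "0 < z" "z < \<epsilon>" "(w has_real_derivative l) (at z)" "w \<epsilon> - w 0 = \<epsilon> * l" by auto
    moreover have "l = w1 z" using d1[of z] DERIV_unique z e by auto
    ultimately show thesis using that by blast
  qed
  have yI: "y \<in> {0<..<1}" using y e by auto
  have "\<epsilon> * \<bar>w1 y\<bar> \<le> 2 * D" using wy D[of \<epsilon>] D[of 0] e by (simp add: abs_mult[symmetric])
  then have w1y: "\<bar>w1 y\<bar> \<le> 2 * D / \<epsilon>" using e by (simp add: field_simps)
  have near: "exp (- \<beta>) \<le> exp (- \<beta> * t / \<epsilon>)" if "t \<le> \<epsilon>" for t
    using that e \<beta>_pos by (simp add: field_simps)
  have prod: "((\<lambda>t. v t * exp ((B t - k) / \<epsilon>)) has_real_derivative exp ((B t - k) / \<epsilon>) * (v' + b t * v t / \<epsilon>)) (at t)"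
    if "t \<in> {0<..<1}" "(v has_real_derivative v') (at t)" for t v v' k
    using e by (auto intro!: derivative_eq_intros that B simp: field_simps)
  have w2: "w2 t + b t * w1 t / \<epsilon> = (c t * w t - \<epsilon> * g t) / \<epsilon>" if "t \<in> {0<..<1}" for t
    using eq[OF that] e by (simp add: field_simps)
  \<comment> \<open>The first summand of \<open>A\<close> serves points left of \<open>y\<close> and
    the starting value at \<open>y\<close>; the second makes the majorant on the right a
    supersolution.\<close>
  have A0: "exp (K + \<beta>) * (2 * D + 2 * R) \<le> A" "R / (\<beta>1 - \<beta>) \<le> A" "0 \<le> A"
    using A R0 D0 \<beta>_less by auto
  have x_exp: "0 \<le> A * \<epsilon>" using A0 e by simp
  show ?thesis
  proof (cases "x \<le> y")
    case True
    \<comment> \<open>Here \<open>x \<le> y < \<epsilon>\<close>, so undoing the integrating factor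
      costs at most \<open>exp K\<close>, and the layer function is still at least
      \<open>exp (- \<beta>)\<close>; together these give the factor
      \<open>exp (K + \<beta>)\<close>.\<close>
    define V where "V = (\<lambda>t. w1 t * exp ((B t - B y) / \<epsilon>))"
    have "\<bar>V y - V x\<bar> \<le> (2 * R / \<epsilon>) * (y - x)"
    proof (rule abs_diff_le_of_deriv_bound[OF True])
      have V: "(V has_real_derivative exp ((B t - B y) / \<epsilon>) * (w2 t + b t * w1 t / \<epsilon>)) (at t)"
        if "t \<in> {0<..<1}" for t unfolding V_def by (rule prod[OF that d2[OF that]])
      show "continuous_on {x..y} V"
        using x yI by (intro continuous_at_imp_continuous_on ballI DERIV_isCont[OF V]) auto
      fix t assume t: "x < t" "t < y"
      then have tI: "t \<in> {0<..<1}" using x yI by auto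
      show "(V has_real_derivative exp ((B t - B y) / \<epsilon>) * ((c t * w t - \<epsilon> * g t) / \<epsilon>)) (at t)"
        using V[OF tI] w2[OF tI] by simp
      have "\<epsilon> + exp (- \<beta> * t / \<epsilon>) \<le> 1 + 1" using e tI \<beta>_pos by (intro add_mono) auto
      then have "R * (\<epsilon> + exp (- \<beta> * t / \<epsilon>)) \<le> R * (1 + 1)" using R0 by (rule mult_left_mono)
      then have "\<bar>c t * w t - \<epsilon> * g t\<bar> \<le> 2 * R" using order_trans[OF R[OF tI]] by simp
      moreover have "exp ((B t - B y) / \<epsilon>) \<le> 1" using Bmono(1)[of t y] t tI yI e by (simp add: divide_le_0_iff)
      ultimately have "exp ((B t - B y) / \<epsilon>) * (\<bar>c t * w t - \<epsilon> * g t\<bar> / \<epsilon>) \<le> 1 * (2 * R / \<epsilon>)"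
        using e by (intro mult_mono divide_right_mono) auto
      then show "\<bar>exp ((B t - B y) / \<epsilon>) * ((c t * w t - \<epsilon> * g t) / \<epsilon>)\<bar> \<le> 2 * R / \<epsilon>"
        using e by (simp add: abs_mult)
    qed
    also have "\<dots> \<le> (2 * R / \<epsilon>) * \<epsilon>" using x y e R0 True by (intro mult_left_mono) auto
    also have "\<dots> \<le> 2 * R / \<epsilon>" using e R0 by (simp add: field_simps mult_left_le)
    finally have "\<bar>V x\<bar> \<le> \<bar>w1 y\<bar> + 2 * R / \<epsilon>" by (simp add: V_def)
    then have V: "\<bar>V x\<bar> \<le> (2 * D + 2 * R) / \<epsilon>" using w1y by (simp add: add_divide_distrib)
    have "(B y - B x) / \<epsilon> \<le> K"
    proof -
      have "B y - B x \<le> K * (y - x)" using Bmono(2)[OF True x yI] .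
      also have "\<dots> \<le> K * \<epsilon>" using x y K_ge1 by (intro mult_left_mono) auto
      finally show ?thesis using e by (simp add: field_simps)
    qed
    then have "\<bar>V x\<bar> * exp ((B y - B x) / \<epsilon>) \<le> (2 * D + 2 * R) / \<epsilon> * exp K"
      using V e R0 D0 by (intro mult_mono) auto
    moreover have "\<bar>V x\<bar> * exp ((B y - B x) / \<epsilon>) = \<bar>w1 x\<bar>"
      by (simp add: V_def abs_mult exp_add[symmetric] add_divide_distrib[symmetric] mult.assoc)
    ultimately have "\<bar>w1 x\<bar> \<le> (2 * D + 2 * R) / \<epsilon> * exp K" by simp
    also have "\<dots> = exp (K + \<beta>) * (2 * D + 2 * R) * (exp (- \<beta>) / \<epsilon>)"
      using exp_add[of "K + \<beta>" "- \<beta>"] by simp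
    also have "\<dots> \<le> A * (exp (- \<beta> * x / \<epsilon>) / \<epsilon>)"
      using A0 near[of x] True y e by (intro mult_mono divide_right_mono) auto
    finally show ?thesis using x_exp unfolding distrib_left by linarith
  next
    case False
    \<comment> \<open>Right of \<open>y\<close> the claimed bound is itself a supersolution of the
      first-order equation for \<open>w1\<close>: the excess \<open>A * (\<beta>1 - \<beta>)\<close>
      absorbs \<open>R\<close>. Hence \<open>(s * w1 - P)\<close> times the integrating factor is
      nonincreasing and starts nonpositive at \<open>y\<close>.\<close>
    define P where "P = (\<lambda>t. A * (\<epsilon> + exp (- \<beta> * t / \<epsilon>) / \<epsilon>))"
    have "s * w1 x \<le> P x" if s: "\<bar>s\<bar> = 1" for s
    proof -
      define V where "V = (\<lambda>t. (s * w1 t - P t) * exp ((B t - B y) / \<epsilon>))"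
      have dP: "((\<lambda>t. s * w1 t - P t) has_real_derivative s * w2 t + A * (\<beta> / \<epsilon>) * (exp (- \<beta> * t / \<epsilon>) / \<epsilon>)) (at t)"
        if "t \<in> {0<..<1}" for t
        unfolding P_def using e by (auto intro!: derivative_eq_intros d2[OF that] simp: field_simps)
      have "V x \<le> V y"
      proof (rule DERIV_nonpos_imp_nonincreasing[where f = V])
        show "y \<le> x" using False by simp
        fix t assume t: "y \<le> t" "t \<le> x"
        then have tI: "t \<in> {0<..<1}" using x yI by auto
        define E where "E = exp (- \<beta> * t / \<epsilon>)"
        have E: "E > 0" by (simp add: E_def)
        have V: "(V has_real_derivative exp ((B t - B y) / \<epsilon>) *
          (s * w2 t + A * (\<beta> / \<epsilon>) * (E / \<epsilon>) + b t * (s * w1 t - P t) / \<epsilon>)) (at t)"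
          unfolding V_def E_def by (rule prod[OF tI dP[OF tI]])
        have "s * w2 t + A * (\<beta> / \<epsilon>) * (E / \<epsilon>) + b t * (s * w1 t - P t) / \<epsilon>
          = (s * (c t * w t - \<epsilon> * g t) - (A * b t * \<epsilon> + A * (b t - \<beta>) * (E / \<epsilon>))) / \<epsilon>"
        proof -
          have "s * w2 t + A * (\<beta> / \<epsilon>) * (E / \<epsilon>) + b t * (s * w1 t - P t) / \<epsilon>
            = s * (w2 t + b t * w1 t / \<epsilon>) + A * (\<beta> / \<epsilon>) * (E / \<epsilon>) - b t * P t / \<epsilon>"
            by (simp add: algebra_simps diff_divide_distrib)
          also have "\<dots> = s * ((c t * w t - \<epsilon> * g t) / \<epsilon>) + A * (\<beta> / \<epsilon>) * (E / \<epsilon>) - b t * P t / \<epsilon>"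
            by (simp only: w2[OF tI])
          also have "\<dots> = (s * (c t * w t - \<epsilon> * g t) - (A * b t * \<epsilon> + A * (b t - \<beta>) * (E / \<epsilon>))) / \<epsilon>"
            unfolding P_def E_def[symmetric] using e by (simp add: field_simps)
          finally show ?thesis .
        qed
        moreover have "s * (c t * w t - \<epsilon> * g t) \<le> A * b t * \<epsilon> + A * (b t - \<beta>) * (E / \<epsilon>)"
        proof -
          have bt: "\<beta>1 - \<beta> \<le> b t - \<beta>" "b t - \<beta> \<le> b t" using b_lower[OF tI] \<beta>_pos by auto
          have RA: "R \<le> A * (\<beta>1 - \<beta>)" using A0(2) \<beta>_less by (simp add: field_simps)
          have "s * (c t * w t - \<epsilon> * g t) \<le> R * (\<epsilon> + E)" using R[OF tI] s abs_mult[of s "c t * w t - \<epsilon> * g t"] unfolding E_def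
            by simp
          also have "\<dots> \<le> A * (\<beta>1 - \<beta>) * (\<epsilon> + E)" using RA e E by (intro mult_right_mono) auto
          also have "\<dots> \<le> A * (b t - \<beta>) * (\<epsilon> + E)" using A0 bt e E by (intro mult_right_mono mult_left_mono) auto
          also have "\<dots> = A * (b t - \<beta>) * \<epsilon> + A * (b t - \<beta>) * E" by (simp add: algebra_simps)
          also have "\<dots> \<le> A * b t * \<epsilon> + A * (b t - \<beta>) * (E / \<epsilon>)"
          proof (intro add_mono mult_right_mono mult_left_mono)
            have "E * \<epsilon> \<le> E * 1" using e E by (intro mult_left_mono) auto
            then show "E \<le> E / \<epsilon>" using e by (simp add: field_simps)
            show "0 \<le> A * (b t - \<beta>)" using A0 bt \<beta>_less by simp
          qed (use A0 bt e in auto)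
          finally show ?thesis .
        qed
        ultimately have "s * w2 t + A * (\<beta> / \<epsilon>) * (E / \<epsilon>) + b t * (s * w1 t - P t) / \<epsilon> \<le> 0"
          using e by (simp add: divide_le_0_iff)
        then show "\<exists>d. (V has_real_derivative d) (at t) \<and> d \<le> 0"
          by (intro exI[of _ "exp ((B t - B y) / \<epsilon>) *
            (s * w2 t + A * (\<beta> / \<epsilon>) * (E / \<epsilon>) + b t * (s * w1 t - P t) / \<epsilon>)"] conjI V mult_nonneg_nonpos) simp
      qed
      also have "V y \<le> 0"
      proof -
        have "s * w1 y \<le> \<bar>w1 y\<bar>" using s by (metis abs_ge_self abs_mult mult_1)
        also have "\<dots> \<le> 2 * D / \<epsilon>" by (rule w1y)
        also have "\<dots> \<le> exp (K + \<beta>) * (2 * D + 2 * R) * (exp (- \<beta>) / \<epsilon>)"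
        proof -
          have "1 * (2 * D) \<le> exp K * (2 * D + 2 * R)" using K_ge1 D0 R0 by (intro mult_mono) auto
          then have "1 * (2 * D) / \<epsilon> \<le> exp K * (2 * D + 2 * R) / \<epsilon>" using e by (intro divide_right_mono) auto
          then show ?thesis using exp_add[of "K + \<beta>" "- \<beta>"] by (simp add: mult_ac)
        qed
        also have "\<dots> \<le> A * (exp (- \<beta> * y / \<epsilon>) / \<epsilon>)"
          using A0 near[of y] y e by (intro mult_mono divide_right_mono) auto
        also have "\<dots> \<le> P y" using x_exp by (simp add: P_def distrib_left)
        finally show ?thesis by (simp add: V_def)
      qed
      finally show ?thesis by (simp add: V_def mult_le_0_iff)
    qed
    from this[of 1] this[of "-1"] show ?thesis by (simp add: P_def)
  qed
qed

text \<open>\<open>C\<close> is fixed before \<epsilon> and \<open>w\<close> are quantified, which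
  is what makes the final estimate uniform. The bound on \<open>w2\<close> comes from solving the
  equation for \<open>\<epsilon> * w2\<close>.\<close>

lemma derivative_bounds:
  obtains C where "C \<ge> 1"
    "\<And>\<epsilon> w w1 w2 x. solution \<epsilon> w w1 w2 \<Longrightarrow> x \<in> {0..1} \<Longrightarrow> \<bar>w x\<bar> \<le> C * (\<epsilon> + exp (- \<beta> * x / \<epsilon>))"
    "\<And>\<epsilon> w w1 w2 x. solution \<epsilon> w w1 w2 \<Longrightarrow> x \<in> {0<..<1} \<Longrightarrow> \<bar>w1 x\<bar> \<le> C * (\<epsilon> + exp (- \<beta> * x / \<epsilon>) / \<epsilon>)"
    "\<And>\<epsilon> w w1 w2 x. solution \<epsilon> w w1 w2 \<Longrightarrow> x \<in> {0<..<1} \<Longrightarrow> \<bar>w2 x\<bar> \<le> C * (1 + exp (- \<beta> * x / \<epsilon>) / \<epsilon>\<^sup>2)"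
proof -
  define C0 where "C0 = K / \<beta> + K"
  define R where "R = K * C0 + K"
  define A where "A = exp (K + \<beta>) * (2 * (2 * C0) + 2 * R) + R / (\<beta>1 - \<beta>)"
  define C where "C = C0 + A + (K * A + R)"
  have K0: "K > 0" using K_ge1 by simp
  have C0: "C0 \<ge> 1" using K_ge1 \<beta>_pos by (simp add: C0_def add_increasing)
  have R0: "R \<ge> 0" using C0 K0 by (simp add: R_def)
  have A0: "A \<ge> 0" using C0 R0 \<beta>_less by (simp add: A_def)
  have KA: "K * A \<ge> 0" using A0 K0 by simp
  have CC: "C \<ge> 1" "C \<ge> C0" "C \<ge> A" "C \<ge> K * A + R" using A0 R0 C0 KA unfolding C_def by linarith+
  have b0: "\<bar>w x\<bar> \<le> C0 * (\<epsilon> + exp (- \<beta> * x / \<epsilon>))"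
    if "solution \<epsilon> w w1 w2" "x \<in> {0..1}" for \<epsilon> w w1 w2 x
  proof -
    have "\<epsilon> > 0" using that by (simp add: solution_def)
    have "K / \<beta> * \<epsilon> \<le> C0 * \<epsilon>" "K * exp (- \<beta> * x / \<epsilon>) \<le> C0 * exp (- \<beta> * x / \<epsilon>)"
      using K0 \<beta>_pos \<open>\<epsilon> > 0\<close> unfolding C0_def by (intro mult_right_mono; simp)+
    then show ?thesis using solution_bound[OF that] unfolding distrib_left by linarith
  qed
  have r: "\<bar>c x * w x - \<epsilon> * g x\<bar> \<le> R * (\<epsilon> + exp (- \<beta> * x / \<epsilon>))"
    if s: "solution \<epsilon> w w1 w2" and x: "x \<in> {0<..<1}" for \<epsilon> w w1 w2 x
  proof -
    have "\<epsilon> > 0" using s by (simp add: solution_def)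
    have "\<bar>c x * w x - \<epsilon> * g x\<bar> \<le> \<bar>c x\<bar> * \<bar>w x\<bar> + \<epsilon> * \<bar>g x\<bar>"
      using \<open>\<epsilon> > 0\<close> by (metis abs_mult abs_of_pos abs_triangle_ineq4)
    also have "\<dots> \<le> K * (C0 * (\<epsilon> + exp (- \<beta> * x / \<epsilon>))) + \<epsilon> * K"
      using c_nonneg[OF x] c_upper[OF x] b0[OF s, of x] g_bound[OF x] x \<open>\<epsilon> > 0\<close> K0
      by (intro add_mono mult_mono) auto
    also have "\<dots> \<le> R * (\<epsilon> + exp (- \<beta> * x / \<epsilon>))"
      using K0 by (simp add: R_def algebra_simps)
    finally show ?thesis .
  qed
  have b1: "\<bar>w1 x\<bar> \<le> A * (\<epsilon> + exp (- \<beta> * x / \<epsilon>) / \<epsilon>)"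
    if s: "solution \<epsilon> w w1 w2" and x: "x \<in> {0<..<1}" for \<epsilon> w w1 w2 x
  proof (rule solution_deriv_bound[OF s x r[OF s] _ A_def])
    fix y :: real assume y: "y \<in> {0..1}"
    have "\<epsilon> > 0" "\<epsilon> < 1" using s by (auto simp: solution_def)
    then have "\<epsilon> + exp (- \<beta> * y / \<epsilon>) \<le> 1 + 1" using y \<beta>_pos by (intro add_mono) auto
    then have "C0 * (\<epsilon> + exp (- \<beta> * y / \<epsilon>)) \<le> C0 * (1 + 1)" using C0 by (intro mult_left_mono) auto
    then show "\<bar>w y\<bar> \<le> 2 * C0" using order_trans[OF b0[OF s y]] by simp
  qed
  have b2: "\<bar>w2 x\<bar> \<le> (K * A + R) * (1 + exp (- \<beta> * x / \<epsilon>) / \<epsilon>\<^sup>2)"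
    if s: "solution \<epsilon> w w1 w2" and x: "x \<in> {0<..<1}" for \<epsilon> w w1 w2 x
  proof -
    define E where "E = exp (- \<beta> * x / \<epsilon>)"
    have e: "\<epsilon> > 0" "\<epsilon> < 1" using s by (auto simp: solution_def)
    have E: "E > 0" "E \<le> E / \<epsilon>" using e by (auto simp: E_def field_simps)
    have "\<epsilon> * w2 x = - (b x * w1 x) + (c x * w x - \<epsilon> * g x)"
      using s x unfolding solution_def by force
    then have "\<epsilon> * \<bar>w2 x\<bar> \<le> b x * \<bar>w1 x\<bar> + \<bar>c x * w x - \<epsilon> * g x\<bar>"
      using e(1) b_pos[OF x] abs_mult[of \<epsilon> "w2 x"] abs_mult[of "b x" "w1 x"] by simp
    also have "\<dots> \<le> K * (A * (\<epsilon> + E / \<epsilon>)) + R * (\<epsilon> + E / \<epsilon>)"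
    proof (rule add_mono)
      show "b x * \<bar>w1 x\<bar> \<le> K * (A * (\<epsilon> + E / \<epsilon>))"
        using b1[OF s x] b_pos[OF x] b_upper[OF x] K0 unfolding E_def by (intro mult_mono) auto
      have "R * (\<epsilon> + E) \<le> R * (\<epsilon> + E / \<epsilon>)" using R0 E by (intro mult_left_mono) auto
      then show "\<bar>c x * w x - \<epsilon> * g x\<bar> \<le> R * (\<epsilon> + E / \<epsilon>)" using order_trans[OF r[OF s x]] unfolding E_def by blast
    qed
    also have "\<dots> = \<epsilon> * ((K * A + R) * (1 + E / \<epsilon>\<^sup>2))" using e by (simp add: field_simps power2_eq_square)
    finally show ?thesis using e(1) by (simp add: E_def)
  qed
  show thesis
  proof (rule that[OF CC(1)])
    fix \<epsilon> w w1 w2 x assume s: "solution \<epsilon> w w1 w2"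
    then have e: "\<epsilon> > 0" by (simp add: solution_def)
    show "\<bar>w x\<bar> \<le> C * (\<epsilon> + exp (- \<beta> * x / \<epsilon>))" if "x \<in> {0..1}"
      by (rule order_trans[OF b0[OF s that] mult_right_mono]) (use CC e in \<open>auto intro: add_nonneg_nonneg\<close>)
    show "\<bar>w1 x\<bar> \<le> C * (\<epsilon> + exp (- \<beta> * x / \<epsilon>) / \<epsilon>)" if "x \<in> {0<..<1}"
      by (rule order_trans[OF b1[OF s that] mult_right_mono]) (use CC e in \<open>auto intro: add_nonneg_nonneg\<close>)
    show "\<bar>w2 x\<bar> \<le> C * (1 + exp (- \<beta> * x / \<epsilon>) / \<epsilon>\<^sup>2)" if "x \<in> {0<..<1}"
      by (rule order_trans[OF b2[OF s that] mult_right_mono]) (use CC e in \<open>auto intro: add_nonneg_nonneg\<close>)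
  qed
qed

end

section \<open>The scheme with frozen coefficient\<close>

text \<open>On a uniform mesh the scheme with frozen coefficient \<open>B\<close> annihilates \<open>1\<close> and \<open>exp (- B x / \<epsilon>)\<close>;
  the following form of its second- and first-order part makes this visible.\<close>

definition asi_local :: "real \<Rightarrow> real \<Rightarrow> real \<Rightarrow> real \<Rightarrow> real \<Rightarrow> real \<Rightarrow> real" where
  "asi_local \<epsilon> B h vm v0 vp =
     B / (h * (1 - exp (- (B * h / \<epsilon>)))) * (exp (- (B * h / \<epsilon>)) * (v0 - vm) - (vp - v0))"

text \<open>With \<open>q = exp (- (B * h / \<epsilon>))\<close> the fitted diffusion is
  \<open>\<epsilon> * sigma \<rho> = B * h * q / (1 - q)\<close>. Collecting terms leaves the
  backward difference with weight \<open>q\<close> and the forward one with weight 1.\<close>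

lemma asi_op_uniform:
  assumes "\<epsilon> > 0" "h > 0" "b (x i) > 0" "x i - x (i - 1) = h" "x (Suc i) - x i = h"
  shows "asi_op \<epsilon> b c x U i = asi_local \<epsilon> (b (x i)) h (U (i - 1)) (U i) (U (Suc i)) + c (x i) * U i"
proof -
  define B where "B = b (x i)"
  define q where "q = exp (- (B * h / \<epsilon>))"
  have B: "B > 0" using assms by (simp add: B_def)
  have q: "0 < q" "q < 1" using assms B by (auto simp: q_def)
  have "sigma (B * h / (2 * \<epsilon>)) = B * h / \<epsilon> / (1 / q - 1)"
    using assms B by (simp add: sigma_def q_def exp_minus field_simps)
  also have "\<dots> = (B * h / \<epsilon>) * q / (1 - q)" using q by (simp add: field_simps)
  finally have s: "\<epsilon> * sigma (B * h / (2 * \<epsilon>)) = B * h * q / (1 - q)" using assms by simp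
  have "asi_op \<epsilon> b c x U i = - (\<epsilon> * sigma (B * h / (2 * \<epsilon>))) *
      (((U (Suc i) - U i) / h - (U i - U (i - 1)) / h) / h) - B * ((U (Suc i) - U i) / h) + c (x i) * U i"
    using assms by (simp add: asi_op_def Let_def B_def)
  also have "\<dots> = B / (h * (1 - q)) * (q * (U i - U (i - 1)) - (U (Suc i) - U i)) + c (x i) * U i"
    unfolding s using q assms by (simp add: field_simps)
  finally show ?thesis by (simp add: asi_local_def q_def B_def)
qed

text \<open>A nonnegative source makes \<open>v1 s * exp (B * s / \<epsilon>)\<close> nonincreasing.
  Comparing it at distance \<open>h\<close> gives
  \<open>v1 (x + t) \<le> q * v1 (x - h + t)\<close>, and integration over \<open>t\<close> from 0
  to \<open>h\<close> is exactly the sign of the three-point expression.\<close>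

lemma asi_local_nonneg:
  fixes v v1 v2 :: "real \<Rightarrow> real"
  assumes "\<epsilon> > 0" "B > 0" "h > 0" and cont: "continuous_on {x - h..x + h} v"
    and v1: "\<And>s. s \<in> {x - h<..<x + h} \<Longrightarrow> (v has_real_derivative v1 s) (at s)"
    and v2: "\<And>s. s \<in> {x - h<..<x + h} \<Longrightarrow> (v1 has_real_derivative v2 s) (at s)"
    and L: "\<And>s. s \<in> {x - h<..<x + h} \<Longrightarrow> 0 \<le> - \<epsilon> * v2 s - B * v1 s"
  shows "0 \<le> asi_local \<epsilon> B h (v (x - h)) (v x) (v (x + h))"
proof -
  define q where "q = exp (- (B * h / \<epsilon>))"
  have q: "0 < q" "q < 1" using assms by (auto simp: q_def)
  define Z where "Z = (\<lambda>s. v1 s * exp (B * s / \<epsilon>))"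
  have Z: "Z t \<le> Z s" if "s \<le> t" "s \<in> {x - h<..<x + h}" "t \<in> {x - h<..<x + h}" for s t
  proof (rule DERIV_nonpos_imp_nonincreasing[where f = Z, OF that(1)])
    fix r assume "s \<le> r" "r \<le> t"
    then have r: "r \<in> {x - h<..<x + h}" using that by auto
    have "(Z has_real_derivative exp (B * r / \<epsilon>) * ((\<epsilon> * v2 r + B * v1 r) / \<epsilon>)) (at r)"
      unfolding Z_def using assms(1) by (auto intro!: derivative_eq_intros v2[OF r] simp: field_simps)
    moreover have "exp (B * r / \<epsilon>) * ((\<epsilon> * v2 r + B * v1 r) / \<epsilon>) \<le> 0"
      using L[OF r] assms(1) by (intro mult_nonneg_nonpos) (auto simp: divide_le_0_iff)
    ultimately show "\<exists>d. (Z has_real_derivative d) (at r) \<and> d \<le> 0" by blast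
  qed
  define D where "D = (\<lambda>t. q * v (x - h + t) - v (x + t))"
  have "D 0 \<le> D h"
  proof (rule DERIV_nonneg_imp_increasing_open[where f = D])
    show "0 \<le> h" using assms by simp
    show "continuous_on {0..h} D" unfolding D_def
      by (intro continuous_intros continuous_on_compose2[OF cont]) auto
    fix t assume t: "0 < t" "t < h"
    then have m: "x - h + t \<in> {x - h<..<x + h}" "x + t \<in> {x - h<..<x + h}" using assms by auto
    have "(D has_real_derivative q * v1 (x - h + t) - v1 (x + t)) (at t)" unfolding D_def
      using v1[OF m(1)] v1[OF m(2)]
      by (auto intro!: derivative_eq_intros DERIV_chain2[where f = v])
    moreover have "0 \<le> q * v1 (x - h + t) - v1 (x + t)"
    proof -
      have "Z (x + t) \<le> Z (x - h + t)" using Z m assms by simp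
      then have "v1 (x + t) * exp (B * (x + t) / \<epsilon>) \<le> v1 (x - h + t) * (q * exp (B * (x + t) / \<epsilon>))"
        by (simp add: Z_def q_def exp_add[symmetric] algebra_simps diff_divide_distrib add_divide_distrib)
      then have "v1 (x + t) * exp (B * (x + t) / \<epsilon>) \<le> (q * v1 (x - h + t)) * exp (B * (x + t) / \<epsilon>)"
        by (simp add: mult_ac)
      then show ?thesis by simp
    qed
    ultimately show "\<exists>y. (D has_real_derivative y) (at t) \<and> 0 \<le> y" by blast
  qed
  then have "0 \<le> q * (v x - v (x - h)) - (v (x + h) - v x)" by (simp add: D_def algebra_simps)
  then show ?thesis using q assms by (simp add: asi_local_def q_def)
qed

section \<open>Linearity, comparison and explicit discrete images\<close>

lemma asi_local_coeffs:
  obtains k q where "\<And>vm v0 vp. asi_local \<epsilon> B h vm v0 vp = k * (q * (v0 - vm) - (vp - v0))"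
  unfolding asi_local_def by blast

lemma asi_local_add: "asi_local \<epsilon> B h (a + d) (a' + d') (a'' + d'') = asi_local \<epsilon> B h a a' a'' + asi_local \<epsilon> B h d d' d''"
  by (rule asi_local_coeffs[of \<epsilon> B h], simp only:, simp add: algebra_simps)

lemma asi_local_scale: "asi_local \<epsilon> B h (r * a) (r * a') (r * a'') = r * asi_local \<epsilon> B h a a' a''"
  by (rule asi_local_coeffs[of \<epsilon> B h], simp only:, simp add: algebra_simps)

text \<open>\<open>p\<close> is a model whose source and discrete image are both explicit, and
  \<open>G\<close> has a source dominating the discrepancy. Positivity is applied to
  \<open>G - (v - p)\<close> and \<open>G + (v - p)\<close>.\<close>

lemma asi_local_compare:
  fixes v v1 v2 :: "real \<Rightarrow> real"
  assumes e: "\<epsilon> > 0" "B > 0" "h > 0"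
    and v: "continuous_on {x - h..x + h} v"
      "\<And>s. s \<in> {x - h<..<x + h} \<Longrightarrow> (v has_real_derivative v1 s) (at s)"
      "\<And>s. s \<in> {x - h<..<x + h} \<Longrightarrow> (v1 has_real_derivative v2 s) (at s)"
    and p: "\<And>s. (p has_real_derivative p1 s) (at s)" "\<And>s. (p1 has_real_derivative p2 s) (at s)"
    and G: "\<And>s. (G has_real_derivative G1 s) (at s)" "\<And>s. (G1 has_real_derivative G2 s) (at s)"
    and L: "\<And>s. s \<in> {x - h<..<x + h} \<Longrightarrow>
      \<bar>(- \<epsilon> * v2 s - B * v1 s) - (- \<epsilon> * p2 s - B * p1 s)\<bar> \<le> - \<epsilon> * G2 s - B * G1 s"
  shows "\<bar>asi_local \<epsilon> B h (v (x - h)) (v x) (v (x + h)) - asi_local \<epsilon> B h (p (x - h)) (p x) (p (x + h))\<bar>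
    \<le> asi_local \<epsilon> B h (G (x - h)) (G x) (G (x + h))"
proof -
  have *: "0 \<le> asi_local \<epsilon> B h (G (x - h) - r * (v (x - h) - p (x - h))) (G x - r * (v x - p x))
      (G (x + h) - r * (v (x + h) - p (x + h)))" if r: "\<bar>r\<bar> = 1" for r
  proof (rule asi_local_nonneg[OF e, where v = "\<lambda>s. G s - r * (v s - p s)" and
        ?v1.0 = "\<lambda>s. G1 s - r * (v1 s - p1 s)" and ?v2.0 = "\<lambda>s. G2 s - r * (v2 s - p2 s)"])
    have "continuous_on {x - h..x + h} G" "continuous_on {x - h..x + h} p"
      using p(1) G(1) by (auto intro!: continuous_at_imp_continuous_on DERIV_isCont)
    then show "continuous_on {x - h..x + h} (\<lambda>s. G s - r * (v s - p s))"
      using v(1) by (intro continuous_intros)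
    fix s assume s: "s \<in> {x - h<..<x + h}"
    show "((\<lambda>s. G s - r * (v s - p s)) has_real_derivative G1 s - r * (v1 s - p1 s)) (at s)"
      by (auto intro!: derivative_eq_intros v(2)[OF s] p(1) G(1))
    show "((\<lambda>s. G1 s - r * (v1 s - p1 s)) has_real_derivative G2 s - r * (v2 s - p2 s)) (at s)"
      by (auto intro!: derivative_eq_intros v(3)[OF s] p(2) G(2))
    have "r = 1 \<or> r = -1" using r by linarith
    then show "0 \<le> - \<epsilon> * (G2 s - r * (v2 s - p2 s)) - B * (G1 s - r * (v1 s - p1 s))"
      using L[OF s] by (auto simp: algebra_simps abs_le_iff)
  qed
  have lin: "asi_local \<epsilon> B h (a - r * (d - k)) (a' - r * (d' - k')) (a'' - r * (d'' - k''))
     = asi_local \<epsilon> B h a a' a'' - r * (asi_local \<epsilon> B h d d' d'' - asi_local \<epsilon> B h k k' k'')"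
    for r a a' a'' d d' d'' k k' k''
    by (rule asi_local_coeffs[of \<epsilon> B h], simp only:, simp add: algebra_simps)
  show ?thesis using *[of 1] *[of "-1"] unfolding lin by (simp add: abs_le_iff)
qed

text \<open>These are the values of \<open>- (s - x) / B\<close>, whose source is 1. Thus the
  positive functional of the source has total mass 1, an average.\<close>

lemma asi_local_linear:
  assumes "\<epsilon> > 0" "B > 0" "h > 0"
  shows "asi_local \<epsilon> B h (h / B) 0 (- h / B) = 1"
proof -
  have "1 - exp (- (B * h / \<epsilon>)) > 0" using assms by simp
  then show ?thesis using assms by (simp add: asi_local_def field_simps)
qed

text \<open>The bounds \<open>0 \<le> x coth x - 1 \<le> x\<^sup>2\<close> with the denominator
  cleared. Both differences vanish at 0 and have nonnegative derivatives.\<close>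

lemma sinh_cosh_bounds:
  fixes x :: real
  assumes "x \<ge> 0"
  shows "sinh x \<le> x * cosh x" "x * cosh x \<le> (1 + x\<^sup>2) * sinh x"
proof -
  have "0 * cosh 0 - sinh 0 \<le> x * cosh x - sinh x"
  proof (rule DERIV_nonneg_imp_nondecreasing[OF assms])
    fix t :: real assume "0 \<le> t"
    then show "\<exists>y. ((\<lambda>x. x * cosh x - sinh x) has_real_derivative y) (at t) \<and> 0 \<le> y"
      by (intro exI[of _ "t * sinh t"] conjI) (auto intro!: derivative_eq_intros)
  qed
  then show "sinh x \<le> x * cosh x" by simp
  have "(1 + 0\<^sup>2) * sinh 0 - 0 * cosh 0 \<le> (1 + x\<^sup>2) * sinh x - x * cosh x"
  proof (rule DERIV_nonneg_imp_nondecreasing[OF assms])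
    fix t :: real assume "0 \<le> t"
    then show "\<exists>y. ((\<lambda>x. (1 + x\<^sup>2) * sinh x - x * cosh x) has_real_derivative y) (at t) \<and> 0 \<le> y"
      by (intro exI[of _ "t * sinh t + t\<^sup>2 * cosh t"] conjI)
        (auto intro!: derivative_eq_intros simp: algebra_simps)
  qed
  then show "x * cosh x \<le> (1 + x\<^sup>2) * sinh x" by simp
qed

text \<open>The quadratic below solves \<open>- \<epsilon> v'' - B v' = s - x\<close>; its discrete image is
  \<open>(\<epsilon>/B) (\<rho> coth \<rho> - 1)\<close> with \<open>\<rho> = B h / (2 \<epsilon>)\<close>, whence the gain of a second power of \<open>h\<close>.\<close>

lemma asi_local_quadratic:
  assumes e: "\<epsilon> > 0" "B > 0" "h > 0"
  shows "\<bar>asi_local \<epsilon> B h (- (h\<^sup>2 / (2 * B)) - \<epsilon> * h / B\<^sup>2) 0 (- (h\<^sup>2 / (2 * B)) + \<epsilon> * h / B\<^sup>2)\<bar> \<le> B * h\<^sup>2 / (4 * \<epsilon>)"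
proof -
  define q where "q = exp (- (B * h / \<epsilon>))"
  define r where "r = B * h / (2 * \<epsilon>)"
  have r: "r > 0" using e by (simp add: r_def)
  have q: "0 < q" "q < 1" using e by (auto simp: q_def)
  have s: "sinh r > 0" using r by simp
  have qr: "q = exp (- r) * exp (- r)" by (simp add: q_def r_def exp_add[symmetric])
  have coth: "(1 + q) / (1 - q) = cosh r / sinh r"
  proof -
    have "1 + q = 2 * exp (- r) * cosh r" "1 - q = 2 * exp (- r) * sinh r"
      unfolding qr by (auto simp: cosh_field_def sinh_field_def algebra_simps exp_add[symmetric])
    then show ?thesis by simp
  qed
  have "asi_local \<epsilon> B h (- (h\<^sup>2 / (2 * B)) - \<epsilon> * h / B\<^sup>2) 0 (- (h\<^sup>2 / (2 * B)) + \<epsilon> * h / B\<^sup>2)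
      = h / 2 * ((1 + q) / (1 - q)) - \<epsilon> / B"
  proof -
    have "asi_local \<epsilon> B h (- (h\<^sup>2 / (2 * B)) - \<epsilon> * h / B\<^sup>2) 0 (- (h\<^sup>2 / (2 * B)) + \<epsilon> * h / B\<^sup>2)
      = B / (h * (1 - q)) * (h\<^sup>2 / (2 * B) * (1 + q) - \<epsilon> * h / B\<^sup>2 * (1 - q))"
      unfolding asi_local_def q_def[symmetric]
      by (intro arg_cong2[where f = "(*)"] refl) (simp add: algebra_simps add_divide_distrib diff_divide_distrib)
    also have "\<dots> = h / 2 * ((1 + q) / (1 - q)) - \<epsilon> / B"
    proof -
      have "B / (h * d) * (h\<^sup>2 / (2 * B) * p - \<epsilon> * h / B\<^sup>2 * d) = h / 2 * (p / d) - \<epsilon> / B" if "d > 0" for p d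
        using e that by (simp add: field_simps power2_eq_square)
      then show ?thesis using q by simp
    qed
    finally show ?thesis .
  qed
  also have "\<dots> = \<epsilon> / B * (r * cosh r / sinh r - 1)"
    unfolding coth using e by (simp add: r_def field_simps)
  finally have eq: "asi_local \<epsilon> B h (- (h\<^sup>2 / (2 * B)) - \<epsilon> * h / B\<^sup>2) 0 (- (h\<^sup>2 / (2 * B)) + \<epsilon> * h / B\<^sup>2)
     = \<epsilon> / B * (r * cosh r / sinh r - 1)" .
  have "0 \<le> r * cosh r / sinh r - 1" "r * cosh r / sinh r - 1 \<le> r\<^sup>2"
    using sinh_cosh_bounds[of r] r s by (auto simp: field_simps)
  then have "\<bar>\<epsilon> / B * (r * cosh r / sinh r - 1)\<bar> \<le> \<epsilon> / B * r\<^sup>2"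
    unfolding abs_mult using e by (intro mult_mono) auto
  also have "\<dots> = B * h\<^sup>2 / (4 * \<epsilon>)" using e by (simp add: r_def field_simps power2_eq_square)
  finally show ?thesis unfolding eq .
qed

text \<open>The factor \<open>\<epsilon> / (\<mu> * (B - \<mu>))\<close> normalises the source to
  \<open>exp (- \<mu> (s - x) / \<epsilon>)\<close>, so this bounds the average of an exponential
  independently of \<open>h / \<epsilon>\<close>. With
  \<open>p = exp (- (\<mu> * h / \<epsilon>))\<close> the discrete image factors through
  \<open>(1 - p) * (1 - q / p)\<close>, where \<open>1 - p \<le> \<mu> * h / \<epsilon>\<close> and
  \<open>1 - q / p \<le> 1 - q\<close>.\<close>

lemma asi_local_exp:
  assumes e: "\<epsilon> > 0" "h > 0" and mu: "0 < \<mu>" "\<mu> < B"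
  shows "\<epsilon> / (\<mu> * (B - \<mu>)) * asi_local \<epsilon> B h (exp (\<mu> * h / \<epsilon>)) 1 (exp (- (\<mu> * h / \<epsilon>))) \<le> B / (B - \<mu>)"
proof -
  define q p where "q = exp (- (B * h / \<epsilon>))" and "p = exp (- (\<mu> * h / \<epsilon>))"
  have q: "0 < q" "q < 1" using e mu by (auto simp: q_def)
  have p: "0 < p" "p < 1" using e mu by (auto simp: p_def)
  have qp: "q < p" using e mu by (simp add: p_def q_def divide_strict_right_mono)
  have p1: "1 - p \<le> \<mu> * h / \<epsilon>" using exp_ge_add_one_self[of "- (\<mu> * h / \<epsilon>)"] by (simp add: p_def)
  have "q * p \<le> q * 1" using p q by (intro mult_left_mono) auto
  then have q1: "1 - q / p \<le> 1 - q" using p by (simp add: field_simps)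
  have "asi_local \<epsilon> B h (exp (\<mu> * h / \<epsilon>)) 1 (exp (- (\<mu> * h / \<epsilon>)))
      = B / (h * (1 - q)) * (q * (1 - 1 / p) - (p - 1))"
    by (simp add: asi_local_def q_def p_def exp_minus inverse_eq_divide)
  also have "\<dots> = B / (h * (1 - q)) * ((1 - p) * (1 - q / p))"
    using p by (simp add: field_simps)
  also have "\<dots> \<le> B / (h * (1 - q)) * ((\<mu> * h / \<epsilon>) * (1 - q))"
    using e mu q p qp p1 q1 by (intro mult_left_mono mult_mono) auto
  also have "\<dots> = B * \<mu> / \<epsilon>" using e q by simp
  finally have "\<epsilon> / (\<mu> * (B - \<mu>)) * asi_local \<epsilon> B h (exp (\<mu> * h / \<epsilon>)) 1 (exp (- (\<mu> * h / \<epsilon>)))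
     \<le> \<epsilon> / (\<mu> * (B - \<mu>)) * (B * \<mu> / \<epsilon>)" using e mu by (intro mult_left_mono) auto
  also have "\<dots> = B / (B - \<mu>)" using e mu by simp
  finally show ?thesis .
qed

text \<open>The quadratic \<open>p\<close> has source \<open>A + m * (s - x)\<close> exactly. The
  linear \<open>G\<close> has constant source \<open>R\<close>, reproduced by the functional because
  its mass is 1.\<close>

lemma asi_local_linear_source:
  fixes v v1 v2 :: "real \<Rightarrow> real"
  assumes e: "\<epsilon> > 0" "B > 0" "h > 0"
    and v: "continuous_on {x - h..x + h} v"
      "\<And>s. s \<in> {x - h<..<x + h} \<Longrightarrow> (v has_real_derivative v1 s) (at s)"
      "\<And>s. s \<in> {x - h<..<x + h} \<Longrightarrow> (v1 has_real_derivative v2 s) (at s)"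
    and L: "\<And>s. s \<in> {x - h<..<x + h} \<Longrightarrow> \<bar>(- \<epsilon> * v2 s - B * v1 s) - (A + m * (s - x))\<bar> \<le> R"
  shows "\<bar>asi_local \<epsilon> B h (v (x - h)) (v x) (v (x + h)) - A\<bar> \<le> \<bar>m\<bar> * (B * h\<^sup>2 / (4 * \<epsilon>)) + R"
proof -
  define p where "p = (\<lambda>s. A * (- (s - x) / B) + m * (- ((s - x)\<^sup>2 / (2 * B)) + \<epsilon> * (s - x) / B\<^sup>2))"
  define p1 where "p1 = (\<lambda>s. - A / B + m * (- (s - x) / B + \<epsilon> / B\<^sup>2))"
  define G where "G = (\<lambda>s. R * (- (s - x) / B))"
  let ?\<mu> = "asi_local \<epsilon> B h (- (h\<^sup>2 / (2 * B)) - \<epsilon> * h / B\<^sup>2) 0 (- (h\<^sup>2 / (2 * B)) + \<epsilon> * h / B\<^sup>2)"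
  have "\<bar>asi_local \<epsilon> B h (v (x - h)) (v x) (v (x + h)) - asi_local \<epsilon> B h (p (x - h)) (p x) (p (x + h))\<bar>
    \<le> asi_local \<epsilon> B h (G (x - h)) (G x) (G (x + h))"
  proof (rule asi_local_compare[OF e v, where ?p1.0 = p1 and ?p2.0 = "\<lambda>_. - m / B"
        and ?G1.0 = "\<lambda>_. - R / B" and ?G2.0 = "\<lambda>_. 0"])
    show "(p has_real_derivative p1 s) (at s)" for s unfolding p_def p1_def
      using e by (auto intro!: derivative_eq_intros simp: field_simps power2_eq_square)
    show "(p1 has_real_derivative - m / B) (at s)" for s unfolding p1_def
      using e by (auto intro!: derivative_eq_intros)
    show "(G has_real_derivative - R / B) (at s)" for s unfolding G_def
      using e by (auto intro!: derivative_eq_intros)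
    fix s assume s: "s \<in> {x - h<..<x + h}"
    have "- \<epsilon> * (- m / B) - B * p1 s = A + m * (s - x)"
      using e by (simp add: p1_def field_simps power2_eq_square)
    then show "\<bar>- \<epsilon> * v2 s - B * v1 s - (- \<epsilon> * (- m / B) - B * p1 s)\<bar> \<le> - \<epsilon> * 0 - B * (- R / B)"
      using L[OF s] e by simp
  qed auto
  moreover have "asi_local \<epsilon> B h (G (x - h)) (G x) (G (x + h)) = R"
    using asi_local_scale[of \<epsilon> B h R "h / B" 0 "- h / B"] asi_local_linear[OF e] by (simp add: G_def)
  moreover have "asi_local \<epsilon> B h (p (x - h)) (p x) (p (x + h)) = A + m * ?\<mu>"
  proof -
    have "asi_local \<epsilon> B h (p (x - h)) (p x) (p (x + h))
      = asi_local \<epsilon> B h (A * (h / B) + m * (- (h\<^sup>2 / (2 * B)) - \<epsilon> * h / B\<^sup>2)) (A * 0 + m * 0)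
         (A * (- h / B) + m * (- (h\<^sup>2 / (2 * B)) + \<epsilon> * h / B\<^sup>2))"
      by (simp add: p_def algebra_simps)
    then show ?thesis unfolding asi_local_add asi_local_scale asi_local_linear[OF e] by simp
  qed
  moreover have "\<bar>m * ?\<mu>\<bar> \<le> \<bar>m\<bar> * (B * h\<^sup>2 / (4 * \<epsilon>))"
    unfolding abs_mult using asi_local_quadratic[OF e] by (intro mult_left_mono) auto
  ultimately show ?thesis by linarith
qed

lemma asi_local_exp_source:
  fixes v v1 v2 :: "real \<Rightarrow> real"
  assumes e: "\<epsilon> > 0" "h > 0" and mu: "0 < \<mu>" "\<mu> < B" "0 < \<nu>" "\<nu> < B" and S: "S \<ge> 0"
    and v: "continuous_on {x - h..x + h} v"
      "\<And>s. s \<in> {x - h<..<x + h} \<Longrightarrow> (v has_real_derivative v1 s) (at s)"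
      "\<And>s. s \<in> {x - h<..<x + h} \<Longrightarrow> (v1 has_real_derivative v2 s) (at s)"
    and L: "\<And>s. s \<in> {x - h<..<x + h} \<Longrightarrow> \<bar>(- \<epsilon> * v2 s - B * v1 s) - A\<bar>
       \<le> R + S * (exp (- (\<mu> * (s - x) / \<epsilon>)) + exp (- (\<nu> * (s - x) / \<epsilon>)))"
  shows "\<bar>asi_local \<epsilon> B h (v (x - h)) (v x) (v (x + h)) - A\<bar> \<le> R + S * (B / (B - \<mu>) + B / (B - \<nu>))"
proof -
  have B: "B > 0" using mu by simp
  define p where "p = (\<lambda>s. A * (- (s - x) / B))"
  \<comment> \<open>Chosen so that \<open>k \<mu> * X \<mu>\<close> has source
    \<open>X \<mu>\<close>.\<close>
  define k where "k = (\<lambda>\<mu>. \<epsilon> / (\<mu> * (B - \<mu>)))"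
  define X where "X = (\<lambda>\<mu> s. exp (- (\<mu> * (s - x) / \<epsilon>)))"
  define G where "G = (\<lambda>s. R * (- (s - x) / B) + S * (k \<mu> * X \<mu> s + k \<nu> * X \<nu> s))"
  have X: "(X \<mu> has_real_derivative - (\<mu> / \<epsilon>) * X \<mu> s) (at s)" for \<mu> s unfolding X_def
    using e by (auto intro!: derivative_eq_intros simp: field_simps)
  have "\<bar>asi_local \<epsilon> B h (v (x - h)) (v x) (v (x + h)) - asi_local \<epsilon> B h (p (x - h)) (p x) (p (x + h))\<bar>
    \<le> asi_local \<epsilon> B h (G (x - h)) (G x) (G (x + h))"
  proof (rule asi_local_compare[OF e(1) B e(2) v, where ?p1.0 = "\<lambda>_. - A / B" and ?p2.0 = "\<lambda>_. 0"
        and ?G1.0 = "\<lambda>s. - R / B + S * (k \<mu> * (- (\<mu> / \<epsilon>) * X \<mu> s) + k \<nu> * (- (\<nu> / \<epsilon>) * X \<nu> s))"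
        and ?G2.0 = "\<lambda>s. S * (k \<mu> * ((\<mu> / \<epsilon>)\<^sup>2 * X \<mu> s) + k \<nu> * ((\<nu> / \<epsilon>)\<^sup>2 * X \<nu> s))"])
    show "(p has_real_derivative - A / B) (at s)" for s unfolding p_def
      using B by (auto intro!: derivative_eq_intros)
    show "(G has_real_derivative - R / B + S * (k \<mu> * (- (\<mu> / \<epsilon>) * X \<mu> s) + k \<nu> * (- (\<nu> / \<epsilon>) * X \<nu> s))) (at s)" for s
      unfolding G_def using B by (auto intro!: derivative_eq_intros X simp: mult_ac)
    show "((\<lambda>s. - R / B + S * (k \<mu> * (- (\<mu> / \<epsilon>) * X \<mu> s) + k \<nu> * (- (\<nu> / \<epsilon>) * X \<nu> s))) has_real_derivative
      S * (k \<mu> * ((\<mu> / \<epsilon>)\<^sup>2 * X \<mu> s) + k \<nu> * ((\<nu> / \<epsilon>)\<^sup>2 * X \<nu> s))) (at s)" for s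
      using e by (auto intro!: derivative_eq_intros X simp: power2_eq_square mult_ac)
    fix s assume s: "s \<in> {x - h<..<x + h}"
    have one: "- \<epsilon> * (k \<mu> * ((\<mu> / \<epsilon>)\<^sup>2 * y)) - B * (k \<mu> * (- (\<mu> / \<epsilon>) * y)) = y"
      if "0 < \<mu>" "\<mu> < B" for \<mu> y
    proof -
      have "- \<epsilon> * (k \<mu> * ((\<mu> / \<epsilon>)\<^sup>2 * y)) - B * (k \<mu> * (- (\<mu> / \<epsilon>) * y)) = k \<mu> * (\<mu> * (B - \<mu>) / \<epsilon>) * y"
        using e by (simp add: field_simps power2_eq_square)
      then show ?thesis using that e by (simp add: k_def)
    qed
    have "- \<epsilon> * (S * (k \<mu> * ((\<mu> / \<epsilon>)\<^sup>2 * X \<mu> s) + k \<nu> * ((\<nu> / \<epsilon>)\<^sup>2 * X \<nu> s)))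
        - B * (- R / B + S * (k \<mu> * (- (\<mu> / \<epsilon>) * X \<mu> s) + k \<nu> * (- (\<nu> / \<epsilon>) * X \<nu> s)))
      = R + S * ((- \<epsilon> * (k \<mu> * ((\<mu> / \<epsilon>)\<^sup>2 * X \<mu> s)) - B * (k \<mu> * (- (\<mu> / \<epsilon>) * X \<mu> s)))
         + (- \<epsilon> * (k \<nu> * ((\<nu> / \<epsilon>)\<^sup>2 * X \<nu> s)) - B * (k \<nu> * (- (\<nu> / \<epsilon>) * X \<nu> s))))"
      using B by (simp add: algebra_simps)
    also have "\<dots> = R + S * (X \<mu> s + X \<nu> s)" unfolding one[OF mu(1,2)] one[OF mu(3,4)] ..
    finally show "\<bar>- \<epsilon> * v2 s - B * v1 s - (- \<epsilon> * 0 - B * (- A / B))\<bar>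
      \<le> - \<epsilon> * (S * (k \<mu> * ((\<mu> / \<epsilon>)\<^sup>2 * X \<mu> s) + k \<nu> * ((\<nu> / \<epsilon>)\<^sup>2 * X \<nu> s)))
        - B * (- R / B + S * (k \<mu> * (- (\<mu> / \<epsilon>) * X \<mu> s) + k \<nu> * (- (\<nu> / \<epsilon>) * X \<nu> s)))"
      using L[OF s] B by (simp add: X_def)
  qed auto
  moreover have "asi_local \<epsilon> B h (p (x - h)) (p x) (p (x + h)) = A"
    using asi_local_scale[of \<epsilon> B h A "h / B" 0 "- h / B"] asi_local_linear[OF e(1) B e(2)] by (simp add: p_def)
  moreover have "asi_local \<epsilon> B h (G (x - h)) (G x) (G (x + h)) \<le> R + S * (B / (B - \<mu>) + B / (B - \<nu>))"
  proof -
    let ?X = "\<lambda>\<mu>. asi_local \<epsilon> B h (exp (\<mu> * h / \<epsilon>)) 1 (exp (- (\<mu> * h / \<epsilon>)))"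
    have "asi_local \<epsilon> B h (G (x - h)) (G x) (G (x + h)) =
      asi_local \<epsilon> B h (R * (h / B) + S * (k \<mu> * exp (\<mu> * h / \<epsilon>) + k \<nu> * exp (\<nu> * h / \<epsilon>)))
       (R * 0 + S * (k \<mu> * 1 + k \<nu> * 1))
       (R * (- h / B) + S * (k \<mu> * exp (- (\<mu> * h / \<epsilon>)) + k \<nu> * exp (- (\<nu> * h / \<epsilon>))))"
      by (simp add: G_def X_def algebra_simps)
    also have "\<dots> = R + S * (k \<mu> * ?X \<mu> + k \<nu> * ?X \<nu>)"
      unfolding asi_local_add asi_local_scale asi_local_linear[OF e(1) B e(2)] by simp
    also have "\<dots> \<le> R + S * (B / (B - \<mu>) + B / (B - \<nu>))"
      using asi_local_exp[OF e mu(1,2)] asi_local_exp[OF e mu(3,4)] S unfolding k_def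
      by (intro add_left_mono mult_left_mono add_mono) auto
    finally show ?thesis .
  qed
  ultimately show ?thesis by linarith
qed

section \<open>Consistency\<close>

text \<open>The last bound measures the departure from the unfitted scheme: \<epsilon> times it is
  at most \<open>b (x i)\<close> times the forward step, which is what the transition point
  needs.\<close>

lemma sigma_bounds:
  assumes "\<rho> > 0"
  shows "0 < sigma \<rho>" "sigma \<rho> \<le> 1" "1 - sigma \<rho> \<le> 2 * \<rho>"
proof -
  have p: "exp (2 * \<rho>) - 1 > 0" using assms by simp
  then show "0 < sigma \<rho>" using assms by (simp add: sigma_def)
  have "2 * \<rho> \<le> exp (2 * \<rho>) - 1" using exp_ge_add_one_self[of "2 * \<rho>"] by linarith
  then show "sigma \<rho> \<le> 1" using assms p by (simp add: sigma_def)
  have "1 - 2 * \<rho> \<le> exp (- (2 * \<rho>))" using exp_ge_add_one_self[of "- (2 * \<rho>)"] by simp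
  also have "\<dots> \<le> sigma \<rho>"
  proof -
    have "exp (- (2 * \<rho>)) * (exp (2 * \<rho>) - 1) = 1 - exp (- (2 * \<rho>))"
      by (simp add: algebra_simps exp_add[symmetric])
    also have "\<dots> \<le> 2 * \<rho>" using exp_ge_add_one_self[of "- (2 * \<rho>)"] by simp
    finally show ?thesis using assms p by (simp add: sigma_def pos_le_divide_eq)
  qed
  finally show "1 - sigma \<rho> \<le> 2 * \<rho>" by simp
qed

lemma abs_add5_le:
  fixes a1 a2 a3 a4 a5 :: real
  assumes "\<bar>a1\<bar> \<le> b1" "\<bar>a2\<bar> \<le> b2" "\<bar>a3\<bar> \<le> b3" "\<bar>a4\<bar> \<le> b4" "\<bar>a5\<bar> \<le> b5"
  shows "\<bar>a1 + a2 + a3 + a4 + a5\<bar> \<le> b1 + b2 + b3 + b4 + b5"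
  using assms by linarith

text \<open>One \<epsilon> and one solution are now fixed, but \<open>C\<close> is a parameter
  supplied from outside. The estimates below therefore display constants in which \<epsilon> does
  not occur.\<close>

locale layer_solution = convection_diffusion +
  fixes \<epsilon> :: real and w w1 w2 :: "real \<Rightarrow> real" and C :: real
  assumes sol: "solution \<epsilon> w w1 w2" and C_ge1: "1 \<le> C"
    and w_bound: "\<And>x. x \<in> {0..1} \<Longrightarrow> \<bar>w x\<bar> \<le> C * (\<epsilon> + exp (- \<beta> * x / \<epsilon>))"
    and w1_bound: "\<And>x. x \<in> {0<..<1} \<Longrightarrow> \<bar>w1 x\<bar> \<le> C * (\<epsilon> + exp (- \<beta> * x / \<epsilon>) / \<epsilon>)"
    and w2_bound: "\<And>x. x \<in> {0<..<1} \<Longrightarrow> \<bar>w2 x\<bar> \<le> C * (1 + exp (- \<beta> * x / \<epsilon>) / \<epsilon>\<^sup>2)"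
begin

section \<open>Layer function and local variation of the solution\<close>

definition E :: "real \<Rightarrow> real" where "E x = exp (- \<beta> * x / \<epsilon>)"

lemma eps: "0 < \<epsilon>" "\<epsilon> < 1"
  and w_cont: "continuous_on {0..1} w"
  and w_deriv: "\<And>x. x \<in> {0<..<1} \<Longrightarrow> (w has_real_derivative w1 x) (at x)"
  and w1_deriv: "\<And>x. x \<in> {0<..<1} \<Longrightarrow> (w1 has_real_derivative w2 x) (at x)"
  and w_eq: "\<And>x. x \<in> {0<..<1} \<Longrightarrow> - \<epsilon> * w2 x - b x * w1 x + c x * w x = \<epsilon> * g x"
  using sol by (auto simp: solution_def)

lemma E_pos [simp]: "0 < E x"
  by (simp add: E_def)

lemma E_mono: "x \<le> y \<Longrightarrow> E y \<le> E x"
  using eps \<beta>_pos by (simp add: E_def divide_right_mono)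

text \<open>The layer grows to the left, within a fine step only by a fixed factor \<open>M\<close>.
  Over a coarse step this factor is not under control, hence the separate treatment there.\<close>

lemma E_le_left:
  assumes "exp (\<beta> * h / \<epsilon>) \<le> M" "x - h \<le> s"
  shows "E s \<le> M * E x"
proof -
  have "E s \<le> E (x - h)" using assms by (intro E_mono)
  also have "\<dots> = exp (\<beta> * h / \<epsilon>) * E x"
    by (simp add: E_def exp_add[symmetric] right_diff_distrib diff_divide_distrib)
  also have "\<dots> \<le> M * E x" using assms by (intro mult_right_mono) (auto simp: less_imp_le)
  finally show ?thesis .
qed

lemma E_le_divide: "E x \<le> E x / \<epsilon>"
  using eps by (simp add: pos_le_divide_eq mult_left_le less_imp_le)

text \<open>Integrating the bound on \<open>w1\<close> removes the factor
  \<open>1 / \<epsilon>\<close> of the layer part: its contribution is at most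
  \<open>E x / \<beta>\<close> however long the interval, so the estimate survives on coarse
  steps.\<close>

lemma w_variation:
  assumes "0 \<le> x" "x \<le> s" "s \<le> 1"
  shows "\<bar>w s - w x\<bar> \<le> C * (\<epsilon> * (s - x) + E x / \<beta>)"
proof -
  have "\<bar>w s - w x\<bar> \<le> C * (\<epsilon> * s - E s / \<beta>) - C * (\<epsilon> * x - E x / \<beta>)"
  proof (rule abs_diff_le_of_deriv[OF assms(2), where f' = w1 and F' = "\<lambda>t. C * (\<epsilon> + E t / \<epsilon>)"])
    show "continuous_on {x..s} w" using assms by (intro continuous_on_subset[OF w_cont]) auto
    show "continuous_on {x..s} (\<lambda>t. C * (\<epsilon> * t - E t / \<beta>))"
      unfolding E_def using eps \<beta>_pos by (intro continuous_intros) auto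
    fix t assume "x < t" "t < s"
    then have t: "t \<in> {0<..<1}" using assms by auto
    show "(w has_real_derivative w1 t) (at t)" by (rule w_deriv[OF t])
    show "((\<lambda>t. C * (\<epsilon> * t - E t / \<beta>)) has_real_derivative C * (\<epsilon> + E t / \<epsilon>)) (at t)"
      unfolding E_def using eps \<beta>_pos by (auto intro!: derivative_eq_intros simp: field_simps)
    show "\<bar>w1 t\<bar> \<le> C * (\<epsilon> + E t / \<epsilon>)" using w1_bound[OF t] by (simp add: E_def)
  qed
  also have "\<dots> = C * (\<epsilon> * (s - x) + E x / \<beta>) - C * (E s / \<beta>)" by (simp add: algebra_simps)
  also have "\<dots> \<le> C * (\<epsilon> * (s - x) + E x / \<beta>)" using C_ge1 \<beta>_pos by (simp add: less_imp_le)
  finally show ?thesis .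
qed

text \<open>With the layer frozen at an upper bound \<open>Em\<close>, the pointwise bounds become
  constants on the interval. In the applications \<open>Em\<close> is
  \<open>M * E x\<close>.\<close>

context
  fixes l u Em :: real
  assumes lu: "0 \<le> l" "u \<le> 1" and Em: "\<forall>t\<in>{l<..<u}. E t \<le> Em"
begin

lemma w_bound_on:
  assumes "t \<in> {l<..<u}"
  shows "\<bar>w t\<bar> \<le> C * (\<epsilon> + Em)" "\<bar>w1 t\<bar> \<le> C * (\<epsilon> + Em / \<epsilon>)" "\<bar>w2 t\<bar> \<le> C * (1 + Em / \<epsilon>\<^sup>2)"
proof -
  have t: "t \<in> {0<..<1}" using assms lu by auto
  have "C * (\<epsilon> + E t) \<le> C * (\<epsilon> + Em)" "C * (\<epsilon> + E t / \<epsilon>) \<le> C * (\<epsilon> + Em / \<epsilon>)"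
    "C * (1 + E t / \<epsilon>\<^sup>2) \<le> C * (1 + Em / \<epsilon>\<^sup>2)"
    using bspec[OF Em assms] C_ge1 eps by (auto intro!: mult_left_mono add_mono divide_right_mono)
  then show "\<bar>w t\<bar> \<le> C * (\<epsilon> + Em)" "\<bar>w1 t\<bar> \<le> C * (\<epsilon> + Em / \<epsilon>)" "\<bar>w2 t\<bar> \<le> C * (1 + Em / \<epsilon>\<^sup>2)"
    using w_bound[of t] w1_bound[of t] w2_bound[of t] t unfolding E_def by force+
qed

lemma w_diff:
  assumes "s \<in> {l<..<u}" "t \<in> {l<..<u}"
  shows "\<bar>w s - w t\<bar> \<le> C * (\<epsilon> + Em / \<epsilon>) * \<bar>s - t\<bar>" "\<bar>w1 s - w1 t\<bar> \<le> C * (1 + Em / \<epsilon>\<^sup>2) * \<bar>s - t\<bar>"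
proof -
  have I: "x \<in> {0<..<1}" if "x \<in> {l<..<u}" for x using that lu by auto
  show "\<bar>w s - w t\<bar> \<le> C * (\<epsilon> + Em / \<epsilon>) * \<bar>s - t\<bar>"
    by (rule abs_diff_le_on[OF w_deriv[OF I] w_bound_on(2) assms])
  show "\<bar>w1 s - w1 t\<bar> \<le> C * (1 + Em / \<epsilon>\<^sup>2) * \<bar>s - t\<bar>"
    by (rule abs_diff_le_on[OF w1_deriv[OF I] w_bound_on(3) assms])
qed

lemma w_taylor:
  assumes s: "s \<in> {l<..<u}" and t: "t \<in> {l<..<u}" and h: "\<bar>s - t\<bar> \<le> h"
  shows "\<bar>w s - w t - w1 t * (s - t)\<bar> \<le> C * (1 + Em / \<epsilon>\<^sup>2) * h\<^sup>2"
proof -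
  have P: "0 \<le> C * (1 + Em / \<epsilon>\<^sup>2)" using w_bound_on(3)[OF t] by (meson abs_ge_zero order_trans)
  have I: "x \<in> {0<..<1}" if "x \<in> {l<..<u}" for x using that lu by auto
  have "\<bar>w s - w t - w1 t * (s - t)\<bar> \<le> C * (1 + Em / \<epsilon>\<^sup>2) * (s - t)\<^sup>2"
    by (rule abs_taylor_le[OF w_deriv[OF I] w_diff(2) P s t])
  also have "\<dots> \<le> C * (1 + Em / \<epsilon>\<^sup>2) * h\<^sup>2"
    using P h by (intro mult_left_mono) (auto simp: power2_le_iff_abs_le)
  finally show ?thesis .
qed

text \<open>Instead of a third derivative, the equations at \<open>s\<close> and \<open>t\<close>,
  solved for \<open>\<epsilon> * w2\<close>, are subtracted. The difference has five terms, each at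
  most \<open>K * X * d\<close>, whence the 5.\<close>

lemma w2_diff:
  assumes s: "s \<in> {l<..<u}" and t: "t \<in> {l<..<u}"
  shows "\<epsilon> * \<bar>w2 s - w2 t\<bar> \<le> 5 * K * C * (1 + Em / \<epsilon>\<^sup>2) * \<bar>s - t\<bar>"
proof -
  have I: "s \<in> {0<..<1}" "t \<in> {0<..<1}" using s t lu by auto
  define d where "d = \<bar>s - t\<bar>"
  define X where "X = C * (1 + Em / \<epsilon>\<^sup>2)"
  have Em0: "Em > 0" using bspec[OF Em s] E_pos[of s] by linarith
  have "\<epsilon>\<^sup>2 \<le> \<epsilon>" "\<epsilon>\<^sup>2 \<le> 1" using eps by (auto simp: power2_eq_square mult_left_le mult_le_one)
  then have "Em / \<epsilon> \<le> Em / \<epsilon>\<^sup>2" "Em / 1 \<le> Em / \<epsilon>\<^sup>2"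
    using eps Em0 by (intro divide_left_mono; simp)+
  then have Emd: "Em / \<epsilon> \<le> Em / \<epsilon>\<^sup>2" "Em \<le> Em / \<epsilon>\<^sup>2" by auto
  have d0: "d \<ge> 0" and X0: "X \<ge> 0" using Em0 C_ge1 by (auto simp: d_def X_def)
  have X1: "C * (\<epsilon> + Em / \<epsilon>) \<le> X" "C * (\<epsilon> + Em) \<le> X" "1 \<le> X"
  proof -
    show "C * (\<epsilon> + Em / \<epsilon>) \<le> X" "C * (\<epsilon> + Em) \<le> X"
      unfolding X_def using Emd eps C_ge1 by (intro mult_left_mono; simp)+
    have "1 * 1 \<le> C * (1 + Em / \<epsilon>\<^sup>2)" using Em0 C_ge1 by (intro mult_mono) auto
    then show "1 \<le> X" by (simp add: X_def)
  qed
  have bs: "\<bar>b s\<bar> \<le> K" "\<bar>c s\<bar> \<le> K" using b_pos[OF I(1)] b_upper[OF I(1)] c_nonneg[OF I(1)] c_upper[OF I(1)] by auto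
  have K0: "K \<ge> 0" using K_ge1 by simp
  have "\<epsilon> * (w2 s - w2 t) = (- b s) * (w1 s - w1 t) + (b t - b s) * w1 t
      + c s * (w s - w t) + (c s - c t) * w t + (- \<epsilon>) * (g s - g t)"
    using w_eq[OF I(1)] w_eq[OF I(2)] by (simp add: algebra_simps)
  then have "\<epsilon> * \<bar>w2 s - w2 t\<bar> = \<bar>(- b s) * (w1 s - w1 t) + (b t - b s) * w1 t
      + c s * (w s - w t) + (c s - c t) * w t + (- \<epsilon>) * (g s - g t)\<bar>"
    using eps(1) by (metis abs_mult abs_of_pos)
  also have "\<dots> \<le> K * (X * d) + (K * d) * X + K * (X * d) + (K * d) * X + 1 * (K * d)"
    unfolding abs_mult
  proof (intro abs_add5_le; unfold abs_mult; intro mult_mono)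
    show "\<bar>w1 s - w1 t\<bar> \<le> X * d" using w_diff(2)[OF s t] by (simp add: X_def d_def)
    show "\<bar>w s - w t\<bar> \<le> X * d"
      using w_diff(1)[OF s t] mult_right_mono[OF X1(1) d0] by (simp add: d_def)
    show "\<bar>w1 t\<bar> \<le> X" "\<bar>w t\<bar> \<le> X" using w_bound_on[OF t] X1 by linarith+
    show "\<bar>b t - b s\<bar> \<le> K * d" using b_lip[OF I] by (simp add: d_def abs_minus_commute)
  qed (use c_lip[OF I] g_lip[OF I] bs eps X0 d0 K0 in \<open>auto simp: d_def\<close>)
  also have "\<dots> \<le> K * (X * d) + (K * d) * X + K * (X * d) + (K * d) * X + X * (K * d)"
    using X1(3) d0 K0 by (intro add_left_mono mult_right_mono) auto
  finally show ?thesis by (simp add: X_def d_def algebra_simps)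
qed

end

text \<open>The source seen by the scheme with coefficient frozen at \<open>x\<close>. At
  \<open>s = x\<close> it is \<open>\<epsilon> * g x - c x * w x\<close>, the value the scheme ought
  to return, so only its variation in \<open>s\<close> produces an error.\<close>

lemma uniform_source:
  assumes "s \<in> {0<..<1}" "x \<in> {0<..<1}"
  shows "- \<epsilon> * w2 s - b x * w1 s = \<epsilon> * g s - c s * w s + (b s - b x) * w1 s"
  using w_eq[OF assms(1)] by (simp add: algebra_simps)

text \<open>The term linear in \<open>s - x\<close> is split off the source, since the scheme integrates it with an
  additional factor \<open>h/\<epsilon>\<close>; bounding it absolutely would cost a factor \<open>ln N\<close>.\<close>

lemma consistency_fine:
  assumes h: "0 < h" "h \<le> M * \<epsilon>" "exp (\<beta> * h / \<epsilon>) \<le> M" and x: "0 \<le> x - h" "x + h \<le> 1"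
  shows "\<bar>asi_local \<epsilon> (b x) h (w (x - h)) (w x) (w (x + h)) - (\<epsilon> * g x - c x * w x)\<bar>
    \<le> 4 * K\<^sup>2 * C * M\<^sup>2 * (\<epsilon> * h + h\<^sup>2 + (h + h\<^sup>2 / \<epsilon>\<^sup>2) * E x)"
proof -
  have M1: "1 \<le> M"
  proof -
    have "1 \<le> exp (\<beta> * h / \<epsilon>)" using \<beta>_pos h eps by simp
    then show ?thesis using h by linarith
  qed
  have xI: "x \<in> {0<..<1}" and xlu: "x \<in> {x - h<..<x + h}" using x h by auto
  define e where "e = E x"
  have e0: "e > 0" by (simp add: e_def)
  have Em: "\<forall>t\<in>{x - h<..<x + h}. E t \<le> M * e"
    using h unfolding e_def by (intro ballI E_le_left) auto
  note bnd = w_bound_on[OF x Em] w_diff[OF x Em _ xlu] w_taylor[OF x Em _ xlu]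
  define W2 where "W2 = C * (1 + M * e / \<epsilon>\<^sup>2)"
  define W1 where "W1 = C * (\<epsilon> + M * e / \<epsilon>)"
  define W0 where "W0 = C * (\<epsilon> + M * e)"
  have W: "W0 \<ge> 0" "W1 \<ge> 0" "W2 \<ge> 0" using eps e0 M1 C_ge1 by (auto simp: W0_def W1_def W2_def)
  define R where "R = \<epsilon> * (K * h) + (K * h) * W0 + K * (W2 * h\<^sup>2) + (K * h\<^sup>2) * W1 + (K * h) * (W2 * h)"
  \<comment> \<open>The part of the derivative of the source at \<open>x\<close> that carries
    \<open>w1\<close>, of size \<open>E x / \<epsilon>\<close>. The variations of \<open>g\<close>
    and of the factor \<open>c\<close> are small enough to be bounded absolutely.\<close>
  define m where "m = (b' x - c x) * w1 x"
  have K0: "K \<ge> 0" using K_ge1 by simp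
  have main: "\<bar>asi_local \<epsilon> (b x) h (w (x - h)) (w x) (w (x + h)) - (\<epsilon> * g x - c x * w x)\<bar>
    \<le> \<bar>m\<bar> * (b x * h\<^sup>2 / (4 * \<epsilon>)) + R"
  proof (rule asi_local_linear_source[OF eps(1) b_pos[OF xI] h(1), where ?v1.0 = w1 and ?v2.0 = w2])
    show "continuous_on {x - h..x + h} w" using x by (intro continuous_on_subset[OF w_cont]) auto
    fix s assume s: "s \<in> {x - h<..<x + h}"
    then have sI: "s \<in> {0<..<1}" using x by auto
    show "(w has_real_derivative w1 s) (at s)" "(w1 has_real_derivative w2 s) (at s)"
      using w_deriv[OF sI] w1_deriv[OF sI] by auto
    define y where "y = s - x"
    have y: "\<bar>y\<bar> \<le> h" using s by (auto simp: y_def)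
    then have y2: "y\<^sup>2 \<le> h\<^sup>2" using abs_le_square_iff[of y h] h by auto
    have "(- \<epsilon> * w2 s - b x * w1 s) - (\<epsilon> * g x - c x * w x + m * (s - x))
      = \<epsilon> * (g s - g x) + (c x - c s) * w s + (- c x) * (w s - w x - w1 x * y)
        + (b s - b x - b' x * y) * w1 s + (b' x * y) * (w1 s - w1 x)"
      unfolding uniform_source[OF sI xI] by (simp add: m_def y_def algebra_simps)
    also have "\<bar>\<dots>\<bar> \<le> \<epsilon> * (K * h) + (K * h) * W0 + K * (W2 * h\<^sup>2) + (K * h\<^sup>2) * W1 + (K * h) * (W2 * h)"
    proof (intro abs_add5_le; unfold abs_mult; intro mult_mono)
      have Ky: "K * \<bar>y\<bar> \<le> K * h" using y K0 by (intro mult_left_mono)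
      show "\<bar>g s - g x\<bar> \<le> K * h" "\<bar>c x - c s\<bar> \<le> K * h"
        using g_lip[OF sI xI] c_lip[OF sI xI] Ky by (auto simp: y_def abs_minus_commute)
      show "\<bar>w s\<bar> \<le> W0" "\<bar>w1 s\<bar> \<le> W1" using bnd(1,2)[OF s] by (auto simp: W0_def W1_def)
      show "\<bar>- c x\<bar> \<le> K" "\<bar>b' x\<bar> \<le> K" using c_nonneg[OF xI] c_upper[OF xI] b'_bound[OF xI] by auto
      show "\<bar>w s - w x - w1 x * y\<bar> \<le> W2 * h\<^sup>2" using bnd(6)[OF s, of h] y by (simp add: y_def W2_def)
      have "K * y\<^sup>2 \<le> K * h\<^sup>2" using y2 K0 by (intro mult_left_mono)
      then show "\<bar>b s - b x - b' x * y\<bar> \<le> K * h\<^sup>2" using b_taylor[OF xI sI] by (simp add: y_def)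
      have "\<bar>w1 s - w1 x\<bar> \<le> W2 * \<bar>y\<bar>" using bnd(5)[OF s] by (simp add: y_def W2_def)
      also have "\<dots> \<le> W2 * h" using y W by (intro mult_left_mono)
      finally show "\<bar>w1 s - w1 x\<bar> \<le> W2 * h" .
    qed (use eps K0 W h y c_nonneg[OF xI] c_upper[OF xI] in auto)
    finally have "\<bar>- \<epsilon> * w2 s - b x * w1 s - (\<epsilon> * g x - c x * w x + m * (s - x))\<bar> \<le> R"
      unfolding R_def .
    then show "\<bar>- \<epsilon> * w2 s - b x * w1 s - (\<epsilon> * g x - c x * w x + m * (s - x))\<bar> \<le> R" .
  qed
  have KC: "K * C \<ge> 0" using K0 C_ge1 by simp
  define T where "T = \<epsilon> * h + h\<^sup>2 + (h + h\<^sup>2 / \<epsilon>\<^sup>2) * e"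
  \<comment> \<open>One factor \<open>h\<close> is traded for \<open>M * \<epsilon>\<close>, turning
    the layer derivative back into a layer value.\<close>
  have heM: "h\<^sup>2 * (M * e / \<epsilon>) \<le> M\<^sup>2 * (h * e)"
  proof -
    have "h * (h * (M * e / \<epsilon>)) \<le> (M * \<epsilon>) * (h * (M * e / \<epsilon>))"
      using h e0 M1 eps by (intro mult_right_mono) auto
    then show ?thesis using eps by (simp add: power2_eq_square mult_ac)
  qed
  have MM: "1 \<le> M\<^sup>2" "M \<le> M\<^sup>2" using M1 self_le_power[of M 2] one_le_power[of M 2] by auto
  have h1: "\<epsilon> * h\<^sup>2 \<le> h\<^sup>2" using eps by (simp add: mult_left_le_one_le)
  have he: "h * e \<ge> 0" "h\<^sup>2 * e / \<epsilon>\<^sup>2 \<ge> 0" "\<epsilon> * h \<ge> 0" using h e0 eps by auto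
  have T0: "T \<ge> 0" using he by (simp add: T_def algebra_simps)
  have RT: "R \<le> K * C * (3 * M\<^sup>2 * T)"
  proof -
    have "R = K * (\<epsilon> * h) + K * C * (\<epsilon> * h + M * (h * e) + 2 * h\<^sup>2 + 2 * M * (h\<^sup>2 * e / \<epsilon>\<^sup>2) + \<epsilon> * h\<^sup>2 + h\<^sup>2 * (M * e / \<epsilon>))"
      by (simp add: R_def W0_def W1_def W2_def power2_eq_square algebra_simps)
    also have "K * (\<epsilon> * h) \<le> K * C * (\<epsilon> * h)" using K0 C_ge1 he by (intro mult_right_mono) (auto simp: mult_le_cancel_left1)
    also have "K * C * (\<epsilon> * h) + K * C * (\<epsilon> * h + M * (h * e) + 2 * h\<^sup>2 + 2 * M * (h\<^sup>2 * e / \<epsilon>\<^sup>2) + \<epsilon> * h\<^sup>2 + h\<^sup>2 * (M * e / \<epsilon>))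
       = K * C * (2 * (\<epsilon> * h) + M * (h * e) + 2 * h\<^sup>2 + 2 * M * (h\<^sup>2 * e / \<epsilon>\<^sup>2) + \<epsilon> * h\<^sup>2 + h\<^sup>2 * (M * e / \<epsilon>))"
      by (simp add: algebra_simps)
    also have "\<dots> \<le> K * C * (3 * M\<^sup>2 * T)"
    proof (rule mult_left_mono[OF _ KC])
      have a1: "1 * (\<epsilon> * h) \<le> M\<^sup>2 * (\<epsilon> * h)" using MM he by (intro mult_right_mono) auto
      have a2: "M * (h * e) \<le> M\<^sup>2 * (h * e)" using MM he by (intro mult_right_mono) auto
      have a3: "1 * h\<^sup>2 \<le> M\<^sup>2 * h\<^sup>2" using MM by (intro mult_right_mono) auto
      have a4: "M * (h\<^sup>2 * e / \<epsilon>\<^sup>2) \<le> M\<^sup>2 * (h\<^sup>2 * e / \<epsilon>\<^sup>2)" using MM he by (intro mult_right_mono) auto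
      have "3 * M\<^sup>2 * T = 3 * (M\<^sup>2 * (\<epsilon> * h)) + 3 * (M\<^sup>2 * h\<^sup>2) + 3 * (M\<^sup>2 * (h * e)) + 3 * (M\<^sup>2 * (h\<^sup>2 * e / \<epsilon>\<^sup>2))"
        by (simp add: T_def algebra_simps)
      moreover have "0 \<le> M\<^sup>2 * (\<epsilon> * h)" "0 \<le> M\<^sup>2 * (h * e)" "0 \<le> M\<^sup>2 * (h\<^sup>2 * e / \<epsilon>\<^sup>2)"
        by (rule mult_nonneg_nonneg[OF zero_le_power2 he(3)] mult_nonneg_nonneg[OF zero_le_power2 he(1)]
            mult_nonneg_nonneg[OF zero_le_power2 he(2)])+
      moreover have "2 * M * (h\<^sup>2 * e / \<epsilon>\<^sup>2) = 2 * (M * (h\<^sup>2 * e / \<epsilon>\<^sup>2))" by simp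
      ultimately show "2 * (\<epsilon> * h) + M * (h * e) + 2 * h\<^sup>2 + 2 * M * (h\<^sup>2 * e / \<epsilon>\<^sup>2) + \<epsilon> * h\<^sup>2 + h\<^sup>2 * (M * e / \<epsilon>) \<le> 3 * M\<^sup>2 * T"
        using a1 a2 a3 a4 h1 heM by linarith
    qed
    finally show ?thesis by simp
  qed
  \<comment> \<open>\<open>m\<close> is of order \<open>\<epsilon> + E x / \<epsilon>\<close>, and
    averaging \<open>s - x\<close> gives order \<open>h\<^sup>2 / \<epsilon>\<close>; the product is
    \<open>h\<^sup>2 + h\<^sup>2 * E x / \<epsilon>\<^sup>2\<close> up to constants.\<close>
  have mT: "\<bar>m\<bar> * (b x * h\<^sup>2 / (4 * \<epsilon>)) \<le> K\<^sup>2 * C * (M\<^sup>2 * T)"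
  proof -
    have "\<bar>w1 x\<bar> \<le> C * (\<epsilon> + e / \<epsilon>)" using w1_bound[OF xI] by (simp add: e_def E_def)
    moreover have "\<bar>b' x - c x\<bar> \<le> 2 * K" using b'_bound[OF xI] c_nonneg[OF xI] c_upper[OF xI] by linarith
    ultimately have "\<bar>m\<bar> \<le> 2 * K * (C * (\<epsilon> + e / \<epsilon>))" unfolding m_def abs_mult
      using K0 by (intro mult_mono) auto
    moreover have "b x * h\<^sup>2 / (4 * \<epsilon>) \<le> K * h\<^sup>2 / (4 * \<epsilon>)"
      using b_upper[OF xI] eps by (intro divide_right_mono mult_right_mono) auto
    moreover have "0 \<le> b x * h\<^sup>2 / (4 * \<epsilon>)" using b_pos[OF xI] eps by simp
    ultimately have "\<bar>m\<bar> * (b x * h\<^sup>2 / (4 * \<epsilon>)) \<le> 2 * K * (C * (\<epsilon> + e / \<epsilon>)) * (K * h\<^sup>2 / (4 * \<epsilon>))"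
      by (intro mult_mono') auto
    also have "\<dots> = K\<^sup>2 * C * ((h\<^sup>2 + h\<^sup>2 * e / \<epsilon>\<^sup>2) / 2)"
      using eps by (simp add: field_simps power2_eq_square)
    also have "\<dots> \<le> K\<^sup>2 * C * (1 * T)"
    proof (intro mult_left_mono)
      have "T = \<epsilon> * h + h\<^sup>2 + h * e + h\<^sup>2 * e / \<epsilon>\<^sup>2" by (simp add: T_def algebra_simps)
      moreover have "(q + r) / 2 \<le> 1 * (p + q + s + r)" if "0 \<le> p" "0 \<le> q" "0 \<le> r" "0 \<le> s" for p q r s :: real
        using that by simp
      ultimately show "(h\<^sup>2 + h\<^sup>2 * e / \<epsilon>\<^sup>2) / 2 \<le> 1 * T"
        using he zero_le_power2[of h] by metis
    qed (use C_ge1 in auto)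
    also have "\<dots> \<le> K\<^sup>2 * C * (M\<^sup>2 * T)"
      using K0 C_ge1 T0 MM by (intro mult_left_mono mult_right_mono) auto
    finally show ?thesis .
  qed
  have "K * C * (3 * M\<^sup>2 * T) \<le> K\<^sup>2 * C * (3 * M\<^sup>2 * T)"
    using K_ge1 C_ge1 T0 by (intro mult_right_mono) (auto simp: power2_eq_square mult_le_cancel_left1)
  then have "\<bar>m\<bar> * (b x * h\<^sup>2 / (4 * \<epsilon>)) + R \<le> K\<^sup>2 * C * (M\<^sup>2 * T) + K\<^sup>2 * C * (3 * M\<^sup>2 * T)"
    using RT mT by linarith
  also have "\<dots> = 4 * K\<^sup>2 * C * M\<^sup>2 * T" by simp
  finally show ?thesis using main unfolding T_def e_def by linarith
qed


text \<open>Although \<open>E\<close> may be far larger at \<open>x - h\<close> than at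
  \<open>x\<close>, its average is still \<open>O(E x)\<close>, because \<beta> stays below
  \<open>b x\<close>. Shifting the exponent by \<delta> to either side also absorbs factors
  \<open>\<bar>s - x\<bar> / \<epsilon>\<close>, and \<open>\<beta> + \<delta> < \<beta>1\<close>
  keeps both exponents below \<open>b x\<close> uniformly.\<close>

lemma consistency_coarse:
  assumes h: "0 < h" and x: "0 \<le> x - h" "x + h \<le> 1"
    and \<delta>: "0 < \<delta>" "\<delta> < \<beta>" "\<beta> + \<delta> < \<beta>1"
  shows "\<bar>asi_local \<epsilon> (b x) h (w (x - h)) (w x) (w (x + h)) - (\<epsilon> * g x - c x * w x)\<bar>
    \<le> K * C * (4 + 1 / \<beta> + (2 / \<delta> + 1 / \<beta>) * (2 * K / (\<beta>1 - \<beta> - \<delta>))) * (\<epsilon> * h + E x)"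
proof -
  have xI: "x \<in> {0<..<1}" using x h by auto
  have K0: "K \<ge> 0" using K_ge1 by simp
  have KC: "K * C \<ge> 0" using K0 C_ge1 by simp
  define e where "e = E x"
  have e0: "e > 0" by (simp add: e_def)
  \<comment> \<open>\<open>1 / \<delta>\<close> twice, for \<open>\<bar>y\<bar> * E s\<close> and
    \<open>\<bar>y\<bar> * E s / \<epsilon>\<close>, and \<open>1 / \<beta>\<close> for the layer
    part of the variation of \<open>w\<close>.\<close>
  define D where "D = 2 / \<delta> + 1 / \<beta>"
  have D0: "D \<ge> 0" using \<delta> \<beta>_pos by (simp add: D_def)
  define R where "R = K * C * (4 * (\<epsilon> * h) + e / \<beta>)"
  have mu: "0 < \<beta> - \<delta>" "\<beta> - \<delta> < b x" "0 < \<beta> + \<delta>" "\<beta> + \<delta> < b x"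
    using \<delta> b_lower[OF xI] by auto
  have main: "\<bar>asi_local \<epsilon> (b x) h (w (x - h)) (w x) (w (x + h)) - (\<epsilon> * g x - c x * w x)\<bar>
    \<le> R + K * C * D * e * (b x / (b x - (\<beta> - \<delta>)) + b x / (b x - (\<beta> + \<delta>)))"
  proof (rule asi_local_exp_source[OF eps(1) h mu, where ?v1.0 = w1 and ?v2.0 = w2])
    show "0 \<le> K * C * D * e" using KC D0 e0 by simp
    show "continuous_on {x - h..x + h} w" using x by (intro continuous_on_subset[OF w_cont]) auto
    fix s assume s: "s \<in> {x - h<..<x + h}"
    then have sI: "s \<in> {0<..<1}" using x by auto
    show "(w has_real_derivative w1 s) (at s)" "(w1 has_real_derivative w2 s) (at s)"
      using w_deriv[OF sI] w1_deriv[OF sI] by auto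
    define y where "y = s - x"
    define S where "S = exp (- ((\<beta> - \<delta>) * y / \<epsilon>)) + exp (- ((\<beta> + \<delta>) * y / \<epsilon>))"
    have y: "\<bar>y\<bar> \<le> h" using s by (auto simp: y_def)
    have Es: "E s = e * exp (- (\<beta> * y / \<epsilon>))"
      by (simp add: E_def e_def y_def exp_add[symmetric] right_diff_distrib diff_divide_distrib)
    \<comment> \<open>The gain \<open>exp (\<delta> * \<bar>y\<bar> / \<epsilon>)\<close> lowers the
      exponent to \<open>\<beta> - \<delta>\<close> on the right and raises it to
      \<open>\<beta> + \<delta>\<close> on the left.\<close>
    have split: "exp (- (\<beta> * y / \<epsilon>)) * exp (\<delta> * \<bar>y\<bar> / \<epsilon>) \<le> S"
    proof (cases "y \<ge> 0")
      case True
      then have "exp (- (\<beta> * y / \<epsilon>)) * exp (\<delta> * \<bar>y\<bar> / \<epsilon>) = exp (- ((\<beta> - \<delta>) * y / \<epsilon>))"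
        by (simp add: exp_add[symmetric] algebra_simps diff_divide_distrib)
      then show ?thesis by (simp add: S_def)
    next
      case False
      then have "exp (- (\<beta> * y / \<epsilon>)) * exp (\<delta> * \<bar>y\<bar> / \<epsilon>) = exp (- ((\<beta> + \<delta>) * y / \<epsilon>))"
        by (simp add: exp_add[symmetric] algebra_simps add_divide_distrib)
      then show ?thesis by (simp add: S_def)
    qed
    have "exp (- (\<beta> * y / \<epsilon>)) * 1 \<le> exp (- (\<beta> * y / \<epsilon>)) * exp (\<delta> * \<bar>y\<bar> / \<epsilon>)"
      using \<delta> eps by (intro mult_left_mono) auto
    then have "exp (- (\<beta> * y / \<epsilon>)) \<le> S" using split by (metis mult_1_right order_trans)
    then have EsS: "E s \<le> e * S" unfolding Es using e0 by (intro mult_left_mono) auto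
    \<comment> \<open>Uses \<open>t \<le> exp t\<close> at
      \<open>t = \<delta> * \<bar>y\<bar> / \<epsilon>\<close>: the polynomial factor is paid for by
      the exponent shift.\<close>
    have yEs: "\<bar>y\<bar> * E s / \<epsilon> \<le> e * S / \<delta>"
    proof -
      have "\<delta> * \<bar>y\<bar> / \<epsilon> \<le> exp (\<delta> * \<bar>y\<bar> / \<epsilon>)" using exp_ge_add_one_self[of "\<delta> * \<bar>y\<bar> / \<epsilon>"] by linarith
      then have "exp (- (\<beta> * y / \<epsilon>)) * (\<delta> * \<bar>y\<bar> / \<epsilon>) \<le> S"
        using split by (meson exp_ge_zero mult_left_mono order_trans)
      then have "e * (exp (- (\<beta> * y / \<epsilon>)) * (\<delta> * \<bar>y\<bar> / \<epsilon>)) \<le> e * S" using e0 by (intro mult_left_mono) auto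
      moreover have "e * (exp (- (\<beta> * y / \<epsilon>)) * (\<delta> * \<bar>y\<bar> / \<epsilon>)) = \<delta> * (\<bar>y\<bar> * E s / \<epsilon>)" by (simp add: Es)
      ultimately have "\<delta> * (\<bar>y\<bar> * E s / \<epsilon>) \<le> e * S" by linarith
      then show ?thesis using \<delta> by (simp add: pos_le_divide_eq mult.commute)
    qed
    have yE: "\<bar>y\<bar> * E s \<le> e * S / \<delta>"
    proof -
      have "\<bar>y\<bar> * E s \<le> \<bar>y\<bar> * (E s / \<epsilon>)" using E_le_divide[of s] by (intro mult_left_mono) auto
      then show ?thesis using yEs by simp
    qed
    have Ky: "K * \<bar>y\<bar> \<le> K * h" using y K0 by (intro mult_left_mono)
    have "\<bar>w s - w x\<bar> \<le> C * (\<epsilon> * \<bar>y\<bar> + (e + E s) / \<beta>)"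
    proof (cases "x \<le> s")
      case True
      have "\<bar>w s - w x\<bar> \<le> C * (\<epsilon> * (s - x) + E x / \<beta>)" using True sI xI by (intro w_variation) auto
      also have "\<dots> \<le> C * (\<epsilon> * \<bar>y\<bar> + (e + E s) / \<beta>)"
        using True C_ge1 \<beta>_pos eps less_imp_le[OF E_pos[of s]]
        by (intro mult_left_mono add_mono divide_right_mono) (auto simp: y_def e_def)
      finally show ?thesis .
    next
      case False
      have "\<bar>w x - w s\<bar> \<le> C * (\<epsilon> * (x - s) + E s / \<beta>)" using False sI xI by (intro w_variation) auto
      also have "\<dots> \<le> C * (\<epsilon> * \<bar>y\<bar> + (e + E s) / \<beta>)"
        using False C_ge1 \<beta>_pos eps e0
        by (intro mult_left_mono add_mono divide_right_mono) (auto simp: y_def)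
      finally show ?thesis by (simp add: abs_minus_commute)
    qed
    note wvar = this
    have "\<bar>- \<epsilon> * w2 s - b x * w1 s - (\<epsilon> * g x - c x * w x)\<bar>
      = \<bar>\<epsilon> * (g s - g x) + (c x - c s) * w s + (- c x) * (w s - w x) + (b s - b x) * w1 s + 0\<bar>"
      unfolding uniform_source[OF sI xI] by (simp add: algebra_simps)
    also have "\<dots> \<le> \<epsilon> * (K * \<bar>y\<bar>) + (K * \<bar>y\<bar>) * (C * (\<epsilon> + E s)) + K * (C * (\<epsilon> * \<bar>y\<bar> + (e + E s) / \<beta>))
        + (K * \<bar>y\<bar>) * (C * (\<epsilon> + E s / \<epsilon>)) + 0"
    proof (intro abs_add5_le; (unfold abs_mult)?; (intro mult_mono)?)
      show "\<bar>g s - g x\<bar> \<le> K * \<bar>y\<bar>" "\<bar>c x - c s\<bar> \<le> K * \<bar>y\<bar>" "\<bar>b s - b x\<bar> \<le> K * \<bar>y\<bar>"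
        using g_lip[OF sI xI] c_lip[OF sI xI] b_lip[OF sI xI] by (auto simp: y_def abs_minus_commute)
      show "\<bar>w s\<bar> \<le> C * (\<epsilon> + E s)" "\<bar>w1 s\<bar> \<le> C * (\<epsilon> + E s / \<epsilon>)"
        using w_bound[of s] w1_bound[of s] sI by (auto simp: E_def)
      show "\<bar>w s - w x\<bar> \<le> C * (\<epsilon> * \<bar>y\<bar> + (e + E s) / \<beta>)" by (rule wvar)
    qed (use eps K0 c_nonneg[OF xI] c_upper[OF xI] in auto)
    also have "\<dots> = K * (\<epsilon> * \<bar>y\<bar>) + K * C * (3 * (\<epsilon> * \<bar>y\<bar>) + \<bar>y\<bar> * E s + \<bar>y\<bar> * E s / \<epsilon> + e / \<beta> + E s / \<beta>)"
      by (simp add: algebra_simps add_divide_distrib)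
    also have "\<dots> \<le> K * C * (\<epsilon> * \<bar>y\<bar>) + K * C * (3 * (\<epsilon> * \<bar>y\<bar>) + \<bar>y\<bar> * E s + \<bar>y\<bar> * E s / \<epsilon> + e / \<beta> + E s / \<beta>)"
      using K0 C_ge1 eps by (intro add_right_mono mult_right_mono) (auto simp: mult_le_cancel_left1)
    also have "\<dots> = K * C * (4 * (\<epsilon> * \<bar>y\<bar>) + \<bar>y\<bar> * E s + \<bar>y\<bar> * E s / \<epsilon> + e / \<beta> + E s / \<beta>)"
      by (simp add: algebra_simps)
    also have "\<dots> \<le> K * C * (4 * (\<epsilon> * h) + e * S / \<delta> + e * S / \<delta> + e / \<beta> + e * S / \<beta>)"
      using KC yEs yE EsS y eps \<beta>_pos by (intro mult_left_mono add_mono divide_right_mono) auto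
    also have "\<dots> = R + K * C * D * e * S" by (simp add: R_def D_def algebra_simps)
    finally show "\<bar>- \<epsilon> * w2 s - b x * w1 s - (\<epsilon> * g x - c x * w x)\<bar>
      \<le> R + K * C * D * e * (exp (- ((\<beta> - \<delta>) * (s - x) / \<epsilon>)) + exp (- ((\<beta> + \<delta>) * (s - x) / \<epsilon>)))"
      by (simp add: S_def y_def)
  qed
  define g0 where "g0 = \<beta>1 - \<beta> - \<delta>"
  have g0: "g0 > 0" using \<delta> by (simp add: g0_def)
  have "b x / (b x - (\<beta> - \<delta>)) + b x / (b x - (\<beta> + \<delta>)) \<le> K / g0 + K / g0"
    using b_lower[OF xI] b_upper[OF xI] \<delta> g0 K0 by (intro add_mono frac_le) (auto simp: g0_def)
  then have "K * C * D * e * (b x / (b x - (\<beta> - \<delta>)) + b x / (b x - (\<beta> + \<delta>))) \<le> K * C * D * e * (2 * K / g0)"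
    using KC D0 e0 by (intro mult_left_mono) auto
  then have "R + K * C * D * e * (b x / (b x - (\<beta> - \<delta>)) + b x / (b x - (\<beta> + \<delta>)))
      \<le> K * C * (4 * (\<epsilon> * h) + (1 / \<beta> + D * (2 * K / g0)) * e)"
    by (simp add: R_def algebra_simps)
  also have "\<dots> \<le> K * C * ((4 + 1 / \<beta> + D * (2 * K / g0)) * (\<epsilon> * h) + (4 + 1 / \<beta> + D * (2 * K / g0)) * e)"
    using KC D0 g0 K0 \<beta>_pos e0 eps h by (intro mult_left_mono add_mono mult_right_mono) auto
  also have "\<dots> = K * C * (4 + 1 / \<beta> + D * (2 * K / g0)) * (\<epsilon> * h + e)"
  proof -
    have "K * C * (S * y + S * z) = K * C * S * (y + z)" for S y z by (simp add: algebra_simps)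
    then show ?thesis .
  qed
  finally show ?thesis using main unfolding D_def g0_def e_def by linarith
qed

text \<open>At the transition point the scheme is not exact for the frozen layer function; the factor
  \<open>hp + \<epsilon>\<close> matches the size of the discrete image of the barrier there.\<close>

lemma consistency_transition:
  assumes h: "0 < hm" "0 < hp" "hm \<le> M * \<epsilon>" "exp (\<beta> * hm / \<epsilon>) \<le> M"
    and x: "0 \<le> x - hm" "x + hp \<le> 1"
    and \<rho>: "\<rho> = b x * hp / (2 * \<epsilon>)"
    and A: "A = - \<epsilon> * sigma \<rho> * (((w (x + hp) - w x) / hp - (w x - w (x - hm)) / hm) / ((hm + hp) / 2))
       - b x * ((w (x + hp) - w x) / hp)"
  shows "\<bar>A - (\<epsilon> * g x - c x * w x)\<bar> * (hp + \<epsilon>) \<le> 100 * K\<^sup>2 * C * M\<^sup>2 * (1 + 1 / \<beta>) * (\<epsilon> * (hm + hp) + E x)"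
proof -
  have M1: "1 \<le> M"
  proof -
    have "1 \<le> exp (\<beta> * hm / \<epsilon>)" using \<beta>_pos h eps by simp
    then show ?thesis using h by linarith
  qed
  have xI: "x \<in> {0<..<1}" using x h by auto
  have K0: "K \<ge> 0" using K_ge1 by simp
  define e where "e = E x"
  have e0: "e > 0" by (simp add: e_def)
  have \<rho>0: "\<rho> > 0" using b_pos[OF xI] h eps by (simp add: \<rho>)
  note sg = sigma_bounds[OF \<rho>0]
  define Dp where "Dp = (w (x + hp) - w x) / hp"
  define Dm where "Dm = (w x - w (x - hm)) / hm"
  define F where "F = \<epsilon> * g x - c x * w x"
  have A': "A = - \<epsilon> * sigma \<rho> * ((Dp - Dm) / ((hm + hp) / 2)) - b x * Dp" by (simp add: A Dp_def Dm_def)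
  have MB: "M \<le> M\<^sup>2" "1 \<le> M\<^sup>2" using M1 self_le_power[of M 2] one_le_power[of M 2] by auto
  have KK: "K \<le> K\<^sup>2" "1 \<le> K\<^sup>2" using K_ge1 self_le_power[of K 2] one_le_power[of K 2] by auto
  \<comment> \<open>A common majorant of the coefficient products. The two cases below end with 24
    and 48 times \<open>Z\<close>; 100 is a round bound for both.\<close>
  define Z where "Z = K\<^sup>2 * C * M\<^sup>2 * (1 + 1 / \<beta>)"
  have "K * C \<le> Z" "K * C * M \<le> Z" "K * C / \<beta> \<le> Z"
  proof -
    have 1: "K * C * M * 1 \<le> K\<^sup>2 * C * M\<^sup>2 * (1 + 1 / \<beta>)"
      using KK MB C_ge1 M1 \<beta>_pos K0 by (intro mult_mono) auto
    then show "K * C * M \<le> Z" by (simp add: Z_def)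
    have "K * C * 1 \<le> K * C * M" using K0 C_ge1 M1 by (intro mult_left_mono) auto
    then show "K * C \<le> Z" using 1 by (simp add: Z_def)
    have "K * C * 1 * (1 / \<beta>) \<le> K\<^sup>2 * C * M\<^sup>2 * (1 + 1 / \<beta>)"
      using KK MB C_ge1 M1 \<beta>_pos K0 by (intro mult_mono) auto
    then show "K * C / \<beta> \<le> Z" by (simp add: Z_def)
  qed
  note ZZ = this
  have Z0: "Z \<ge> 0" using ZZ(1) K0 C_ge1 by (meson mult_nonneg_nonneg order_trans zero_le_one)
  have Emm: "\<forall>t\<in>{x - hm<..<x + hp}. E t \<le> M * e"
    using h unfolding e_def by (intro ballI E_le_left) auto
  have "\<bar>A - F\<bar> * (hp + \<epsilon>) \<le> 100 * Z * (\<epsilon> * (hm + hp) + e)"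
  proof (cases "hp > \<epsilon>")
    case True
    have hp1: "hp \<le> 1" using x h by auto
    have e_hp: "e \<le> e / hp" using hp1 h e0 by (simp add: pos_le_divide_eq mult_left_le)
    define X where "X = \<epsilon> + e / hp"
    have X0: "X \<ge> 0" using eps e0 h by (simp add: X_def)
    have wd: "\<bar>w (x + hp) - w x\<bar> \<le> C * (\<epsilon> * (x + hp - x) + E x / \<beta>)"
      using h x by (intro w_variation) auto
    have Dp: "\<bar>Dp\<bar> \<le> C * (\<epsilon> + e / (\<beta> * hp))"
    proof -
      have "\<bar>Dp\<bar> \<le> C * (\<epsilon> * hp + e / \<beta>) / hp" using wd h by (simp add: Dp_def e_def divide_right_mono)
      then show ?thesis using h by (simp add: add_divide_distrib distrib_left)
    qed
    have KDp: "K * \<bar>Dp\<bar> \<le> 2 * Z * X"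
    proof -
      have "K * \<bar>Dp\<bar> \<le> K * (C * (\<epsilon> + e / (\<beta> * hp)))" using Dp K0 by (intro mult_left_mono) auto
      also have "\<dots> = (K * C) * \<epsilon> + (K * C / \<beta>) * (e / hp)" by (simp add: algebra_simps)
      also have "\<dots> \<le> Z * \<epsilon> + Z * (e / hp)"
        using ZZ eps e0 h by (intro add_mono mult_right_mono) auto
      also have "\<dots> = Z * X" by (simp add: X_def distrib_left)
      also have "\<dots> \<le> 2 * Z * X" using Z0 X0 by simp
      finally show ?thesis .
    qed
    have Dm: "\<bar>Dm\<bar> \<le> C * (\<epsilon> + M * e / \<epsilon>)"
    proof -
      have "\<bar>w x - w (x - hm)\<bar> \<le> C * (\<epsilon> + M * e / \<epsilon>) * (x - (x - hm))"
      proof (rule abs_diff_le_of_deriv_bound[where f' = w1])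
        show "continuous_on {x - hm..x} w" using x xI by (intro continuous_on_subset[OF w_cont]) auto
        fix t assume t: "x - hm < t" "t < x"
        then show "(w has_real_derivative w1 t) (at t)" using x xI by (intro w_deriv) auto
        show "\<bar>w1 t\<bar> \<le> C * (\<epsilon> + M * e / \<epsilon>)"
          using w_bound_on(2)[OF x Emm, of t] t h by auto
      qed (use h in auto)
      then show ?thesis using h by (simp add: Dm_def pos_divide_le_eq)
    qed
    have D2: "\<bar>\<epsilon> * sigma \<rho> * ((Dp - Dm) / ((hm + hp) / 2))\<bar> \<le> 8 * Z * X"
    proof -
      have "\<bar>\<epsilon> * sigma \<rho> * ((Dp - Dm) / ((hm + hp) / 2))\<bar> = \<epsilon> * sigma \<rho> * (\<bar>Dp - Dm\<bar> / ((hm + hp) / 2))"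
        unfolding abs_mult abs_divide using eps sg h by simp
      also have "\<dots> \<le> \<epsilon> * 1 * ((\<bar>Dp\<bar> + \<bar>Dm\<bar>) / (hp / 2))"
        using eps sg h by (intro mult_mono frac_le abs_triangle_ineq4) auto
      also have "\<dots> = 2 * (\<epsilon> / hp) * \<bar>Dp\<bar> + 2 * (\<epsilon> / hp) * \<bar>Dm\<bar>" by (simp add: algebra_simps add_divide_distrib)
      also have "\<dots> \<le> 2 * 1 * \<bar>Dp\<bar> + 2 * (Z * X)"
      proof (intro add_mono mult_right_mono)
        show "2 * (\<epsilon> / hp) \<le> 2 * 1" using True h by (simp add: pos_divide_le_eq)
        have "(\<epsilon> / hp) * \<bar>Dm\<bar> \<le> (\<epsilon> / hp) * (C * (\<epsilon> + M * e / \<epsilon>))" using Dm eps h by (intro mult_left_mono) auto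
        also have "\<dots> = C * (\<epsilon> / hp * \<epsilon>) + C * M * (e / hp)" using eps by (simp add: algebra_simps)
        also have "\<dots> \<le> C * (1 * \<epsilon>) + C * M * (e / hp)"
          using True h eps C_ge1 by (intro add_right_mono mult_left_mono mult_right_mono) auto
        also have "\<dots> \<le> Z * \<epsilon> + Z * (e / hp)"
        proof -
          have "1 * C \<le> K * C" "1 * (C * M) \<le> K * (C * M)" using K_ge1 C_ge1 M1 by (intro mult_right_mono; simp)+
          then have "C \<le> Z" "C * M \<le> Z" using ZZ by (auto simp: mult_ac)
          then have "C * \<epsilon> \<le> Z * \<epsilon>" "C * M * (e / hp) \<le> Z * (e / hp)"
            using eps e0 h by (intro mult_right_mono; simp)+
          then show ?thesis by simp
        qed
        also have "\<dots> = Z * X" by (simp add: X_def distrib_left)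
        finally show "2 * (\<epsilon> / hp) * \<bar>Dm\<bar> \<le> 2 * (Z * X)" by simp
      qed auto
      also have "\<dots> \<le> 8 * Z * X"
      proof -
        have "1 * \<bar>Dp\<bar> \<le> K * \<bar>Dp\<bar>" using K_ge1 by (intro mult_right_mono) auto
        moreover have "0 \<le> Z * X" using Z0 X0 by simp
        ultimately show ?thesis using KDp by linarith
      qed
      finally show ?thesis .
    qed
    have F: "\<bar>F\<bar> \<le> 2 * Z * X"
    proof -
      have "\<bar>F\<bar> \<le> \<epsilon> * \<bar>g x\<bar> + c x * \<bar>w x\<bar>"
        unfolding F_def using abs_triangle_ineq4[of "\<epsilon> * g x" "c x * w x"] eps c_nonneg[OF xI] by (simp add: abs_mult)
      also have "\<dots> \<le> \<epsilon> * K + K * (C * (\<epsilon> + e))"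
        using g_bound[OF xI] c_nonneg[OF xI] c_upper[OF xI] w_bound[of x] xI eps K0
        by (intro add_mono mult_mono) (auto simp: e_def E_def)
      also have "\<dots> \<le> \<epsilon> * (K * C) + (K * C) * (\<epsilon> + e / hp)"
      proof (rule add_mono)
        show "\<epsilon> * K \<le> \<epsilon> * (K * C)" using eps K0 C_ge1 by (intro mult_left_mono) (auto simp: mult_le_cancel_left1)
        have "(K * C) * (\<epsilon> + e) \<le> (K * C) * (\<epsilon> + e / hp)" using e_hp K0 C_ge1 by (intro mult_left_mono) auto
        then show "K * (C * (\<epsilon> + e)) \<le> (K * C) * (\<epsilon> + e / hp)" by (simp add: mult_ac)
      qed
      also have "\<dots> \<le> (K * C) * X + (K * C) * X"
      proof (rule add_mono)
        have "\<epsilon> * (K * C) \<le> X * (K * C)"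
          using K0 C_ge1 e0 h by (intro mult_right_mono) (auto simp: X_def)
        then show "\<epsilon> * (K * C) \<le> (K * C) * X" by (simp add: mult.commute)
      qed (simp add: X_def)
      also have "\<dots> \<le> Z * X + Z * X" using ZZ X0 by (intro add_mono mult_right_mono)
      finally show ?thesis by (simp add: mult_ac)
    qed
    have bD: "\<bar>b x * Dp\<bar> \<le> 2 * Z * X"
    proof -
      have "\<bar>b x * Dp\<bar> \<le> K * \<bar>Dp\<bar>" unfolding abs_mult
        using b_pos[OF xI] b_upper[OF xI] by (intro mult_right_mono) auto
      then show ?thesis using KDp by linarith
    qed
    have "\<bar>A - F\<bar> \<le> 12 * Z * X"
    proof -
      have "\<bar>- p - q - F\<bar> \<le> 12 * Z * X" if "\<bar>p\<bar> \<le> 8 * Z * X" "\<bar>q\<bar> \<le> 2 * Z * X" for p q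
        using F that by linarith
      from this[OF D2 bD] show ?thesis by (simp add: A')
    qed
    then have "\<bar>A - F\<bar> * (hp + \<epsilon>) \<le> (12 * Z * X) * (2 * hp)"
      using True eps Z0 X0 by (intro mult_mono) auto
    also have "\<dots> = 24 * Z * (\<epsilon> * hp + e)" using h by (simp add: X_def algebra_simps)
    also have "\<dots> \<le> 100 * Z * (\<epsilon> * (hm + hp) + e)"
      using Z0 eps h e0 by (intro mult_mono) auto
    finally show ?thesis .
  next
    case False
    then have hpe: "hp \<le> \<epsilon>" by simp
    define W2 where "W2 = C * (1 + M * e / \<epsilon>\<^sup>2)"
    \<comment> \<open>Now both steps are \<open>O(\<epsilon>)\<close>, and second-order expansion at
      \<open>x\<close> is affordable. \<omega> bounds the oscillation of \<open>w2\<close> over the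
      two cells.\<close>
    define \<omega> where "\<omega> = 5 * K * W2 * (hm + hp) / \<epsilon>"
    have W20: "W2 \<ge> 0" using C_ge1 M1 e0 by (simp add: W2_def)
    have \<omega>0: "\<omega> \<ge> 0" using W20 K0 h eps by (simp add: \<omega>_def)
    have xlu: "x \<in> {x - hm<..<x + hp}" using h by auto
    have w2d: "\<bar>w2 s - w2 x\<bar> \<le> \<omega>" if s: "s \<in> {x - hm<..<x + hp}" for s
    proof -
      have "\<epsilon> * \<bar>w2 s - w2 x\<bar> \<le> 5 * K * W2 * \<bar>s - x\<bar>"
        using w2_diff[OF x Emm s xlu] by (simp add: W2_def mult_ac)
      also have "\<dots> \<le> 5 * K * W2 * (hm + hp)" using s W20 K0 h by (intro mult_left_mono) auto
      finally show ?thesis using eps by (simp add: \<omega>_def pos_le_divide_eq mult.commute)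
    qed
    have dQ: "\<bar>w1 s - w1 x - w2 x * (s - x)\<bar> \<le> \<omega> * \<bar>s - x\<bar>" if s: "s \<in> {x - hm<..<x + hp}" for s
    proof -
      have I: "t \<in> {0<..<1}" if "t \<in> {x - hm<..<x + hp}" for t using that x by auto
      have "\<bar>(w1 s - w2 x * s) - (w1 x - w2 x * x)\<bar> \<le> \<omega> * \<bar>s - x\<bar>"
        by (rule abs_diff_le_on[where f' = "\<lambda>t. w2 t - w2 x", OF _ w2d s xlu])
          (auto intro!: derivative_eq_intros w1_deriv I)
      then show ?thesis by (simp add: algebra_simps)
    qed
    have Q: "\<bar>(w s - w1 x * s - w2 x * (s - x)\<^sup>2 / 2) - (w r - w1 x * r - w2 x * (r - x)\<^sup>2 / 2)\<bar> \<le> \<omega> * k * (s - r)"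
      if "r \<le> s" "x - hm \<le> r" "s \<le> x + hp" "\<And>t. r < t \<Longrightarrow> t < s \<Longrightarrow> \<bar>t - x\<bar> \<le> k" for r s k
    proof (rule abs_diff_le_of_deriv_bound[where f' = "\<lambda>t. w1 t - w1 x - w2 x * (t - x)", OF that(1)])
      show "continuous_on {r..s} (\<lambda>s. w s - w1 x * s - w2 x * (s - x)\<^sup>2 / 2)"
        using x that by (intro continuous_intros continuous_on_subset[OF w_cont]) auto
      fix t assume t: "r < t" "t < s"
      show "((\<lambda>s. w s - w1 x * s - w2 x * (s - x)\<^sup>2 / 2) has_real_derivative w1 t - w1 x - w2 x * (t - x)) (at t)"
        using t that x by (auto intro!: derivative_eq_intros w_deriv)
      have "\<bar>w1 t - w1 x - w2 x * (t - x)\<bar> \<le> \<omega> * \<bar>t - x\<bar>" using t that by (intro dQ) auto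
      also have "\<dots> \<le> \<omega> * k" using that(4)[OF t] \<omega>0 by (intro mult_left_mono)
      finally show "\<bar>w1 t - w1 x - w2 x * (t - x)\<bar> \<le> \<omega> * k" .
    qed
    have Dp: "\<bar>Dp - w1 x - w2 x * hp / 2\<bar> \<le> \<omega> * hp"
    proof -
      have "\<bar>w (x + hp) - w x - w1 x * hp - w2 x * hp\<^sup>2 / 2\<bar> \<le> \<omega> * hp * hp"
        using Q[of x "x + hp" hp] h by (simp add: algebra_simps)
      moreover have "Dp - w1 x - w2 x * hp / 2 = (w (x + hp) - w x - w1 x * hp - w2 x * hp\<^sup>2 / 2) / hp"
        using h by (simp add: Dp_def field_simps power2_eq_square)
      ultimately show ?thesis using h by (simp add: pos_divide_le_eq)
    qed
    have Dm: "\<bar>Dm - w1 x + w2 x * hm / 2\<bar> \<le> \<omega> * hm"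
    proof -
      have "\<bar>w x - w (x - hm) - w1 x * hm + w2 x * hm\<^sup>2 / 2\<bar> \<le> \<omega> * hm * hm"
        using Q[of "x - hm" x hm] h by (simp add: algebra_simps)
      moreover have "Dm - w1 x + w2 x * hm / 2 = (w x - w (x - hm) - w1 x * hm + w2 x * hm\<^sup>2 / 2) / hm"
        using h by (simp add: Dm_def field_simps power2_eq_square)
      ultimately show ?thesis using h by (simp add: pos_divide_le_eq)
    qed
    have w2x: "\<bar>w2 x\<bar> \<le> W2" using w_bound_on(3)[OF x Emm xlu] by (simp add: W2_def)
    have D2: "\<bar>(Dp - Dm) / ((hm + hp) / 2) - w2 x\<bar> \<le> 2 * \<omega>"
    proof -
      have "(Dp - Dm) / ((hm + hp) / 2) - w2 x
        = ((Dp - w1 x - w2 x * hp / 2) - (Dm - w1 x + w2 x * hm / 2)) / ((hm + hp) / 2)"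
        using h by (simp add: field_simps)
      also have "\<bar>\<dots>\<bar> \<le> (\<omega> * hp + \<omega> * hm) / ((hm + hp) / 2)"
        using Dp Dm h unfolding abs_divide by (intro frac_le) auto
      also have "\<dots> = 2 * \<omega>" using h by (simp add: field_simps)
      finally show ?thesis .
    qed
    have Dp1: "\<bar>Dp - w1 x\<bar> \<le> W2 * hp"
    proof -
      have "\<bar>(w (x + hp) - w1 x * (x + hp)) - (w x - w1 x * x)\<bar> \<le> W2 * hp * (x + hp - x)"
      proof (rule abs_diff_le_of_deriv_bound[where f' = "\<lambda>t. w1 t - w1 x"])
        show "continuous_on {x..x + hp} (\<lambda>s. w s - w1 x * s)"
          using x xI h by (intro continuous_intros continuous_on_subset[OF w_cont]) auto
        fix t assume t: "x < t" "t < x + hp"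
        show "((\<lambda>s. w s - w1 x * s) has_real_derivative w1 t - w1 x) (at t)"
          using t x xI by (auto intro!: derivative_eq_intros w_deriv)
        have "\<bar>w1 t - w1 x\<bar> \<le> W2 * \<bar>t - x\<bar>" using w_diff(2)[OF x Emm _ xlu, of t] t h by (auto simp: W2_def)
        also have "\<dots> \<le> W2 * hp" using t W20 by (intro mult_left_mono) auto
        finally show "\<bar>w1 t - w1 x\<bar> \<le> W2 * hp" .
      qed (use h in auto)
      then have "\<bar>w (x + hp) - w x - w1 x * hp\<bar> \<le> W2 * hp * hp" by (simp add: algebra_simps)
      moreover have "Dp - w1 x = (w (x + hp) - w x - w1 x * hp) / hp" using h by (simp add: Dp_def field_simps)
      ultimately show ?thesis using h by (simp add: pos_divide_le_eq)
    qed
    \<comment> \<open>The equation at \<open>x\<close> splits the error into the fitting defect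
      \<open>1 - sigma \<rho>\<close>, the error of the second difference and that of the forward
      difference. The zeros only fit the five-term inequality.\<close>
    have "A - F = \<epsilon> * (1 - sigma \<rho>) * w2 x + (- (\<epsilon> * sigma \<rho>)) * ((Dp - Dm) / ((hm + hp) / 2) - w2 x)
       + (- b x) * (Dp - w1 x) + 0 + 0"
      using w_eq[OF xI] unfolding A' F_def by (simp add: algebra_simps)
    also have "\<bar>\<dots>\<bar> \<le> (K * hp) * W2 + \<epsilon> * (2 * \<omega>) + K * (W2 * hp) + 0 + 0"
    proof (intro abs_add5_le; (unfold abs_mult[of "\<epsilon> * (1 - sigma \<rho>)"] abs_mult[of "- (\<epsilon> * sigma \<rho>)"] abs_mult[of "- b x"])?; (intro mult_mono)?)
      have "\<epsilon> * (1 - sigma \<rho>) \<le> \<epsilon> * (2 * \<rho>)" using eps sg by (intro mult_left_mono) auto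
      also have "\<dots> = b x * hp" using eps by (simp add: \<rho>)
      also have "\<dots> \<le> K * hp" using b_upper[OF xI] h by (intro mult_right_mono) auto
      finally show "\<bar>\<epsilon> * (1 - sigma \<rho>)\<bar> \<le> K * hp" using eps sg by (simp add: abs_mult)
      show "\<bar>- (\<epsilon> * sigma \<rho>)\<bar> \<le> \<epsilon>" using eps sg by (simp add: abs_mult mult_left_le)
    qed (use w2x D2 Dp1 b_pos[OF xI] b_upper[OF xI] K0 h eps W20 \<omega>0 in auto)
    also have "\<dots> = 2 * K * W2 * hp + 10 * K * W2 * (hm + hp)" using eps by (simp add: \<omega>_def)
    also have "\<dots> \<le> 2 * K * W2 * (hm + hp) + 10 * K * W2 * (hm + hp)"
      using K0 W20 h by (intro add_right_mono mult_left_mono) auto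
    finally have AF: "\<bar>A - F\<bar> \<le> 12 * K * W2 * (hm + hp)" by simp
    have W2h: "K * W2 * (hm + hp) * \<epsilon> \<le> 2 * Z * (\<epsilon> * (hm + hp) + e)"
    proof -
      have hs: "hm + hp \<le> 2 * M * \<epsilon>"
      proof -
        have "1 * \<epsilon> \<le> M * \<epsilon>" using M1 eps by (intro mult_right_mono) auto
        then show ?thesis using h hpe by linarith
      qed
      have "K * W2 * (hm + hp) * \<epsilon> = (K * C) * (\<epsilon> * (hm + hp)) + K * C * M * (e * ((hm + hp) / \<epsilon>))"
        using eps by (simp add: W2_def field_simps power2_eq_square)
      also have "\<dots> \<le> Z * (\<epsilon> * (hm + hp)) + K * C * M * (e * (2 * M))"
        using ZZ eps h hs e0 K0 C_ge1 M1
        by (intro add_mono mult_right_mono mult_left_mono) (auto simp: pos_divide_le_eq mult.commute)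
      also have "K * C * M * (e * (2 * M)) = 2 * (K * C * M\<^sup>2 * 1) * e" by (simp add: power2_eq_square)
      also have "Z * (\<epsilon> * (hm + hp)) + \<dots> \<le> Z * (\<epsilon> * (hm + hp)) + 2 * Z * e"
      proof -
        have "K * C * M\<^sup>2 * 1 \<le> K\<^sup>2 * C * M\<^sup>2 * (1 + 1 / \<beta>)"
          using KK C_ge1 K0 \<beta>_pos by (intro mult_mono) auto
        then have "2 * (K * C * M\<^sup>2 * 1) * e \<le> 2 * Z * e"
          unfolding Z_def using e0 by (intro mult_right_mono mult_left_mono) auto
        then show ?thesis by simp
      qed
      also have "\<dots> \<le> 2 * Z * (\<epsilon> * (hm + hp)) + 2 * Z * e" using Z0 eps h by simp
      finally show ?thesis by (simp add: distrib_left)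
    qed
    have "\<bar>A - F\<bar> * (hp + \<epsilon>) \<le> (12 * K * W2 * (hm + hp)) * (2 * \<epsilon>)"
      using AF hpe eps h K0 W20 by (intro mult_mono) auto
    also have "\<dots> = 24 * (K * W2 * (hm + hp) * \<epsilon>)" by simp
    also have "\<dots> \<le> 24 * (2 * Z * (\<epsilon> * (hm + hp) + e))" by (intro mult_left_mono W2h) simp
    also have "\<dots> = 48 * Z * (\<epsilon> * (hm + hp) + e)" by simp
    also have "\<dots> \<le> 100 * Z * (\<epsilon> * (hm + hp) + e)"
      using Z0 eps h e0 by (intro mult_right_mono) auto
    finally show ?thesis .
  qed
  then show ?thesis by (simp add: F_def Z_def e_def mult.assoc)
qed

end

section \<open>Discrete stability\<close>

text \<open>The M-matrix sign pattern: positive weights on the differences to both neighbours,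
  independent of \<open>U\<close>, plus the zeroth-order term. Linearity and the discrete minimum
  principle are both read off from it.\<close>

lemma asi_op_coeffs:
  assumes "\<epsilon> > 0" "b (x i) > 0" "x (i - 1) < x i" "x i < x (Suc i)"
  obtains \<alpha> \<gamma> where "\<alpha> > 0" "\<gamma> > 0"
    "\<And>U. asi_op \<epsilon> b c x U i = \<alpha> * (U i - U (Suc i)) + \<gamma> * (U i - U (i - 1)) + c (x i) * U i"
proof -
  define p m where "p = x (Suc i) - x i" and "m = x i - x (i - 1)"
  define s where "s = \<epsilon> * sigma (b (x i) * p / (2 * \<epsilon>)) / ((m + p) / 2)"
  have pm: "p > 0" "m > 0" using assms by (auto simp: p_def m_def)
  then have s: "s > 0" using assms sigma_bounds(1)[of "b (x i) * p / (2 * \<epsilon>)"] by (simp add: s_def)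
  show thesis
  proof (rule that[of "(s + b (x i)) / p" "s / m"])
    show "0 < (s + b (x i)) / p" "0 < s / m" using s pm assms by auto
    fix U
    have "asi_op \<epsilon> b c x U i = - s * ((U (Suc i) - U i) / p - (U i - U (i - 1)) / m)
        - b (x i) * ((U (Suc i) - U i) / p) + c (x i) * U i"
      unfolding asi_op_def Let_def p_def[symmetric] m_def[symmetric] s_def
      by (simp only: mult_minus_left times_divide_eq_left times_divide_eq_right)
    also have "\<dots> = (s + b (x i)) / p * (U i - U (Suc i)) + s / m * (U i - U (i - 1)) + c (x i) * U i"
      using pm by (simp add: field_simps)
    finally show "asi_op \<epsilon> b c x U i = (s + b (x i)) / p * (U i - U (Suc i)) + s / m * (U i - U (i - 1)) + c (x i) * U i" .
  qed
qed

lemma asi_op_linear: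
  assumes "\<epsilon> > 0" "b (x i) > 0" "x (i - 1) < x i" "x i < x (Suc i)"
  shows "asi_op \<epsilon> b c x (\<lambda>i. U i + V i) i = asi_op \<epsilon> b c x U i + asi_op \<epsilon> b c x V i"
    and "asi_op \<epsilon> b c x (\<lambda>i. U i - V i) i = asi_op \<epsilon> b c x U i - asi_op \<epsilon> b c x V i"
    and "asi_op \<epsilon> b c x (\<lambda>i. r * U i) i = r * asi_op \<epsilon> b c x U i"
  by (rule asi_op_coeffs[where b = b and x = x and i = i, OF assms, of c], simp only:, simp add: algebra_simps)+

text \<open>Taking the first index at which the negative minimum is attained makes the difference to
  the left neighbour strictly negative. That gives the contradiction even if \<open>c\<close>
  vanishes, without a perturbation.\<close>

lemma asi_op_minimum_principle:
  assumes e: "\<epsilon> > 0" and b: "\<And>i. 0 < i \<Longrightarrow> i < N \<Longrightarrow> b (x i) > 0" and c: "\<And>i. 0 < i \<Longrightarrow> i < N \<Longrightarrow> c (x i) \<ge> 0"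
    and x: "\<And>i. i < N \<Longrightarrow> x i < x (Suc i)"
    and L: "\<And>i. 0 < i \<Longrightarrow> i < N \<Longrightarrow> 0 \<le> asi_op \<epsilon> b c x U i"
    and bc: "U 0 \<ge> 0" "U N \<ge> 0" and i: "i \<le> N"
  shows "U i \<ge> 0"
proof (rule ccontr)
  assume neg: "\<not> U i \<ge> 0"
  define \<mu> where "\<mu> = Min (U ` {..N})"
  have min: "\<mu> \<le> U j" if "j \<le> N" for j using that by (simp add: \<mu>_def)
  have mu0: "\<mu> < 0" using min[OF i] neg by simp
  have "\<mu> \<in> U ` {..N}" unfolding \<mu>_def by (intro Min_in) auto
  then have ex: "\<exists>j. j \<le> N \<and> U j = \<mu>" by auto
  define k where "k = (LEAST j. j \<le> N \<and> U j = \<mu>)"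
  have k: "k \<le> N" "U k = \<mu>" using LeastI_ex[OF ex] by (auto simp: k_def)
  have k0: "0 < k" "k < N" using k bc mu0 by (auto intro: Suc_leI gr0I le_neq_implies_less)
  have "\<not> (k - 1 \<le> N \<and> U (k - 1) = \<mu>)" using not_less_Least[of "k - 1" "\<lambda>j. j \<le> N \<and> U j = \<mu>"] k0 by (simp add: k_def)
  then have prev: "U k < U (k - 1)" using min[of "k - 1"] k by force
  have succ: "U k \<le> U (Suc k)" using min[of "Suc k"] k k0 by simp
  have "x (k - 1) < x k" using x[of "k - 1"] k0 by simp
  then obtain \<alpha> \<gamma> where ag: "\<alpha> > 0" "\<gamma> > 0"
    and eq: "asi_op \<epsilon> b c x U k = \<alpha> * (U k - U (Suc k)) + \<gamma> * (U k - U (k - 1)) + c (x k) * U k"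
    using asi_op_coeffs[where b = b and x = x and i = k and c = c and \<epsilon> = \<epsilon> and thesis = thesis, OF e b[OF k0] _ x[OF k0(2)]] by blast
  have "\<alpha> * (U k - U (Suc k)) \<le> 0" "\<gamma> * (U k - U (k - 1)) < 0" "c (x k) * U k \<le> 0"
    using ag prev succ c[OF k0] k mu0 by (auto simp: mult_pos_neg mult_nonneg_nonpos)
  then show False using L[OF k0] eq by linarith
qed

lemma asi_op_comparison:
  assumes e: "\<epsilon> > 0" and b: "\<And>i. 0 < i \<Longrightarrow> i < N \<Longrightarrow> b (x i) > 0" and c: "\<And>i. 0 < i \<Longrightarrow> i < N \<Longrightarrow> c (x i) \<ge> 0"
    and x: "\<And>i. i < N \<Longrightarrow> x i < x (Suc i)"
    and L: "\<And>i. 0 < i \<Longrightarrow> i < N \<Longrightarrow> \<bar>asi_op \<epsilon> b c x U i\<bar> \<le> asi_op \<epsilon> b c x Y i"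
    and bc: "\<bar>U 0\<bar> \<le> Y 0" "\<bar>U N\<bar> \<le> Y N" and i: "i \<le> N"
  shows "\<bar>U i\<bar> \<le> Y i"
proof -
  have lin: "asi_op \<epsilon> b c x (\<lambda>i. Y i + U i) i = asi_op \<epsilon> b c x Y i + asi_op \<epsilon> b c x U i"
    "asi_op \<epsilon> b c x (\<lambda>i. Y i - U i) i = asi_op \<epsilon> b c x Y i - asi_op \<epsilon> b c x U i"
    if "0 < i" "i < N" for i
    using asi_op_linear(1,2)[of \<epsilon> b x i c Y U] e b[OF that] x[of i] x[of "i - 1"] that by auto
  have "0 \<le> Y i - U i"
  proof (rule asi_op_minimum_principle[where b = b and c = c and x = x and \<epsilon> = \<epsilon> and i = i
        and U = "\<lambda>i. Y i - U i" and N = N, OF e b c x _ _ _ i])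
    show "0 \<le> asi_op \<epsilon> b c x (\<lambda>i. Y i - U i) j" if "0 < j" "j < N" for j
      using L[OF that] lin(2)[OF that] by linarith
    show "0 \<le> Y 0 - U 0" "0 \<le> Y N - U N" using bc by linarith+
  qed
  moreover have "0 \<le> Y i + U i"
  proof (rule asi_op_minimum_principle[where b = b and c = c and x = x and \<epsilon> = \<epsilon> and i = i
        and U = "\<lambda>i. Y i + U i" and N = N, OF e b c x _ _ _ i])
    show "0 \<le> asi_op \<epsilon> b c x (\<lambda>i. Y i + U i) j" if "0 < j" "j < N" for j
      using L[OF that] lin(1)[OF that] by linarith
    show "0 \<le> Y 0 + U 0" "0 \<le> Y N + U N" using bc by linarith+
  qed
  ultimately show ?thesis by linarith
qed

text \<open>The second difference of a linear function vanishes even where the step changes, so the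
  fitting factor drops out. This barrier pays for errors that do not decay with the layer.\<close>

lemma asi_op_linear_barrier:
  assumes "x (i - 1) < x i" "x i < x (Suc i)"
  shows "asi_op \<epsilon> b c x (\<lambda>i. 1 - x i) i = b (x i) + c (x i) * (1 - x i)"
proof -
  have "((1 - x (Suc i)) - (1 - x i)) / (x (Suc i) - x i) = - 1"
    "((1 - x i) - (1 - x (i - 1))) / (x i - x (i - 1)) = - 1"
    using assms by (auto simp: field_simps)
  then show ?thesis unfolding asi_op_def Let_def by simp
qed

text \<open>A discrete counterpart of \<open>exp (- \<kappa> (x - x m))\<close>, constant up to the mesh point \<open>x m\<close>.  For
  \<open>m = J\<close> it absorbs the inconsistency of the scheme at the transition point.\<close>

definition barrier :: "real \<Rightarrow> (nat \<Rightarrow> real) \<Rightarrow> nat \<Rightarrow> nat \<Rightarrow> real" where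
  "barrier \<kappa> x m i = (\<Prod>j\<in>{m<..i}. 1 / (1 + \<kappa> * (x j - x (j - 1))))"

lemma barrier_le: "i \<le> m \<Longrightarrow> barrier \<kappa> x m i = 1"
  by (simp add: barrier_def)

lemma barrier_Suc:
  assumes "m \<le> i"
  shows "barrier \<kappa> x m (Suc i) = barrier \<kappa> x m i / (1 + \<kappa> * (x (Suc i) - x i))"
proof -
  have "{m<..Suc i} = insert (Suc i) {m<..i}" using assms by auto
  then show ?thesis by (simp add: barrier_def)
qed

lemma barrier_bounds:
  assumes "\<kappa> \<ge> 0" and x: "\<And>i. i < N \<Longrightarrow> x i < x (Suc i)" and i: "i \<le> N"
  shows "0 < barrier \<kappa> x m i" "barrier \<kappa> x m i \<le> 1"
proof -
  have "1 + \<kappa> * (x j - x (j - 1)) \<ge> 1" if "j \<in> {m<..i}" for j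
  proof -
    have "x (j - 1) < x j" using x[of "j - 1"] that i by fastforce
    then have "0 \<le> \<kappa> * (x j - x (j - 1))" using assms(1) by (intro mult_nonneg_nonneg) auto
    then show ?thesis by simp
  qed
  then have f: "0 < 1 / (1 + \<kappa> * (x j - x (j - 1)))" "1 / (1 + \<kappa> * (x j - x (j - 1))) \<le> 1"
    if "j \<in> {m<..i}" for j using that by (force simp: divide_simps)+
  then show "0 < barrier \<kappa> x m i" unfolding barrier_def by (intro prod_pos) auto
  show "barrier \<kappa> x m i \<le> 1" unfolding barrier_def
    using f by (intro prod_le_1) (auto simp: less_imp_le)
qed

text \<open>Each factor satisfies \<open>1 + t \<le> exp t\<close>. This is how the discrete barrier
  comes to dominate the continuous layer function.\<close>

lemma barrier_ge_exp:
  assumes "\<kappa> \<ge> 0" and x: "\<And>i. i < N \<Longrightarrow> x i < x (Suc i)" and i: "i \<le> N"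
  shows "exp (- \<kappa> * (x i - x 0)) \<le> barrier \<kappa> x 0 i"
  using i
proof (induction i)
  case 0
  then show ?case by (simp add: barrier_le)
next
  case (Suc i)
  define d where "d = x (Suc i) - x i"
  have d: "\<kappa> * d \<ge> 0" using x[of i] Suc.prems assms(1) by (simp add: d_def)
  have "exp (- \<kappa> * (x (Suc i) - x 0)) = exp (- \<kappa> * (x i - x 0)) * exp (- (\<kappa> * d))"
    by (simp add: d_def exp_add[symmetric] algebra_simps)
  also have "\<dots> \<le> barrier \<kappa> x 0 i * (1 / (1 + \<kappa> * d))"
  proof (intro mult_mono)
    show "exp (- \<kappa> * (x i - x 0)) \<le> barrier \<kappa> x 0 i" using Suc by simp
    have "1 + \<kappa> * d \<le> exp (\<kappa> * d)" by (rule exp_ge_add_one_self)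
    then show "exp (- (\<kappa> * d)) \<le> 1 / (1 + \<kappa> * d)" using d by (simp add: exp_minus field_simps)
    show "0 \<le> barrier \<kappa> x 0 i" using barrier_bounds(1)[where x = x and N = N, OF assms(1) x, of i 0] Suc.prems by simp
  qed simp
  also have "\<dots> = barrier \<kappa> x 0 (Suc i)" by (simp add: barrier_Suc d_def)
  finally show ?case .
qed

text \<open>With \<open>z\<close> the value at \<open>Suc i\<close>, the forward difference is
  \<open>- \<kappa> * z\<close> and the second difference is at most
  \<open>2 * \<kappa>\<^sup>2 * z\<close> on any mesh. For
  \<open>\<kappa> = \<beta> / (2 * \<epsilon>)\<close> diffusion thus takes at most
  \<open>\<beta> * \<kappa> * z\<close> from the \<open>\<beta>1 * \<kappa> * z\<close> supplied by
  convection. Left of \<open>m\<close> the barrier is constant and contributes only its zeroth-order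
  term.\<close>

lemma asi_op_barrier:
  assumes e: "\<epsilon> > 0" and \<beta>: "0 < \<beta>" "\<beta> < \<beta>1" "\<beta>1 \<le> b (x i)" and c: "c (x i) \<ge> 0"
    and x: "\<And>i. i < N \<Longrightarrow> x i < x (Suc i)" and i: "0 < i" "i < N"
    and \<kappa>: "\<kappa> = \<beta> / (2 * \<epsilon>)"
  shows "(if m \<le> i then \<kappa> * (\<beta>1 - \<beta>) * barrier \<kappa> x m (Suc i) else 0) \<le> asi_op \<epsilon> b c x (barrier \<kappa> x m) i"
proof -
  define Z where "Z = barrier \<kappa> x m"
  define p q where "p = x (Suc i) - x i" and "q = x i - x (i - 1)"
  have pq: "p > 0" "q > 0" using x[of i] x[of "i - 1"] i by (auto simp: p_def q_def)
  have \<kappa>0: "\<kappa> > 0" using e \<beta> by (simp add: \<kappa>)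
  have Zpos: "0 < Z j" if "j \<le> N" for j using barrier_bounds(1)[where x = x and N = N, OF less_imp_le[OF \<kappa>0] x that] by (simp add: Z_def)
  define s where "s = sigma (b (x i) * p / (2 * \<epsilon>))"
  have s: "0 < s" "s \<le> 1" using sigma_bounds(1,2)[of "b (x i) * p / (2 * \<epsilon>)"] pq e \<beta> by (auto simp: s_def)
  have L: "asi_op \<epsilon> b c x Z i = - \<epsilon> * s * (((Z (Suc i) - Z i) / p - (Z i - Z (i - 1)) / q) / ((q + p) / 2))
     - b (x i) * ((Z (Suc i) - Z i) / p) + c (x i) * Z i"
    by (simp add: asi_op_def Let_def p_def q_def s_def)
  have cZ: "0 \<le> c (x i) * Z i" using c Zpos[of i] i by simp
  show ?thesis
  proof (cases "m \<le> i")
    case False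
    then have "Z (Suc i) = 1" "Z i = 1" "Z (i - 1) = 1" by (auto simp: Z_def barrier_le)
    then show ?thesis using False c L by (simp add: Z_def)
  next
    case True
    define z where "z = Z (Suc i)"
    have z: "z > 0" using Zpos[of "Suc i"] i by (simp add: z_def)
    have den: "1 + \<kappa> * p > 0" "1 + \<kappa> * q > 0" using \<kappa>0 pq by (auto simp: add_pos_pos)
    have Zi: "Z i = z * (1 + \<kappa> * p)" using barrier_Suc[OF True, of \<kappa> x] den by (simp add: Z_def z_def p_def)
    have D1: "(Z (Suc i) - Z i) / p = - (\<kappa> * z)" using pq by (simp add: Zi z_def[symmetric] field_simps)
    have b1: "b (x i) * (\<kappa> * z) \<ge> \<beta>1 * (\<kappa> * z)" using \<beta> \<kappa>0 z by (intro mult_right_mono) auto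
    have D2: "\<epsilon> * s * (((Z (Suc i) - Z i) / p - (Z i - Z (i - 1)) / q) / ((q + p) / 2)) \<le> \<beta> * (\<kappa> * z)"
    proof (cases "i = m")
      \<comment> \<open>At the kink \<open>i = m\<close> the barrier is concave, so the second
        difference has the favourable sign.\<close>
      case True
      then have "Z i = 1" "Z (i - 1) = 1" by (auto simp: Z_def barrier_le)
      then have "((Z (Suc i) - Z i) / p - (Z i - Z (i - 1)) / q) / ((q + p) / 2) \<le> 0"
        unfolding D1 using pq \<kappa>0 z by (simp add: divide_le_0_iff mult_nonneg_nonneg)
      then have "\<epsilon> * s * (((Z (Suc i) - Z i) / p - (Z i - Z (i - 1)) / q) / ((q + p) / 2)) \<le> 0"
        using e s by (intro mult_nonneg_nonpos) auto
      also have "0 \<le> \<beta> * (\<kappa> * z)" using \<beta> \<kappa>0 z by simp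
      finally show ?thesis .
    next
      case False
      then have "Z (Suc (i - 1)) = Z (i - 1) / (1 + \<kappa> * (x (Suc (i - 1)) - x (i - 1)))"
        unfolding Z_def using \<open>m \<le> i\<close> by (intro barrier_Suc) auto
      then have "Z (i - 1) = Z i * (1 + \<kappa> * q)" using den i by (simp add: q_def)
      then have D0: "(Z i - Z (i - 1)) / q = - (\<kappa> * Z i)" using pq by (simp add: field_simps)
      have "((Z (Suc i) - Z i) / p - (Z i - Z (i - 1)) / q) / ((q + p) / 2) = \<kappa>\<^sup>2 * z * (p / ((q + p) / 2))"
        unfolding D1 D0 by (simp add: Zi algebra_simps power2_eq_square add_divide_distrib)
      also have "\<dots> \<le> \<kappa>\<^sup>2 * z * 2"
        using pq z by (intro mult_left_mono) (auto simp: pos_divide_le_eq)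
      finally have "\<epsilon> * s * (((Z (Suc i) - Z i) / p - (Z i - Z (i - 1)) / q) / ((q + p) / 2)) \<le> \<epsilon> * s * (\<kappa>\<^sup>2 * z * 2)"
        using e s by (intro mult_left_mono) auto
      also have "\<dots> \<le> \<epsilon> * 1 * (\<kappa>\<^sup>2 * z * 2)" using e s z by (intro mult_right_mono mult_left_mono) auto
      also have "\<dots> = \<beta> * (\<kappa> * z)" using e by (simp add: \<kappa> power2_eq_square)
      finally show ?thesis .
    qed
    have "\<kappa> * (\<beta>1 - \<beta>) * z = \<beta>1 * (\<kappa> * z) - \<beta> * (\<kappa> * z)" by (simp add: algebra_simps)
    also have "\<dots> \<le> asi_op \<epsilon> b c x Z i"
    proof -
      have "asi_op \<epsilon> b c x Z i = b (x i) * (\<kappa> * z) + c (x i) * Z i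
        - \<epsilon> * s * (((Z (Suc i) - Z i) / p - (Z i - Z (i - 1)) / q) / ((q + p) / 2))"
        unfolding L D1 by simp
      then show ?thesis using b1 D2 cZ by linarith
    qed
    finally show ?thesis using True by (simp add: Z_def z_def)
  qed
qed

context layer_solution begin

text \<open>The comparison function has one summand per kind of error: \<open>A1\<close> for terms
  bounded by \<open>\<Theta>\<close> (including the whole coarse part, where \<open>E\<close> is at
  most \<open>E (x J)\<close>), \<open>A2\<close> for the decaying layer errors of the fine part,
  \<open>A3\<close> for the transition point alone.\<close>

lemma discrete_error:
  assumes N: "0 < J" "J < N" and x0: "x 0 = 0" and xN: "x N = 1"
    and fine: "\<And>i. i < J \<Longrightarrow> x (Suc i) - x i = h"
    and coarse: "\<And>i. J \<le> i \<Longrightarrow> i < N \<Longrightarrow> x (Suc i) - x i = H"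
    and h: "0 < h" "h \<le> M * \<epsilon>" "exp (\<beta> * h / \<epsilon>) \<le> M" "h \<le> d" and H: "0 < H" "H \<le> d"
    and W: "W 0 = w 0" "W N = 0" "\<And>i. 0 < i \<Longrightarrow> i < N \<Longrightarrow> asi_op \<epsilon> b c x W i = \<epsilon> * g (x i)"
    and \<delta>: "0 < \<delta>" "\<delta> < \<beta>" "\<beta> + \<delta> < \<beta>1"
    and P1: "P1 = 4 * K\<^sup>2 * C * M\<^sup>2"
    and P2: "P2 = K * C * (4 + 1 / \<beta> + (2 / \<delta> + 1 / \<beta>) * (2 * K / (\<beta>1 - \<beta> - \<delta>)))"
    and P3: "P3 = 100 * K\<^sup>2 * C * M\<^sup>2 * (1 + 1 / \<beta>)"
    and i: "i \<le> N"
  shows "\<bar>w (x i) - W i\<bar> \<le> ((P1 * (1 + M) + P2) / \<beta> + 2 * P1 * M / (\<beta> * (\<beta>1 - \<beta>)) + 2 * P3 * (2 + \<beta>) / (\<beta> * (\<beta>1 - \<beta>)))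
     * (\<epsilon> * d + E (x J) + h\<^sup>2 / \<epsilon>)"
proof -
  have step: "x i < x (Suc i)" if "i < N" for i
    using fine[of i] coarse[of i] that h H by (cases "i < J") auto
  have xmono: "x i \<le> x j" if "i \<le> j" "j \<le> N" for i j
    using that
  proof (induction j)
    case (Suc j)
    then show ?case using step[of j] by (cases "i = Suc j") auto
  qed auto
  have xI: "x i \<in> {0<..<1}" if "0 < i" "i < N" for i
    using step[of 0] step[of i] xmono[of 1 i] xmono[of "Suc i" N] that x0 xN by auto
  have M1: "1 \<le> M"
  proof -
    have "1 \<le> exp (\<beta> * h / \<epsilon>)" using \<beta>_pos h eps by simp
    then show ?thesis using h by linarith
  qed
  have K0: "K \<ge> 0" using K_ge1 by simp
  have g0: "\<beta>1 - \<beta> > 0" "\<beta>1 - \<beta> - \<delta> > 0" using \<delta> \<beta>_less by auto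
  have P0: "P1 \<ge> 0" "P2 \<ge> 0" "P3 \<ge> 0" using K0 C_ge1 M1 \<beta>_pos \<delta> g0 by (auto simp: P1 P2 P3)
  define \<kappa> where "\<kappa> = \<beta> / (2 * \<epsilon>)"
  have \<kappa>0: "\<kappa> > 0" using eps \<beta>_pos by (simp add: \<kappa>_def)
  note Zb = barrier_bounds[where x = x and N = N, OF less_imp_le[OF \<kappa>0] step]
  define \<Theta> where "\<Theta> = \<epsilon> * d + E (x J)"
  have d0: "d > 0" using h by linarith
  have Th: "\<Theta> \<ge> 0" "\<epsilon> * d \<le> \<Theta>" "E (x J) \<le> \<Theta>" using d0 eps less_imp_le[OF E_pos[of "x J"]] by (auto simp: \<Theta>_def)
  define A1 where "A1 = (P1 * (1 + M) + P2) / \<beta> * \<Theta>"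
  \<comment> \<open>Fixed by \<open>A2 * \<kappa> * (\<beta>1 - \<beta>) = P1 * M * (d + h\<^sup>2 /
    \<epsilon>\<^sup>2)\<close>, the coefficient of the layer in the fine consistency error.\<close>
  define A2 where "A2 = 2 * P1 * M / (\<beta> * (\<beta>1 - \<beta>)) * (\<epsilon> * d + h\<^sup>2 / \<epsilon>)"
  \<comment> \<open>At \<open>i = J\<close>, \<kappa> times the barrier value at
    \<open>Suc J\<close> is \<open>\<beta> / (2 * \<epsilon> + \<beta> * H)\<close>, at least
    \<open>\<beta> / ((2 + \<beta>) * (H + \<epsilon>))\<close>; this accounts for
    \<open>2 + \<beta>\<close>. The 2 before \<open>\<Theta>\<close> comes from
    \<open>h + H \<le> 2 * d\<close>.\<close>
  define A3 where "A3 = P3 * (2 + \<beta>) / (\<beta> * (\<beta>1 - \<beta>)) * (2 * \<Theta>)"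
  have A0: "A1 \<ge> 0" "A2 \<ge> 0" "A3 \<ge> 0"
    using P0 M1 \<beta>_pos g0 Th eps d0 h by (auto simp: A1_def A2_def A3_def)
  define Y where "Y = (\<lambda>i. A1 * (1 - x i) + (A2 * barrier \<kappa> x 0 i + A3 * barrier \<kappa> x J i))"
  have pos: "\<epsilon> > 0" "b (x i) > 0" "x (i - 1) < x i" "x i < x (Suc i)" if "0 < i" "i < N" for i
    using eps b_pos[OF xI[OF that]] step[of i] step[of "i - 1"] that by auto
  have LY: "A1 * \<beta> + (A2 * (\<kappa> * (\<beta>1 - \<beta>) * barrier \<kappa> x 0 (Suc i))
        + A3 * (if J \<le> i then \<kappa> * (\<beta>1 - \<beta>) * barrier \<kappa> x J (Suc i) else 0))
      \<le> asi_op \<epsilon> b c x Y i" if i: "0 < i" "i < N" for i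
  proof -
    have bi: "\<beta>1 \<le> b (x i)" "c (x i) \<ge> 0" using b_lower c_nonneg xI[OF i] by auto
    have "asi_op \<epsilon> b c x Y i = A1 * (b (x i) + c (x i) * (1 - x i))
       + (A2 * asi_op \<epsilon> b c x (barrier \<kappa> x 0) i + A3 * asi_op \<epsilon> b c x (barrier \<kappa> x J) i)"
      unfolding Y_def asi_op_linear[where x = x and b = b and i = i, OF pos[OF i]] asi_op_linear_barrier[where x = x and i = i, OF pos(3,4)[OF i]] ..
    moreover have "A1 * \<beta> \<le> A1 * (b (x i) + c (x i) * (1 - x i))"
      using bi \<beta>_less xI[OF i] A0 by (intro mult_left_mono) (auto intro: add_increasing2)
    moreover have "A2 * (\<kappa> * (\<beta>1 - \<beta>) * barrier \<kappa> x 0 (Suc i)) \<le> A2 * asi_op \<epsilon> b c x (barrier \<kappa> x 0) i"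
      using asi_op_barrier[where b = b and c = c and x = x and N = N and i = i, OF eps(1) \<beta>_pos \<beta>_less bi step i \<kappa>_def, of 0] A0 by (intro mult_left_mono) auto
    moreover have "A3 * (if J \<le> i then \<kappa> * (\<beta>1 - \<beta>) * barrier \<kappa> x J (Suc i) else 0) \<le> A3 * asi_op \<epsilon> b c x (barrier \<kappa> x J) i"
      using asi_op_barrier[where b = b and c = c and x = x and N = N and i = i, OF eps(1) \<beta>_pos \<beta>_less bi step i \<kappa>_def, of J] A0 by (intro mult_left_mono) auto
    ultimately show ?thesis by linarith
  qed
  have A1\<beta>: "A1 * \<beta> = (P1 * (1 + M) + P2) * \<Theta>" using \<beta>_pos by (simp add: A1_def)
  have nonneg: "0 \<le> A2 * (\<kappa> * (\<beta>1 - \<beta>) * barrier \<kappa> x 0 (Suc i))"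
    "0 \<le> A3 * (if J \<le> i then \<kappa> * (\<beta>1 - \<beta>) * barrier \<kappa> x J (Suc i) else 0)" if "i < N" for i
    using A0 \<kappa>0 g0 Zb(1)[of "Suc i"] that by (auto intro!: mult_nonneg_nonneg simp: less_imp_le)
  have LU: "\<bar>asi_op \<epsilon> b c x (\<lambda>i. w (x i) - W i) i\<bar> \<le> asi_op \<epsilon> b c x Y i" if i: "0 < i" "i < N" for i
  proof -
    have diff: "asi_op \<epsilon> b c x (\<lambda>i. w (x i) - W i) i = asi_op \<epsilon> b c x (\<lambda>i. w (x i)) i - \<epsilon> * g (x i)"
      unfolding asi_op_linear(2)[where x = x and b = b and i = i, OF pos[OF i]] W(3)[OF i] ..
    have xprev: "0 \<le> x (i - 1)" "x (Suc i) \<le> 1"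
      using xmono[of 0 "i - 1"] xmono[of "Suc i" N] i x0 xN by auto
    consider "i < J" | "i = J" | "J < i" by linarith
    then show ?thesis
    proof cases
      case 1
      have s: "x i - x (i - 1) = h" "x (Suc i) - x i = h" using fine[of i] fine[of "i - 1"] 1 i by auto
      then have xe: "x (i - 1) = x i - h" "x (Suc i) = x i + h" by auto
      have "\<bar>asi_op \<epsilon> b c x (\<lambda>i. w (x i) - W i) i\<bar>
         \<le> P1 * (\<epsilon> * h + h\<^sup>2 + (h + h\<^sup>2 / \<epsilon>\<^sup>2) * E (x i))"
        using consistency_fine[OF h(1-3), of "x i"] xprev
        unfolding diff asi_op_uniform[where x = x and b = b and i = i and c = c and U = "\<lambda>i. w (x i)", OF eps(1) h(1) pos(2)[OF i] s] P1 xe by (simp add: algebra_simps)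
      also have "\<dots> \<le> P1 * ((1 + M) * \<Theta> + (d + h\<^sup>2 / \<epsilon>\<^sup>2) * (M * barrier \<kappa> x 0 (Suc i)))"
      proof (intro mult_left_mono add_mono mult_mono)
        have "\<epsilon> * h \<le> \<epsilon> * d" using h eps by (intro mult_left_mono) auto
        moreover have "h * h \<le> (M * \<epsilon>) * d" using h M1 eps by (intro mult_mono) auto
        moreover have "(1 + M) * (\<epsilon> * d) \<le> (1 + M) * \<Theta>" using Th M1 by (intro mult_left_mono) auto
        ultimately show "\<epsilon> * h + h\<^sup>2 \<le> (1 + M) * \<Theta>" by (simp add: algebra_simps power2_eq_square)
        \<comment> \<open>The barrier image involves the value at \<open>Suc i\<close>, one step
          further right than the layer value; the shift costs
          \<open>exp (\<kappa> * h) \<le> M\<close>.\<close>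
        have "E (x i) \<le> exp (- \<kappa> * x i)"
        proof -
          have "\<kappa> * x i \<le> \<beta> / \<epsilon> * x i"
            using eps \<beta>_pos xI[OF i] unfolding \<kappa>_def by (intro mult_right_mono divide_left_mono) auto
          then show ?thesis by (simp add: E_def)
        qed
        also have "\<dots> = exp (\<kappa> * h) * exp (- \<kappa> * (x (Suc i) - x 0))"
          by (simp add: xe x0 exp_add[symmetric] algebra_simps)
        also have "\<dots> \<le> M * barrier \<kappa> x 0 (Suc i)"
        proof (intro mult_mono)
          have "\<kappa> * h \<le> \<beta> * h / \<epsilon>" using eps \<beta>_pos h by (simp add: \<kappa>_def field_simps)
          then show "exp (\<kappa> * h) \<le> M" using h(3) by (meson exp_le_cancel_iff order_trans)
          show "exp (- \<kappa> * (x (Suc i) - x 0)) \<le> barrier \<kappa> x 0 (Suc i)"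
            using barrier_ge_exp[where x = x and N = N, OF less_imp_le[OF \<kappa>0] step, of "Suc i"] i by simp
        qed (use M1 in auto)
        finally show "E (x i) \<le> M * barrier \<kappa> x 0 (Suc i)" .
      qed (use h P0 d0 in \<open>auto simp: less_imp_le\<close>)
      also have "\<dots> = P1 * (1 + M) * \<Theta> + A2 * (\<kappa> * (\<beta>1 - \<beta>) * barrier \<kappa> x 0 (Suc i))"
      proof -
        have "A2 * (\<kappa> * (\<beta>1 - \<beta>)) = P1 * M * (d + h\<^sup>2 / \<epsilon>\<^sup>2)"
          using g0 \<beta>_pos eps by (simp add: A2_def \<kappa>_def field_simps power2_eq_square)
        then have "A2 * (\<kappa> * (\<beta>1 - \<beta>) * z) = P1 * M * (d + h\<^sup>2 / \<epsilon>\<^sup>2) * z" for z by (metis mult.assoc)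
        moreover have "P1 * ((1 + M) * \<Theta> + D * (M * z)) = P1 * (1 + M) * \<Theta> + P1 * M * D * z" for D z
          by (simp add: algebra_simps)
        ultimately show ?thesis by (simp only:)
      qed
      also have "\<dots> \<le> A1 * \<beta> + A2 * (\<kappa> * (\<beta>1 - \<beta>) * barrier \<kappa> x 0 (Suc i))"
        using P0 Th by (simp add: A1\<beta> distrib_right)
      finally show ?thesis using LY[OF i] nonneg[OF i(2)] by linarith
    next
      case 3
      have s: "x i - x (i - 1) = H" "x (Suc i) - x i = H" using coarse[of i] coarse[of "i - 1"] 3 i by auto
      then have xe: "x (i - 1) = x i - H" "x (Suc i) = x i + H" by auto
      have "\<bar>asi_op \<epsilon> b c x (\<lambda>i. w (x i) - W i) i\<bar> \<le> P2 * (\<epsilon> * H + E (x i))"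
        using consistency_coarse[OF H(1) _ _ \<delta>, of "x i"] xprev
        unfolding diff asi_op_uniform[where x = x and b = b and i = i and c = c and U = "\<lambda>i. w (x i)", OF eps(1) H(1) pos(2)[OF i] s] P2 xe by (simp add: algebra_simps)
      also have "\<dots> \<le> P2 * \<Theta>" unfolding \<Theta>_def
        using H eps E_mono[OF xmono[of J i]] 3 i P0 by (intro mult_left_mono add_mono) auto
      also have "\<dots> \<le> A1 * \<beta>" using P0 Th M1 by (simp add: A1\<beta> distrib_right)
      finally show ?thesis using LY[OF i] nonneg[OF i(2)] by linarith
    next
      case 2
      have s: "x i - x (i - 1) = h" "x (Suc i) - x i = H" using fine[of "i - 1"] coarse[of i] 2 i by auto
      then have xe: "x (i - 1) = x i - h" "x (Suc i) = x i + H" by auto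
      let ?\<rho> = "b (x i) * H / (2 * \<epsilon>)"
      let ?A = "- \<epsilon> * sigma ?\<rho> * (((w (x i + H) - w (x i)) / H - (w (x i) - w (x i - h)) / h) / ((h + H) / 2))
       - b (x i) * ((w (x i + H) - w (x i)) / H)"
      have A: "asi_op \<epsilon> b c x (\<lambda>i. w (x i)) i = ?A + c (x i) * w (x i)"
        unfolding asi_op_def Let_def s unfolding xe ..
      have "\<bar>?A - (\<epsilon> * g (x i) - c (x i) * w (x i))\<bar> * (H + \<epsilon>) \<le> P3 * (\<epsilon> * (h + H) + E (x i))"
        unfolding P3 by (rule consistency_transition[OF h(1) H(1) h(2,3) _ _ refl refl]) (use xprev xe in auto)
      also have "\<dots> \<le> P3 * (2 * \<Theta>)"
      proof (rule mult_left_mono[OF _ P0(3)])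
        have "\<epsilon> * (h + H) \<le> \<epsilon> * (d + d)" using h H eps by (intro mult_left_mono) auto
        then show "\<epsilon> * (h + H) + E (x i) \<le> 2 * \<Theta>"
          using less_imp_le[OF E_pos[of "x J"]] by (simp add: \<Theta>_def 2 algebra_simps)
      qed
      finally have "\<bar>asi_op \<epsilon> b c x (\<lambda>i. w (x i) - W i) i\<bar> * (H + \<epsilon>) \<le> P3 * (2 * \<Theta>)"
        unfolding diff A by (simp add: algebra_simps)
      then have "\<bar>asi_op \<epsilon> b c x (\<lambda>i. w (x i) - W i) i\<bar> \<le> P3 * (2 * \<Theta>) / (H + \<epsilon>)"
        using H eps by (simp add: pos_le_divide_eq)
      also have "\<dots> \<le> A3 * (\<kappa> * (\<beta>1 - \<beta>) * barrier \<kappa> x J (Suc i))"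
      proof -
        have "barrier \<kappa> x J (Suc i) = 1 / (1 + \<kappa> * H)"
          using barrier_Suc[of J i \<kappa> x] 2 s by (simp add: barrier_le)
        then have "\<kappa> * barrier \<kappa> x J (Suc i) = \<beta> / (2 * \<epsilon> + \<beta> * H)"
          using eps \<beta>_pos H by (simp add: \<kappa>_def field_simps)
        moreover have "\<beta> / ((2 + \<beta>) * (H + \<epsilon>)) \<le> \<beta> / (2 * \<epsilon> + \<beta> * H)"
          using eps \<beta>_pos H by (intro divide_left_mono mult_pos_pos add_pos_pos) (auto simp: algebra_simps)
        ultimately have "\<beta> / ((2 + \<beta>) * (H + \<epsilon>)) \<le> \<kappa> * barrier \<kappa> x J (Suc i)" by simp
        then have "A3 * (\<beta>1 - \<beta>) * (\<beta> / ((2 + \<beta>) * (H + \<epsilon>))) \<le> A3 * (\<beta>1 - \<beta>) * (\<kappa> * barrier \<kappa> x J (Suc i))"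
          using A0 g0 by (intro mult_left_mono) auto
        moreover have "A3 * (\<beta>1 - \<beta>) * (\<beta> / ((2 + \<beta>) * (H + \<epsilon>))) = P3 * (2 * \<Theta>) / (H + \<epsilon>)"
        proof -
          have "p * t / (\<beta> * (\<beta>1 - \<beta>)) * r * (\<beta>1 - \<beta>) * (\<beta> / (t * v)) = p * r / v" if "t > 0" "v > 0" for p r t v
            using \<beta>_pos g0 that by (simp add: divide_simps)
          from this[of "2 + \<beta>" "H + \<epsilon>" P3 "2 * \<Theta>"] show ?thesis
            using \<beta>_pos H eps by (simp add: A3_def)
        qed
        ultimately show ?thesis by (simp add: mult_ac)
      qed
      finally have "\<bar>asi_op \<epsilon> b c x (\<lambda>i. w (x i) - W i) i\<bar> \<le> A3 * (if J \<le> i then \<kappa> * (\<beta>1 - \<beta>) * barrier \<kappa> x J (Suc i) else 0)"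
        using 2 by simp
      moreover have "0 \<le> A1 * \<beta>" using A0 \<beta>_pos by simp
      ultimately show ?thesis using LY[OF i] nonneg(1)[OF i(2)] by linarith
    qed
  qed
  have Y: "Y i \<le> A1 + (A2 + A3)" "0 \<le> Y i" if "i \<le> N" for i
  proof -
    have "0 \<le> x i" "x i \<le> 1" using xmono[of 0 i] xmono[of i N] that x0 xN by auto
    moreover have "0 \<le> barrier \<kappa> x m i" "barrier \<kappa> x m i \<le> 1" for m using Zb[of i m] that by (auto simp: less_imp_le)
    ultimately have "A1 * (1 - x i) \<le> A1 * 1" "A2 * barrier \<kappa> x 0 i \<le> A2 * 1" "A3 * barrier \<kappa> x J i \<le> A3 * 1"
      "0 \<le> A1 * (1 - x i)" "0 \<le> A2 * barrier \<kappa> x 0 i" "0 \<le> A3 * barrier \<kappa> x J i"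
      using A0 by (simp_all add: mult_left_le)
    then show "Y i \<le> A1 + (A2 + A3)" "0 \<le> Y i" unfolding Y_def by linarith+
  qed
  have "w 1 = 0" using sol by (simp add: solution_def)
  then have bc: "\<bar>w (x 0) - W 0\<bar> \<le> Y 0" "\<bar>w (x N) - W N\<bar> \<le> Y N"
    using Y(2)[of 0] Y(2)[of N] W(1,2) x0 xN by auto
  have "\<bar>w (x i) - W i\<bar> \<le> Y i"
    by (rule asi_op_comparison[where b = b and c = c and x = x and N = N and i = i and Y = Y
          and U = "\<lambda>i. w (x i) - W i", OF eps(1) pos(2) c_nonneg[OF xI] step LU bc i])
  also have "\<dots> \<le> A1 + (A2 + A3)" by (rule Y(1)[OF i])
  also have "\<dots> \<le> ((P1 * (1 + M) + P2) / \<beta> + 2 * P1 * M / (\<beta> * (\<beta>1 - \<beta>)) + 2 * P3 * (2 + \<beta>) / (\<beta> * (\<beta>1 - \<beta>)))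
     * (\<epsilon> * d + E (x J) + h\<^sup>2 / \<epsilon>)"
  proof -
    define T where "T = \<epsilon> * d + E (x J) + h\<^sup>2 / \<epsilon>"
    have he: "0 \<le> h\<^sup>2 / \<epsilon>" using eps by simp
    have "\<Theta> \<le> T" "\<epsilon> * d + h\<^sup>2 / \<epsilon> \<le> T" using he less_imp_le[OF E_pos[of "x J"]] by (auto simp: T_def \<Theta>_def)
    then have "A1 \<le> (P1 * (1 + M) + P2) / \<beta> * T" "A2 \<le> 2 * P1 * M / (\<beta> * (\<beta>1 - \<beta>)) * T"
      and A3: "A3 \<le> P3 * (2 + \<beta>) / (\<beta> * (\<beta>1 - \<beta>)) * (2 * T)"
      unfolding A1_def A2_def A3_def using P0 M1 \<beta>_pos g0 by (intro mult_left_mono; simp)+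
    moreover have "A3 \<le> 2 * P3 * (2 + \<beta>) / (\<beta> * (\<beta>1 - \<beta>)) * T"
      using A3 by (simp add: mult_ac)
    moreover have "p + (q + r) \<le> (k + l + m) * T" if "p \<le> k * T" "q \<le> l * T" "r \<le> m * T" for p q r k l m
      using that unfolding distrib_right by linarith
    ultimately show ?thesis unfolding T_def[symmetric] by blast
  qed
  finally show ?thesis .
qed

end

section \<open>The error estimate\<close>

theorem theorem4:
  fixes b c f u0 :: "real \<Rightarrow> real" and \<beta> a Q :: real
  assumes Cb: "Ck_on 4 {0..1} b" and Cc: "Ck_on 4 {0..1} c" and Cf: "Ck_on 4 {0..1} f"
    and beta_pos: "\<beta> > 0"
    and b_gt: "\<forall>x\<in>{0..1}. b x > \<beta>"
    and c_nonneg: "\<forall>x\<in>{0..1}. c x \<ge> 0"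
    and Q_rat: "Q \<in> \<rat>" and Q_pos: "0 < Q" and Q_lt1: "Q < 1"
    and a_pos: "a > 0"
    and a_ge: "a \<ge> min 3 (max 1 (\<beta> / (b 0 - \<beta>)))"
    and u0_cont: "continuous_on {0..1} u0"
    and u0_bc: "u0 1 = 0"
    and u0_eq: "\<forall>x\<in>{0<..<1}. \<exists>d. (u0 has_real_derivative d) (at x) \<and>
                   - b x * d + c x * u0 x = f x"
  shows "\<exists>C. \<forall>(\<epsilon>::real) (N::nat) (J::nat) (u::real \<Rightarrow> real) (W::nat \<Rightarrow> real).
    0 < \<epsilon> \<and> \<epsilon> < 1 \<and> N > 0 \<and> real J = Q * real N \<and>
    shishkin_xi a \<beta> \<epsilon> N \<le> Q \<and>
    continuous_on {0..1} u \<and> u 0 = 0 \<and> u 1 = 0 \<and>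
    (\<forall>x\<in>{0<..<1}. \<exists>d1 d2. (u has_real_derivative d1) (at x) \<and>
        (deriv u has_real_derivative d2) (at x) \<and>
        - \<epsilon> * d2 - b x * d1 + c x * u x = f x) \<and>
    W 0 = - u0 0 \<and> W N = 0 \<and>
    (\<forall>i\<in>{1..N-1}. asi_op \<epsilon> b c (mesh (shishkin_xi a \<beta> \<epsilon> N) J N) W i
         = \<epsilon> * deriv (deriv u0) (mesh (shishkin_xi a \<beta> \<epsilon> N) J N i))
    \<longrightarrow>
    (MAX i\<in>{0..N}. \<bar>(u (mesh (shishkin_xi a \<beta> \<epsilon> N) J N i)
                        - u0 (mesh (shishkin_xi a \<beta> \<epsilon> N) J N i)) - W i\<bar>)
      \<le> C * max (\<epsilon> * real N powr (-2) * (ln (real N))\<^sup>2)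
                 (\<epsilon> * real N powr (-1) + real N powr (- (a + 1) / 2))"
proof -

  \<comment> \<open>Regularity of the data and the reduced solution\<close>
  have two_le: "2 \<le> (4::nat)" by simp
  obtain b1 b2 where b: "continuous_on {0..1} b" "continuous_on {0..1} b1" "continuous_on {0..1} b2"
      "\<And>x. x \<in> {0<..<1} \<Longrightarrow> (b has_real_derivative b1 x) (at x)"
      "\<And>x. x \<in> {0<..<1} \<Longrightarrow> (b1 has_real_derivative b2 x) (at x)"
    by (rule Ck_on_two_derivs[OF Cb two_le]) blast
  obtain c1 c2 where c: "continuous_on {0..1} c" "continuous_on {0..1} c1" "continuous_on {0..1} c2"
      "\<And>x. x \<in> {0<..<1} \<Longrightarrow> (c has_real_derivative c1 x) (at x)"
      "\<And>x. x \<in> {0<..<1} \<Longrightarrow> (c1 has_real_derivative c2 x) (at x)"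
    by (rule Ck_on_two_derivs[OF Cc two_le]) blast
  obtain f1 f2 where f: "continuous_on {0..1} f" "continuous_on {0..1} f1" "continuous_on {0..1} f2"
      "\<And>x. x \<in> {0<..<1} \<Longrightarrow> (f has_real_derivative f1 x) (at x)"
      "\<And>x. x \<in> {0<..<1} \<Longrightarrow> (f1 has_real_derivative f2 x) (at x)"
    by (rule Ck_on_two_derivs[OF Cf two_le]) blast
  \<comment> \<open>Compactness turns the strict pointwise bound \<open>b x > \<beta>\<close> into
    the uniform gap between \<beta> and the minimum \<beta>1.\<close>
  obtain x0 where x0: "x0 \<in> {0..1}" "\<And>x. x \<in> {0..1} \<Longrightarrow> b x0 \<le> b x"
    using continuous_attains_inf[of "{0..1::real}" b] b(1) by auto
  define \<beta>1 where "\<beta>1 = b x0"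
  have \<beta>1: "\<beta> < \<beta>1" "\<And>x. x \<in> {0..1} \<Longrightarrow> \<beta>1 \<le> b x" using x0 b_gt by (auto simp: \<beta>1_def)
  have bnz: "b x \<noteq> 0" if "x \<in> {0..1}" for x using \<beta>1 beta_pos that by force

  define v where "v = (\<lambda>x. (c x * u0 x - f x) / b x)"
  \<comment> \<open>Obtained by differentiating \<open>b * v = c * u0 - f\<close> with
    \<open>v\<close> the derivative of \<open>u0\<close>. This formula involves only first
    derivatives of the data.\<close>
  define g where "g = (\<lambda>x. ((c1 x * u0 x - f1 x) - (b1 x - c x) * v x) / b x)"
  have v_cont: "continuous_on {0..1} v" unfolding v_def
    using bnz by (intro continuous_intros b c f u0_cont) auto
  have u0': "(u0 has_real_derivative v x) (at x)" if x: "x \<in> {0<..<1}" for x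
  proof -
    obtain d where d: "(u0 has_real_derivative d) (at x)" "- b x * d + c x * u0 x = f x" using u0_eq x by blast
    then have "d = v x" using bnz[of x] x by (simp add: v_def field_simps)
    then show ?thesis using d by simp
  qed
  have v': "(v has_real_derivative g x) (at x)" if x: "x \<in> {0<..<1}" for x
  proof -
    have "b x \<noteq> 0" using bnz x by auto
    then have "(v has_real_derivative ((c1 x * u0 x + c x * v x - f1 x) * b x - (c x * u0 x - f x) * b1 x) / (b x * b x)) (at x)"
      unfolding v_def using x
      by (auto intro!: derivative_eq_intros b c f u0'[unfolded v_def])
    moreover have "((c1 x * u0 x + c x * v x - f1 x) * b x - (c x * u0 x - f x) * b1 x) / (b x * b x) = g x"
    proof -
      have "c x * u0 x - f x = v x * b x" using \<open>b x \<noteq> 0\<close> by (simp add: v_def)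
      then show ?thesis using \<open>b x \<noteq> 0\<close> unfolding g_def by (simp add: field_simps)
    qed
    ultimately show ?thesis by simp
  qed
  have ddu0: "(deriv u0 has_real_derivative g x) (at x)" "deriv (deriv u0) x = g x" "deriv u0 x = v x"
    if x: "x \<in> {0<..<1}" for x
  proof -
    \<comment> \<open>\<open>deriv (deriv u0)\<close> at \<open>x\<close> depends on
      \<open>deriv u0\<close> near \<open>x\<close>, so equality with \<open>v\<close> is needed on
      a neighbourhood and not just at the point.\<close>
    have ev: "\<forall>\<^sub>F y in nhds x. deriv u0 y = v y"
    proof (rule eventually_mono)
      show "\<forall>\<^sub>F y in nhds x. y \<in> {0<..<1}" using x by (intro eventually_nhds_in_open) auto
      show "deriv u0 y = v y" if "y \<in> {0<..<1}" for y by (rule DERIV_imp_deriv[OF u0'[OF that]])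
    qed
    show "(deriv u0 has_real_derivative g x) (at x)"
      using DERIV_cong_ev[OF refl ev refl] v'[OF x] by simp
    then show "deriv (deriv u0) x = g x" by (rule DERIV_imp_deriv)
    show "deriv u0 x = v x" by (rule DERIV_imp_deriv[OF u0'[OF x]])
  qed

  \<comment> \<open>Uniform bounds and choice of constants\<close>
  have lip: "bounded_lipschitz b" "bounded_lipschitz b1" "bounded_lipschitz c" "bounded_lipschitz c1"
      "bounded_lipschitz f" "bounded_lipschitz f1" "bounded_lipschitz u0"
    by (rule bounded_lipschitz_of_deriv[OF b(1,2,4)] bounded_lipschitz_of_deriv[OF b(2,3,5)]
      bounded_lipschitz_of_deriv[OF c(1,2,4)] bounded_lipschitz_of_deriv[OF c(2,3,5)]
      bounded_lipschitz_of_deriv[OF f(1,2,4)] bounded_lipschitz_of_deriv[OF f(2,3,5)]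
      bounded_lipschitz_of_deriv[OF u0_cont v_cont u0']; assumption)+
  have "bounded_lipschitz (\<lambda>x. 1 / b x)"
    using \<beta>1 beta_pos by (intro bounded_lipschitz_inverse[OF lip(1), of \<beta>1]) auto
  note lip_div = bounded_lipschitz_mult[OF _ this, simplified]
  have lip_v: "bounded_lipschitz v" unfolding v_def
    by (intro lip_div bounded_lipschitz_diff bounded_lipschitz_mult lip)
  have lip_g: "bounded_lipschitz g" unfolding g_def
    by (intro lip_div bounded_lipschitz_diff bounded_lipschitz_mult lip lip_v)
  obtain Kb where Kb: "Kb \<ge> 0" "\<And>x. x \<in> {0<..<1} \<Longrightarrow> \<bar>b x\<bar> \<le> Kb"
    "\<And>x y. x \<in> {0<..<1} \<Longrightarrow> y \<in> {0<..<1} \<Longrightarrow> \<bar>b x - b y\<bar> \<le> Kb * \<bar>x - y\<bar>"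
    using lip(1) by (elim bounded_lipschitzE) blast
  obtain Kb1 where Kb1: "Kb1 \<ge> 0" "\<And>x. x \<in> {0<..<1} \<Longrightarrow> \<bar>b1 x\<bar> \<le> Kb1"
    "\<And>x y. x \<in> {0<..<1} \<Longrightarrow> y \<in> {0<..<1} \<Longrightarrow> \<bar>b1 x - b1 y\<bar> \<le> Kb1 * \<bar>x - y\<bar>"
    using lip(2) by (elim bounded_lipschitzE) blast
  obtain Kc where Kc: "Kc \<ge> 0" "\<And>x. x \<in> {0<..<1} \<Longrightarrow> \<bar>c x\<bar> \<le> Kc"
    "\<And>x y. x \<in> {0<..<1} \<Longrightarrow> y \<in> {0<..<1} \<Longrightarrow> \<bar>c x - c y\<bar> \<le> Kc * \<bar>x - y\<bar>"
    using lip(3) by (elim bounded_lipschitzE) blast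
  obtain Kg where Kg: "Kg \<ge> 0" "\<And>x. x \<in> {0<..<1} \<Longrightarrow> \<bar>g x\<bar> \<le> Kg"
    "\<And>x y. x \<in> {0<..<1} \<Longrightarrow> y \<in> {0<..<1} \<Longrightarrow> \<bar>g x - g y\<bar> \<le> Kg * \<bar>x - y\<bar>"
    using lip_g by (elim bounded_lipschitzE) blast
  \<comment> \<open>\<open>\<bar>u0 0\<bar>\<close> is included because \<open>solution\<close>
    requires \<open>K\<close> to bound the boundary value of \<open>w\<close>.\<close>
  define K where "K = 1 + Kb + Kb1 + Kc + Kg + \<bar>u0 0\<bar>"
  have KK: "1 \<le> K" "Kb \<le> K" "Kb1 \<le> K" "Kc \<le> K" "Kg \<le> K" "\<bar>u0 0\<bar> \<le> K"
    using Kb(1) Kb1(1) Kc(1) Kg(1) by (auto simp: K_def)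
  have up: "z \<le> K * r" if "z \<le> k * r" "k \<le> K" "0 \<le> r" for z k r :: real
    using that mult_right_mono[of k K r] by linarith

  interpret convection_diffusion b b1 c g \<beta> \<beta>1 K
  proof
    show "0 < \<beta>" "\<beta> < \<beta>1" "1 \<le> K" "continuous_on {0..1} b" using beta_pos \<beta>1 KK b by auto
    fix x :: real assume x: "x \<in> {0<..<1}"
    show "\<beta>1 \<le> b x" "0 \<le> c x" using x \<beta>1 c_nonneg by auto
    show "b x \<le> K" "\<bar>b1 x\<bar> \<le> K" "c x \<le> K" "\<bar>g x\<bar> \<le> K"
      using Kb(2)[OF x] Kb1(2)[OF x] Kc(2)[OF x] Kg(2)[OF x] KK by linarith+
    fix y :: real assume y: "y \<in> {0<..<1}"
    show "\<bar>b x - b y\<bar> \<le> K * \<bar>x - y\<bar>" "\<bar>c x - c y\<bar> \<le> K * \<bar>x - y\<bar>" "\<bar>g x - g y\<bar> \<le> K * \<bar>x - y\<bar>"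
      using up[OF Kb(3)[OF x y] KK(2)] up[OF Kc(3)[OF x y] KK(4)] up[OF Kg(3)[OF x y] KK(5)] by auto
    show "\<bar>b y - b x - b1 x * (y - x)\<bar> \<le> K * (y - x)\<^sup>2"
      using up[OF abs_taylor_le[OF b(4) Kb1(3) Kb1(1) y x] KK(3)] by simp
  qed
  obtain C where C: "C \<ge> 1"
    "\<And>\<epsilon> w w1 w2 x. solution \<epsilon> w w1 w2 \<Longrightarrow> x \<in> {0..1} \<Longrightarrow> \<bar>w x\<bar> \<le> C * (\<epsilon> + exp (- \<beta> * x / \<epsilon>))"
    "\<And>\<epsilon> w w1 w2 x. solution \<epsilon> w w1 w2 \<Longrightarrow> x \<in> {0<..<1} \<Longrightarrow> \<bar>w1 x\<bar> \<le> C * (\<epsilon> + exp (- \<beta> * x / \<epsilon>) / \<epsilon>)"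
    "\<And>\<epsilon> w w1 w2 x. solution \<epsilon> w w1 w2 \<Longrightarrow> x \<in> {0<..<1} \<Longrightarrow> \<bar>w2 x\<bar> \<le> C * (1 + exp (- \<beta> * x / \<epsilon>) / \<epsilon>\<^sup>2)"
    using derivative_bounds by blast

  \<comment> \<open>The fine step is \<open>h = \<epsilon> * k * ln N / N\<close>, hence
    \<open>h \<le> k * \<epsilon>\<close>. \<open>M\<close> then bounds both
    \<open>h / \<epsilon>\<close> and \<open>exp (\<beta> * h / \<epsilon>)\<close>.\<close>
  define k where "k = a / (\<beta> * Q)"
  define M where "M = k + exp (\<beta> * k)"
  define \<delta> where "\<delta> = min \<beta> (\<beta>1 - \<beta>) / 2"
  define P1 where "P1 = 4 * K\<^sup>2 * C * M\<^sup>2"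
  define P2 where "P2 = K * C * (4 + 1 / \<beta> + (2 / \<delta> + 1 / \<beta>) * (2 * K / (\<beta>1 - \<beta> - \<delta>)))"
  define P3 where "P3 = 100 * K\<^sup>2 * C * M\<^sup>2 * (1 + 1 / \<beta>)"
  define P where "P = (P1 * (1 + M) + P2) / \<beta> + 2 * P1 * M / (\<beta> * (\<beta>1 - \<beta>)) + 2 * P3 * (2 + \<beta>) / (\<beta> * (\<beta>1 - \<beta>))"
  have k: "k > 0" using a_pos beta_pos Q_pos by (simp add: k_def)
  have M: "k \<le> M" "exp (\<beta> * k) \<le> M" using k by (auto simp: M_def)
  have \<delta>: "0 < \<delta>" "\<delta> < \<beta>" "\<beta> + \<delta> < \<beta>1" using beta_pos \<beta>1(1) by (auto simp: \<delta>_def min_def field_simps)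
  have P: "P \<ge> 0"
  proof -
    have "P1 \<ge> 0" "P2 \<ge> 0" "P3 \<ge> 0" "M \<ge> 0" using KK C(1) beta_pos \<delta> k M by (auto simp: P1_def P2_def P3_def)
    then show ?thesis using beta_pos \<beta>1(1) by (simp add: P_def)
  qed
  have a1: "a \<ge> 1" using a_ge by (auto simp: min_def max_def split: if_splits)

  show ?thesis
  \<comment> \<open>The three summands pay for \<open>\<epsilon> * d\<close>, for
    \<open>E (x J)\<close> and for \<open>h\<^sup>2 / \<epsilon>\<close>, in this order.\<close>
  proof (intro exI[of _ "P * (1 / (1 - Q) + 1 + k\<^sup>2)"] allI impI, elim conjE)
    fix \<epsilon> :: real and N J :: nat and u :: "real \<Rightarrow> real" and W :: "nat \<Rightarrow> real"
    assume e: "0 < \<epsilon>" "\<epsilon> < 1" and N: "N > 0" and J: "real J = Q * real N"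
      and xi: "shishkin_xi a \<beta> \<epsilon> N \<le> Q"
      and u: "continuous_on {0..1} u" "u 0 = 0" "u 1 = 0"
      and u_eq: "\<forall>x\<in>{0<..<1}. \<exists>d1 d2. (u has_real_derivative d1) (at x) \<and>
        (deriv u has_real_derivative d2) (at x) \<and> - \<epsilon> * d2 - b x * d1 + c x * u x = f x"
      and W: "W 0 = - u0 0" "W N = 0"
      and W_eq: "\<forall>i\<in>{1..N-1}. asi_op \<epsilon> b c (mesh (shishkin_xi a \<beta> \<epsilon> N) J N) W i
         = \<epsilon> * deriv (deriv u0) (mesh (shishkin_xi a \<beta> \<epsilon> N) J N i)"

    \<comment> \<open>Mesh quantities\<close>
    define \<xi> where "\<xi> = shishkin_xi a \<beta> \<epsilon> N"
    define x where "x = mesh \<xi> J N"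
    define h where "h = \<xi> / real J"
    define H where "H = (1 - \<xi>) / real (N - J)"
    \<comment> \<open>A common bound of order \<open>1 / N\<close> for both steps:
      \<open>\<xi> \<le> Q\<close> gives \<open>h \<le> 1 / N\<close>, and
      \<open>1 - \<xi> \<le> 1\<close> gives \<open>H \<le> d\<close>.\<close>
    define d where "d = 1 / ((1 - Q) * real N)"
    have NJ: "0 < J" "J < N"
    proof -
      have "real J > 0" "real J < real N" using J Q_pos Q_lt1 N by auto
      then show "0 < J" "J < N" by auto
    qed
    \<comment> \<open>An integer lies strictly between 0 and \<open>N\<close>, so
      \<open>ln N\<close> is positive and the fine step does not degenerate.\<close>
    have rN: "real N \<ge> 2" using NJ by simp
    have lnN: "ln (real N) > 0" "ln (real N) \<le> real N" using rN ln_le_minus_one[of "real N"] by auto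
    have \<xi>: "\<xi> = a * \<epsilon> / \<beta> * ln (real N)" "0 < \<xi>" "\<xi> \<le> Q" "\<xi> < 1"
    proof -
      show "\<xi> = a * \<epsilon> / \<beta> * ln (real N)" by (simp add: \<xi>_def shishkin_xi_def)
      then show "0 < \<xi>" using a_pos e beta_pos lnN by simp
      show "\<xi> \<le> Q" using xi by (simp add: \<xi>_def)
      then show "\<xi> < 1" using Q_lt1 by linarith
    qed
    have d: "d > 0" using Q_lt1 N by (simp add: d_def)
    have NmJ: "real (N - J) = (1 - Q) * real N" using NJ J by (simp add: of_nat_diff algebra_simps)
    have h: "h = \<epsilon> * (k * (ln (real N) / real N))" "0 < h"
      using \<xi> J NJ beta_pos Q_pos by (auto simp: h_def k_def field_simps)
    have hk: "h \<le> k * \<epsilon>"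
    proof -
      have "h \<le> \<epsilon> * (k * 1)" unfolding h(1) using lnN k rN e by (intro mult_left_mono) auto
      then show ?thesis by (simp add: mult.commute)
    qed
    have hM: "h \<le> M * \<epsilon>" using hk mult_right_mono[OF M(1), of \<epsilon>] e by linarith
    have hexp: "exp (\<beta> * h / \<epsilon>) \<le> M"
    proof -
      have "\<beta> * h / \<epsilon> \<le> \<beta> * k" using hk e beta_pos by (simp add: pos_divide_le_eq mult.assoc)
      then show ?thesis using M(2) by (meson exp_le_cancel_iff order_trans)
    qed
    have hd: "h \<le> d"
    proof -
      have "h \<le> Q / (Q * real N)" unfolding h_def J using \<xi> Q_pos N by (intro divide_right_mono) auto
      also have "\<dots> = 1 / real N" using Q_pos by simp
      also have "\<dots> \<le> d" unfolding d_def using Q_pos Q_lt1 N by (intro frac_le) auto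
      finally show ?thesis .
    qed
    have H: "0 < H" "H \<le> d"
      using \<xi> NJ Q_lt1 N unfolding H_def d_def NmJ by (auto intro!: divide_right_mono)
    have xs: "x 0 = 0" "x N = 1" "x J = \<xi>"
      using NJ by (auto simp: x_def mesh_def)
    have fine: "x (Suc i) - x i = h" if "i < J" for i
      using that by (simp add: x_def mesh_def h_def algebra_simps add_divide_distrib)
    have coarse: "x (Suc i) - x i = H" if "J \<le> i" "i < N" for i
    proof (cases "i = J")
      case True
      then show ?thesis using that NJ by (simp add: x_def mesh_def H_def)
    next
      case False
      then have "real (Suc i - J) = real (i - J) + 1" using that by (simp add: Suc_diff_le)
      moreover have "x i = \<xi> + real (i - J) * H" "x (Suc i) = \<xi> + real (Suc i - J) * H"
        using that False by (auto simp: x_def mesh_def H_def)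
      ultimately show ?thesis by (simp only:) (simp add: algebra_simps)
    qed
    have xI: "x i \<in> {0<..<1}" if i: "0 < i" "i < N" for i
    proof (cases "i \<le> J")
      case True
      then have "real i * h \<le> real J * h" using h by (intro mult_right_mono) auto
      also have "\<dots> = \<xi>" using NJ by (simp add: h_def)
      finally have "real i * h < 1" using \<xi>(4) by linarith
      moreover have "x i = real i * h" using True by (simp add: x_def mesh_def h_def)
      moreover have "0 < real i * h" using i h(2) by simp
      ultimately show ?thesis by simp
    next
      case False
      then have "real (i - J) * H < real (N - J) * H" using H i by (intro mult_strict_right_mono) auto
      also have "\<dots> = 1 - \<xi>" using NJ by (simp add: H_def)
      finally have "real (i - J) * H < 1 - \<xi>" .
      moreover have "x i = \<xi> + real (i - J) * H" using False by (simp add: x_def mesh_def H_def)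
      moreover have "0 \<le> real (i - J) * H" using H by simp
      ultimately show ?thesis using \<xi>(2) by simp
    qed

    \<comment> \<open>The remainder as a solution, and the final bound\<close>
    define w where "w = (\<lambda>x. u x - u0 x)"
    define w1 where "w1 = (\<lambda>x. deriv u x - deriv u0 x)"
    define w2 where "w2 = (\<lambda>x. deriv (deriv u) x - deriv (deriv u0) x)"
    have sol: "solution \<epsilon> w w1 w2" unfolding solution_def
    proof (intro conjI ballI)
      show "continuous_on {0..1} w" unfolding w_def by (intro continuous_intros u u0_cont)
      show "\<bar>w 0\<bar> \<le> K" "w 1 = 0" using u u0_bc KK by (auto simp: w_def)
      fix y :: real assume y: "y \<in> {0<..<1}"
      obtain d1 d2 where d: "(u has_real_derivative d1) (at y)" "(deriv u has_real_derivative d2) (at y)"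
        "- \<epsilon> * d2 - b y * d1 + c y * u y = f y" using u_eq y by blast
      have ud: "deriv u y = d1" "deriv (deriv u) y = d2" using d by (auto intro: DERIV_imp_deriv)
      show "(w has_real_derivative w1 y) (at y)" "(w1 has_real_derivative w2 y) (at y)"
        unfolding w_def w1_def w2_def ud using d ddu0[OF y] u0'[OF y] by (auto intro!: DERIV_diff)
      have "f y = - b y * v y + c y * u0 y" using y bnz[of y] by (simp add: v_def)
      then show "- \<epsilon> * w2 y - b y * w1 y + c y * w y = \<epsilon> * g y"
        using d(3) unfolding w_def w1_def w2_def ud ddu0[OF y] by (simp add: algebra_simps)
    qed (use e in auto)
    interpret layer_solution b b1 c g \<beta> \<beta>1 K \<epsilon> w w1 w2 C
      using sol C by unfold_locales blast+
    define T where "T = max (\<epsilon> * real N powr (-2) * (ln (real N))\<^sup>2)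
                 (\<epsilon> * real N powr (-1) + real N powr (- (a + 1) / 2))"
    have bound: "\<epsilon> * d + E (x J) + h\<^sup>2 / \<epsilon> \<le> (1 / (1 - Q) + 1 + k\<^sup>2) * T"
    proof -
      have T: "\<epsilon> * real N powr (-2) * (ln (real N))\<^sup>2 \<le> T" "\<epsilon> * real N powr (-1) \<le> T" "real N powr (- (a + 1) / 2) \<le> T"
        using e by (auto simp: T_def max_def intro: add_increasing add_increasing2 order_trans[rotated])
      have "\<epsilon> * d = 1 / (1 - Q) * (\<epsilon> * real N powr (-1))"
        using N by (simp add: d_def powr_minus field_simps)
      also have "\<dots> \<le> 1 / (1 - Q) * T" using T Q_lt1 by (intro mult_left_mono) auto
      finally have 1: "\<epsilon> * d \<le> 1 / (1 - Q) * T" .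
      \<comment> \<open>This is what the transition point is chosen for:
        \<open>\<beta> * \<xi> / \<epsilon> = a * ln N\<close>.\<close>
      have "E (x J) = real N powr (- a)"
        using N beta_pos e by (simp add: E_def xs \<xi>(1) powr_def)
      also have "\<dots> \<le> real N powr (- (a + 1) / 2)" using a1 rN by (intro powr_mono) auto
      finally have 2: "E (x J) \<le> 1 * T" using T by simp
      have "h\<^sup>2 / \<epsilon> = k\<^sup>2 * (\<epsilon> * real N powr (-2) * (ln (real N))\<^sup>2)"
        using N e by (simp add: h(1) powr_minus powr_numeral power_mult_distrib power_divide power2_eq_square field_simps)
      also have "\<dots> \<le> k\<^sup>2 * T" using T by (intro mult_left_mono) auto
      finally have 3: "h\<^sup>2 / \<epsilon> \<le> k\<^sup>2 * T" .
      show ?thesis using 1 2 3 unfolding distrib_right by linarith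
    qed
    have err: "\<bar>w (x i) - W i\<bar> \<le> P * (1 / (1 - Q) + 1 + k\<^sup>2) * T" if i: "i \<le> N" for i
    proof -
      have "\<bar>w (x i) - W i\<bar> \<le> P * (\<epsilon> * d + E (x J) + h\<^sup>2 / \<epsilon>)"
        unfolding P_def
      proof (rule discrete_error[where x = x and J = J and N = N and W = W and h = h and H = H and i = i, OF NJ xs(1,2) fine coarse h(2) hM hexp hd H _ W(2) _ \<delta> P1_def P2_def P3_def i])
        show "W 0 = w 0" using W u by (simp add: w_def)
        show "asi_op \<epsilon> b c x W i = \<epsilon> * g (x i)" if "0 < i" "i < N" for i
          using W_eq ddu0(2)[OF xI[OF that]] that by (auto simp: x_def \<xi>_def)
      qed
      also have "\<dots> \<le> P * ((1 / (1 - Q) + 1 + k\<^sup>2) * T)" using bound P by (intro mult_left_mono)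
      finally show ?thesis by (simp add: mult.assoc)
    qed
    show "(MAX i\<in>{0..N}. \<bar>(u (mesh (shishkin_xi a \<beta> \<epsilon> N) J N i)
                        - u0 (mesh (shishkin_xi a \<beta> \<epsilon> N) J N i)) - W i\<bar>)
      \<le> P * (1 / (1 - Q) + 1 + k\<^sup>2) * max (\<epsilon> * real N powr (-2) * (ln (real N))\<^sup>2)
                 (\<epsilon> * real N powr (-1) + real N powr (- (a + 1) / 2))"
      unfolding \<xi>_def[symmetric] x_def[symmetric] T_def[symmetric]
      using err by (intro Max.boundedI) (auto simp: w_def)
  qed
qed

end
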